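(* Let $\mathcal G$ be a graph of groups with trivial edge groups, and suppose that the word problem in each vertex group is solvable on a Turing machine in time $\preceq f(n)$ for some convex function $f(n)\geq n$. Then the word problem in $G=\pi_1(\mathcal G)$ is solvable on a Turing machine in time $\preceq \log(n)f(n)$.
   Context: All Turing machines are multi-tape. For monotone functions $f,g:\mathbb N\to\mathbb R$, $f\preceq g$ means that there is a positive integer $C$ with $f(n)\le C\,g(Cn+C)+Cn+C$ for all $n$. An algorithm runs in time $\preceq f(n)$ if its running time on inputs of length $n$ is bounded by some function $g(n)$ with $g\preceq f$. The word problem in a finitely generated group asks, given a word in a fixed finite generating set and inverses, to decide whether it represents the trivial element; its complexity up to $\preceq$ in both directions does not depend on the finite generating set. Graphs $\Gamma$ are finite and connected, with vertex set $V(\Gamma)$ and set of directed edges $E(\Gamma)$; each edge $\alpha$ has an initial vertex $\alpha^-$ and a terminal vertex $\alpha^+$, and there is a reverse edge $\bar\alpha\in E(\Gamma)$ with $\bar\alpha^+=\alpha^-$, $\bar\alpha^-=\alpha^+$. Loops and multiple edges are allowed. A graph of groups is a tuple $\mathcal G=(\Gamma,\{G_\mu\}_{\mu\in V(\Gamma)},\{G_\alpha\}_{\alpha\in E(\Gamma)},\{\tau_\alpha\})$ of vertex groups $G_\mu$, edge groups $G_\alpha=G_{\bar\alpha}$, and injective homomorphisms $\tau_\alpha:G_\alpha\to G_{\alpha^+}$. Fixing a spanning tree of $\Gamma$, $\pi_1(\mathcal G)$ is the quotient of $(\ast_{\mu}G_\mu)\ast(\ast_{\alpha}\langle t_\alpha\rangle)$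 by the relations $t_\alpha=t_{\bar\alpha}^{-1}$; $t_\alpha=1$ if $\alpha$ is in the spanning tree; and $t_\alpha\tau_\alpha(x)t_\alpha^{-1}=\tau_{\bar\alpha}(x)$ for all edges $\alpha$ and $x\in G_\alpha$. *)

theory Defs
  imports Complex_Main
    "HOL-Algebra.Generated_Groups"
    "HOL-Algebra.Elementary_Groups"
    "Graph_Theory.Digraph_Component"
    "Graph_Theory.Bidirected_Digraph"
begin

section \<open>Multi-tape Turing machines\<close>

text \<open>
  A deterministic machine over an input alphabet \<open>A :: 'a set\<close>. States are the numbers below
  \<open>tm_states M\<close>; tape symbols are the blank, the input letters and finitely many auxiliary
  symbols. The transition function maps a state and the list of symbols under the heads to a new
  state and, for each tape, the symbol to write and the move of its head. Tapes are infinite in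
  both directions and the input is written on the first one.
\<close>

datatype 'a symb = Blank | Letter 'a | Aux nat

datatype move = MLeft | MStay | MRight

record 'a tm =
  tm_tapes :: nat
  tm_states :: nat
  tm_aux :: nat
  tm_start :: nat
  tm_accept :: nat
  tm_reject :: nat
  tm_delta :: "nat \<Rightarrow> 'a symb list \<Rightarrow> nat \<times> ('a symb \<times> move) list"

definition tm_symbols :: "'a set \<Rightarrow> 'a tm \<Rightarrow> 'a symb set" where
  "tm_symbols A M = insert Blank (Letter ` A \<union> Aux ` {..<tm_aux M})"

definition wf_tm :: "'a set \<Rightarrow> 'a tm \<Rightarrow> bool" where
  "wf_tm A M \<longleftrightarrow>
     finite A \<and> 1 \<le> tm_tapes M \<and>
     tm_start M < tm_states M \<and> tm_accept M < tm_states M \<and> tm_reject M < tm_states M \<and>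
     tm_accept M \<noteq> tm_reject M \<and>
     (\<forall>q < tm_states M. \<forall>xs \<in> lists (tm_symbols A M). length xs = tm_tapes M \<longrightarrow>
        fst (tm_delta M q xs) < tm_states M \<and>
        length (snd (tm_delta M q xs)) = tm_tapes M \<and>
        fst ` set (snd (tm_delta M q xs)) \<subseteq> tm_symbols A M)"

text \<open>A tape is given by the position of its head and its contents.\<close>

type_synonym 'a tape = "int \<times> (int \<Rightarrow> 'a symb)"
type_synonym 'a tm_config = "nat \<times> 'a tape list"

definition tape_read :: "'a tape \<Rightarrow> 'a symb" where
  "tape_read T = snd T (fst T)"

fun move_offset :: "move \<Rightarrow> int" where
  "move_offset MLeft = - 1"
| "move_offset MStay = 0"
| "move_offset MRight = 1"

definition tape_act :: "'a symb \<times> move \<Rightarrow> 'a tape \<Rightarrow> 'a tape" where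
  "tape_act a T = (fst T + move_offset (snd a), (snd T)(fst T := fst a))"

text \<open>Configurations in the accepting or the rejecting state are final.\<close>

definition tm_step :: "'a tm \<Rightarrow> 'a tm_config \<Rightarrow> 'a tm_config" where
  "tm_step M c =
     (if fst c = tm_accept M \<or> fst c = tm_reject M then c
      else let (q, acts) = tm_delta M (fst c) (map tape_read (snd c))
           in (q, map2 tape_act acts (snd c)))"

definition tm_init :: "'a tm \<Rightarrow> 'a list \<Rightarrow> 'a tm_config" where
  "tm_init M w =
     (tm_start M,
      (0, \<lambda>i. if 0 \<le> i \<and> i < int (length w) then Letter (w ! nat i) else Blank)
      # replicate (tm_tapes M - 1) (0, \<lambda>_. Blank))"

definition tm_decides_within :: "'a set \<Rightarrow> 'a tm \<Rightarrow> 'a list set \<Rightarrow> (nat \<Rightarrow> real) \<Rightarrow> bool" where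
  "tm_decides_within A M L g \<longleftrightarrow>
     (\<forall>w \<in> lists A. \<exists>t::nat. real t \<le> g (length w) \<and>
        fst ((tm_step M ^^ t) (tm_init M w)) = (if w \<in> L then tm_accept M else tm_reject M))"


section \<open>Growth of functions\<close>

definition preceq :: "(nat \<Rightarrow> real) \<Rightarrow> (nat \<Rightarrow> real) \<Rightarrow> bool" (infix "\<preceq>" 50) where
  "f \<preceq> g \<longleftrightarrow> (\<exists>C::nat. 0 < C \<and>
     (\<forall>n. f n \<le> real C * g (C * n + C) + real C * real n + real C))"

definition decidable_in_time :: "'a set \<Rightarrow> 'a list set \<Rightarrow> (nat \<Rightarrow> real) \<Rightarrow> bool" where
  "decidable_in_time A L f \<longleftrightarrow>
     (\<exists>M g. wf_tm A M \<and> mono g \<and> g \<preceq> f \<and> tm_decides_within A M L g)"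

text \<open>The library notion \<open>convex_on\<close> needs a real vector space as domain; for a function on the
  naturals convexity means that its graph lies below its chords.\<close>

definition convex_nat :: "(nat \<Rightarrow> real) \<Rightarrow> bool" where
  "convex_nat f \<longleftrightarrow>
     (\<forall>a b c. a < b \<and> b < c \<longrightarrow>
        (real c - real a) * f b \<le> (real c - real b) * f a + (real b - real a) * f c)"


section \<open>Word problems\<close>

definition finite_generating_set :: "('g, 'm) monoid_scheme \<Rightarrow> 'g set \<Rightarrow> bool" where
  "finite_generating_set G S \<longleftrightarrow> finite S \<and> S \<subseteq> carrier G \<and> generate G S = carrier G"

text \<open>Words over \<open>S\<close> and inverses are lists over \<open>S \<times> UNIV\<close>; the letter \<open>(s, True)\<close> stands for
  \<open>s\<close> and \<open>(s, False)\<close> for its formal inverse.\<close>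

definition word_value :: "('g, 'm) monoid_scheme \<Rightarrow> ('g \<times> bool) list \<Rightarrow> 'g" where
  "word_value G w =
     foldr (\<lambda>(s, b) x. (if b then s else inv\<^bsub>G\<^esub> s) \<otimes>\<^bsub>G\<^esub> x) w \<one>\<^bsub>G\<^esub>"

definition word_problem :: "('g, 'm) monoid_scheme \<Rightarrow> 'g set \<Rightarrow> ('g \<times> bool) list set" where
  "word_problem G S = {w \<in> lists (S \<times> UNIV). word_value G w = \<one>\<^bsub>G\<^esub>}"

definition word_problem_in_time :: "('g, 'm) monoid_scheme \<Rightarrow> 'g set \<Rightarrow> (nat \<Rightarrow> real) \<Rightarrow> bool" where
  "word_problem_in_time G S f \<longleftrightarrow> decidable_in_time (S \<times> UNIV) (word_problem G S) f"


section \<open>Groups given by generators and relations\<close>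

inductive presented_eq :: "'a set \<Rightarrow> ('a list \<times> 'a list) set \<Rightarrow> 'a list \<Rightarrow> 'a list \<Rightarrow> bool"
  for A R where
  relation: "\<lbrakk>(u, v) \<in> R; x \<in> lists A; u \<in> lists A; v \<in> lists A; y \<in> lists A\<rbrakk>
    \<Longrightarrow> presented_eq A R (x @ u @ y) (x @ v @ y)"
| refl: "u \<in> lists A \<Longrightarrow> presented_eq A R u u"
| sym: "presented_eq A R u v \<Longrightarrow> presented_eq A R v u"
| trans: "\<lbrakk>presented_eq A R u v; presented_eq A R v w\<rbrakk> \<Longrightarrow> presented_eq A R u w"

text \<open>The quotient of the free monoid on \<open>A\<close> by the congruence generated by \<open>R\<close>.\<close>

definition presented :: "'a set \<Rightarrow> ('a list \<times> 'a list) set \<Rightarrow> 'a list set monoid" where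
  "presented A R =
     \<lparr>carrier = lists A // {(u, v). presented_eq A R u v},
      monoid.mult = (\<lambda>X Y. {w. \<exists>u \<in> X. \<exists>v \<in> Y. presented_eq A R (u @ v) w}),
      monoid.one = {w. presented_eq A R [] w}\<rparr>"


section \<open>Graphs of groups\<close>

text \<open>
  A directed edge \<open>\<alpha>\<close> runs from \<open>tail \<Gamma> \<alpha>\<close> to \<open>head \<Gamma> \<alpha>\<close>. The locale \<open>bidirected_digraph\<close> says that
  \<open>bar\<close> is a fixed-point free involution of the edges which exchanges the two endpoints (and is the
  identity outside the set of edges); loops and multiple edges are allowed.
\<close>

locale graph_of_groups = fin_digraph \<Gamma> + bidirected_digraph \<Gamma> bar
  for \<Gamma> :: "('v, 'e) pre_digraph" and bar :: "'e \<Rightarrow> 'e" +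
  fixes GV :: "'v \<Rightarrow> 'g monoid"
    and GE :: "'e \<Rightarrow> 'h monoid"
    and \<tau> :: "'e \<Rightarrow> 'h \<Rightarrow> 'g"
  assumes connected_graph: "Digraph_Component.connected \<Gamma>"
    and vertex_group: "\<mu> \<in> verts \<Gamma> \<Longrightarrow> group (GV \<mu>)"
    and edge_group: "\<alpha> \<in> arcs \<Gamma> \<Longrightarrow> group (GE \<alpha>)"
    and edge_group_rev: "\<alpha> \<in> arcs \<Gamma> \<Longrightarrow> GE (bar \<alpha>) = GE \<alpha>"
    and edge_hom: "\<alpha> \<in> arcs \<Gamma> \<Longrightarrow> \<tau> \<alpha> \<in> hom (GE \<alpha>) (GV (head \<Gamma> \<alpha>))"
    and edge_inj: "\<alpha> \<in> arcs \<Gamma> \<Longrightarrow> inj_on (\<tau> \<alpha>) (carrier (GE \<alpha>))"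

text \<open>
  A spanning tree is given by its set of directed edges, which is closed under reversal. The
  library notion \<open>spanning_tree\<close> does not apply: it excludes directed cycles, hence every pair
  \<open>\<alpha>\<close>, \<open>bar \<alpha>\<close>. Here the only closed walks without repeated vertices are the walks
  \<open>[\<alpha>, bar \<alpha>]\<close>.
\<close>

definition bidirected_spanning_tree ::
    "('v, 'e) pre_digraph \<Rightarrow> ('e \<Rightarrow> 'e) \<Rightarrow> 'e set \<Rightarrow> bool" where
  "bidirected_spanning_tree \<Gamma> bar Tr \<longleftrightarrow>
     Tr \<subseteq> arcs \<Gamma> \<and> bar ` Tr \<subseteq> Tr \<and>
     Digraph_Component.connected (\<Gamma>\<lparr>arcs := Tr\<rparr>) \<and>
     (\<forall>p. pre_digraph.cycle (\<Gamma>\<lparr>arcs := Tr\<rparr>) p \<longrightarrow> (\<exists>\<alpha>. p = [\<alpha>, bar \<alpha>]))"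

text \<open>
  The generators of the free product of the vertex groups and the infinite cyclic groups
  \<open>\<langle>t\<^sub>\<alpha>\<rangle>\<close>: all elements of the vertex groups, and \<open>t\<^sub>\<alpha>\<close> and its inverse for each edge.
\<close>

datatype ('v, 'e, 'g) pi1_gen = Elem 'v 'g | Stable 'e | StableInv 'e

definition pi1_gens ::
    "('v, 'e) pre_digraph \<Rightarrow> ('v \<Rightarrow> 'g monoid) \<Rightarrow> ('v, 'e, 'g) pi1_gen set" where
  "pi1_gens \<Gamma> GV =
     {Elem \<mu> g | \<mu> g. \<mu> \<in> verts \<Gamma> \<and> g \<in> carrier (GV \<mu>)} \<union>
     Stable ` arcs \<Gamma> \<union> StableInv ` arcs \<Gamma>"

text \<open>The first four kinds of relations define the free product, the other three its quotient.\<close>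

inductive_set pi1_rels ::
    "('v, 'e) pre_digraph \<Rightarrow> ('e \<Rightarrow> 'e) \<Rightarrow> ('v \<Rightarrow> 'g monoid) \<Rightarrow> ('e \<Rightarrow> 'h monoid)
      \<Rightarrow> ('e \<Rightarrow> 'h \<Rightarrow> 'g) \<Rightarrow> 'e set
      \<Rightarrow> (('v, 'e, 'g) pi1_gen list \<times> ('v, 'e, 'g) pi1_gen list) set"
  for \<Gamma> bar GV GE \<tau> Tr where
  vertex_mult: "\<lbrakk>\<mu> \<in> verts \<Gamma>; g \<in> carrier (GV \<mu>); h \<in> carrier (GV \<mu>)\<rbrakk>
    \<Longrightarrow> ([Elem \<mu> g, Elem \<mu> h], [Elem \<mu> (g \<otimes>\<^bsub>GV \<mu>\<^esub> h)]) \<in> pi1_rels \<Gamma> bar GV GE \<tau> Tr"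
| vertex_one: "\<mu> \<in> verts \<Gamma>
    \<Longrightarrow> ([Elem \<mu> \<one>\<^bsub>GV \<mu>\<^esub>], []) \<in> pi1_rels \<Gamma> bar GV GE \<tau> Tr"
| stable_right_inv: "\<alpha> \<in> arcs \<Gamma>
    \<Longrightarrow> ([Stable \<alpha>, StableInv \<alpha>], []) \<in> pi1_rels \<Gamma> bar GV GE \<tau> Tr"
| stable_left_inv: "\<alpha> \<in> arcs \<Gamma>
    \<Longrightarrow> ([StableInv \<alpha>, Stable \<alpha>], []) \<in> pi1_rels \<Gamma> bar GV GE \<tau> Tr"
| stable_rev: "\<alpha> \<in> arcs \<Gamma>
    \<Longrightarrow> ([Stable \<alpha>], [StableInv (bar \<alpha>)]) \<in> pi1_rels \<Gamma> bar GV GE \<tau> Tr"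
| stable_tree: "\<alpha> \<in> Tr
    \<Longrightarrow> ([Stable \<alpha>], []) \<in> pi1_rels \<Gamma> bar GV GE \<tau> Tr"
| edge_conj: "\<lbrakk>\<alpha> \<in> arcs \<Gamma>; x \<in> carrier (GE \<alpha>)\<rbrakk>
    \<Longrightarrow> ([Stable \<alpha>, Elem (head \<Gamma> \<alpha>) (\<tau> \<alpha> x), StableInv \<alpha>],
         [Elem (head \<Gamma> (bar \<alpha>)) (\<tau> (bar \<alpha>) x)]) \<in> pi1_rels \<Gamma> bar GV GE \<tau> Tr"

definition pi1 ::
    "('v, 'e) pre_digraph \<Rightarrow> ('e \<Rightarrow> 'e) \<Rightarrow> ('v \<Rightarrow> 'g monoid) \<Rightarrow> ('e \<Rightarrow> 'h monoid)
      \<Rightarrow> ('e \<Rightarrow> 'h \<Rightarrow> 'g) \<Rightarrow> 'e set \<Rightarrow> ('v, 'e, 'g) pi1_gen list set monoid" where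
  "pi1 \<Gamma> bar GV GE \<tau> Tr = presented (pi1_gens \<Gamma> GV) (pi1_rels \<Gamma> bar GV GE \<tau> Tr)"

end

theory Submission
  imports Defs "HOL-Library.Discrete_Functions"
begin

text \<open>When the edge groups are trivial, \<open>pi1\<close> is the free product of the vertex groups and of a free group on
the edges outside the spanning tree. A word is therefore a sequence of syllables, each a word in
one vertex group or a single stable letter, and it represents the identity only if it is emptied by
deleting trivial syllables and inverse pairs of stable letters and joining neighbours from the same
vertex group (\<open>reduced_trivial\<close>, by letting \<open>pi1\<close> act on reduced sequences).

Deleting from left to right is too slow: a long syllable can be tested again after each of its
many extensions. Divide and conquer avoids this. Two reduced sequences are multiplied by cancelling
at the seam only: the last syllable of the first is joined to the first syllable of the second and
tested, and cancellation goes on only as long as the joined syllable is trivial. The syllables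
tested during one multiplication are disjoint pieces of the input, and so are those tested in a
whole pass that multiplies neighbouring blocks in pairs. As \<open>f\<close> is convex, the running times of the
given machines have a superadditive bound of the same growth (\<open>envelope\<close>), so a pass costs
about \<open>f n\<close> (\<open>exec_pass_com\<close>). Each pass halves the number of blocks, whence the factor \<open>log n\<close>
(\<open>exec_loop_com\<close>).

To obtain an actual Turing machine, the algorithm is written in a small language of programs that
operate on finitely many stacks. Such programs run on multi-tape machines with constant slowdown
(\<open>decidable_by_program\<close>), and they can call a given Turing machine as a subroutine, again with
constant slowdown (\<open>exec_sim_com\<close>): a tape is a pair of stacks, and the tapes are wiped clean after
each call by emptying these stacks, in time proportional to the simulated computation.\<close>

section \<open>Stack programs and their compilation to Turing machines\<close>

text \<open>Branching on the symbol is a function from symbols to programs, which replaces variables: what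
has been read is remembered in the choice of the program that is executed next.\<close>

datatype ('i, 'b) com =
    Skip
  | Push 'i 'b
  | Pop 'i
  | Seq "('i, 'b) com" "('i, 'b) com"  (infixr ";;" 60)
  | Case 'i "'b option \<Rightarrow> ('i, 'b) com"
  | While 'i "'b option \<Rightarrow> bool" "('i, 'b) com"

definition peek :: "'b list \<Rightarrow> 'b option" where
  "peek xs = (case xs of [] \<Rightarrow> None | x # _ \<Rightarrow> Some x)"

lemma peek_simps [simp]: "peek [] = None" "peek (x # xs) = Some x"
  by (simp_all add: peek_def)

text \<open>The number is an upper bound for the running time, not the exact time, so that estimates can be
rounded up wherever this is convenient.\<close>

inductive exec :: "('i, 'b) com \<Rightarrow> ('i \<Rightarrow> 'b list) \<Rightarrow> nat \<Rightarrow> ('i \<Rightarrow> 'b list) \<Rightarrow> bool" where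
  Skip: "exec Skip s 1 s"
| Push: "exec (Push i x) s 1 (s(i := x # s i))"
| Pop: "exec (Pop i) s 1 (s(i := tl (s i)))"
| Seq: "\<lbrakk>exec c s t s'; exec d s' u s''\<rbrakk> \<Longrightarrow> exec (c ;; d) s (t + u + 1) s''"
| Case: "exec (f (peek (s i))) s t s' \<Longrightarrow> exec (Case i f) s (t + 1) s'"
| While_False: "\<not> P (peek (s i)) \<Longrightarrow> exec (While i P c) s 1 s"
| While_True: "\<lbrakk>P (peek (s i)); exec c s t s'; exec (While i P c) s' u s''\<rbrakk>
    \<Longrightarrow> exec (While i P c) s (t + u + 1) s''"
| weaken: "\<lbrakk>exec c s t s'; t \<le> u\<rbrakk> \<Longrightarrow> exec c s u s'"

primrec wf_com :: "'i set \<Rightarrow> 'b set \<Rightarrow> ('i, 'b) com \<Rightarrow> bool" where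
  "wf_com I B Skip \<longleftrightarrow> True"
| "wf_com I B (Push i x) \<longleftrightarrow> i \<in> I \<and> x \<in> B"
| "wf_com I B (Pop i) \<longleftrightarrow> i \<in> I"
| "wf_com I B (c ;; d) \<longleftrightarrow> wf_com I B c \<and> wf_com I B d"
| "wf_com I B (Case i f) \<longleftrightarrow> i \<in> I \<and> (\<forall>x \<in> insert None (Some ` B). wf_com I B (f x))"
| "wf_com I B (While i P c) \<longleftrightarrow> i \<in> I \<and> wf_com I B c"

text \<open>One control step: the rest of the computation is a list of commands, and at most one stack
  changes (a push of a symbol, or a pop).\<close>

fun control :: "('i, 'b) com list \<Rightarrow> ('i \<Rightarrow> 'b option)
    \<Rightarrow> ('i, 'b) com list \<times> ('i \<times> 'b option) option" where
  "control [] p = ([], None)"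
| "control (Skip # k) p = (k, None)"
| "control (Push i x # k) p = (k, Some (i, Some x))"
| "control (Pop i # k) p = (k, Some (i, None))"
| "control ((c ;; d) # k) p = (c # d # k, None)"
| "control (Case i f # k) p = (f (p i) # k, None)"
| "control (While i P c # k) p = (if P (p i) then c # While i P c # k else k, None)"

text \<open>A superset of the continuations that occur while \<open>c\<close> runs before \<open>k\<close>. It is finite,
  since a continuation grows only when the program descends in its syntax tree; this is what makes
  finitely many machine states suffice.\<close>

primrec conts :: "'b set \<Rightarrow> ('i, 'b) com \<Rightarrow> ('i, 'b) com list \<Rightarrow> ('i, 'b) com list set" where
  "conts B Skip k = {Skip # k, k}"
| "conts B (Push i x) k = {Push i x # k, k}"
| "conts B (Pop i) k = {Pop i # k, k}"
| "conts B (c ;; d) k = {(c ;; d) # k} \<union> conts B c (d # k) \<union> conts B d k"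
| "conts B (Case i f) k = {Case i f # k} \<union> (\<Union>x \<in> insert None (Some ` B). conts B (f x) k)"
| "conts B (While i P c) k = {While i P c # k, k} \<union> conts B c (While i P c # k)"

lemma finite_conts: "finite B \<Longrightarrow> finite (conts B c k)"
  by (induction c arbitrary: k) auto

lemma conts_start: "c # k \<in> conts B c k"
  by (induction c arbitrary: k) auto

lemma conts_end: "k \<in> conts B c k"
  by (induction c arbitrary: k) auto

lemma conts_wf:
  "\<lbrakk>q \<in> conts B c k; wf_com I B c; list_all (wf_com I B) k\<rbrakk> \<Longrightarrow> list_all (wf_com I B) q"
proof (induction c arbitrary: k q)
  case (Seq c d)
  from Seq.prems consider "q = (c ;; d) # k" | "q \<in> conts B c (d # k)" | "q \<in> conts B d k" by auto
  then show ?case using Seq.prems Seq.IH(1)[of q "d # k"] Seq.IH(2)[of q k] by cases auto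
next
  case (Case i f)
  then show ?case by fastforce
next
  case (While i P c)
  then show ?case using While.IH[of q "While i P c # k"] by auto
qed auto

text \<open>The exception for \<open>k\<close> is what makes the induction work: a subprogram hands over to its
continuation, whose steps are covered by the set for the enclosing program.\<close>

lemma conts_closed:
  assumes "q \<in> conts B c k" "\<And>i. p i \<in> insert None (Some ` B)"
  shows "q = k \<or> fst (control q p) \<in> conts B c k"
  using assms(1)
proof (induction c arbitrary: k q)
  case (Seq c d)
  from Seq.prems consider "q = (c ;; d) # k" | "q \<in> conts B c (d # k)" | "q \<in> conts B d k" by auto
  then show ?case
  proof cases
    case 1 then show ?thesis by (simp add: conts_start)
  next
    case 2
    show ?thesis
    proof (cases "q = d # k")
      case True
      then show ?thesis using Seq.IH(2)[of "d # k" k] conts_start[of d k B] by auto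
    next
      case False
      then show ?thesis using Seq.IH(1)[OF 2] by auto
    qed
  next
    case 3 then show ?thesis using Seq.IH(2)[OF 3] by auto
  qed
next
  case (Case i f)
  from Case.prems consider "q = Case i f # k" | x where "x \<in> insert None (Some ` B)" "q \<in> conts B (f x) k"
    by auto
  then show ?case
  proof cases
    case 1 
    have "f (p i) # k \<in> conts B (f (p i)) k" by (rule conts_start)
    then show ?thesis using 1 assms(2)[of i] by auto
  next
    case 2 then show ?thesis using Case.IH[of "f x" q k] by auto
  qed
next
  case (While i P c)
  from While.prems consider "q = While i P c # k" | "q = k" | "q \<in> conts B c (While i P c # k)" by auto
  then show ?case
  proof cases
    case 3
    then show ?thesis using While.IH[OF 3] conts_start[of c "While i P c # k" B] by auto
  qed (auto simp: conts_start)
qed auto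

text \<open>The head of a stack tape stands on the top symbol, so that every stack can be inspected
  without moving a head. The cell to the left of the bottom symbol is blank.\<close>

definition stack_tape :: "('b \<Rightarrow> 'a symb) \<Rightarrow> 'b list \<Rightarrow> 'a tape" where
  "stack_tape e xs = (int (length xs),
     \<lambda>j. if 1 \<le> j \<and> j \<le> int (length xs) then e (rev xs ! nat (j - 1)) else Blank)"

lemma stack_tape_Nil: "stack_tape e [] = (0, \<lambda>_. Blank)"
  by (auto simp: stack_tape_def fun_eq_iff)

lemma read_stack_tape:
  "tape_read (stack_tape e xs) = (case xs of [] \<Rightarrow> Blank | x # _ \<Rightarrow> e x)"
  by (cases xs) (auto simp: tape_read_def stack_tape_def nth_append)

lemma stay_tape: "tape_act (tape_read T, MStay) T = T"
  by (simp add: tape_act_def tape_read_def)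

lemma push_stack_tape:
  "tape_act (e x, MStay) (tape_act (tape_read (stack_tape e xs), MRight) (stack_tape e xs))
     = stack_tape e (x # xs)"
  by (cases xs) (auto simp: tape_act_def tape_read_def stack_tape_def fun_eq_iff nth_append)

lemma pop_stack_tape:
  "tape_act (Blank, MLeft) (stack_tape e (x # xs)) = stack_tape e xs"
  by (auto simp: tape_act_def tape_read_def stack_tape_def fun_eq_iff nth_append)

datatype ('i, 'b) mode = Load | Run "('i, 'b) com list" | Accept | Reject

type_synonym ('i, 'b) state = "('i, 'b) mode \<times> ('i \<times> 'b) option"

text \<open>Tape \<open>0\<close> holds the input and tape \<open>j + 1\<close> the stack of the register \<open>rs ! j\<close>. The machine first copies
the input to the stack of \<open>ri\<close> and then runs \<open>c\<close>; it accepts if the stack of \<open>ro\<close> ends up empty.\<close>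

locale compilation =
  fixes A :: "'a set" and B :: "'b set" and rs :: "'i list"
    and inp :: "'a \<Rightarrow> 'b" and ri ro :: 'i and c :: "('i, 'b) com"
  assumes fin_A: "finite A" and fin_B: "finite B"
    and ri: "ri \<in> set rs" and ro: "ro \<in> set rs" and inp: "inp ` A \<subseteq> B"
    and wf_c: "wf_com (set rs) B c"
begin

definition num :: "'b \<Rightarrow> nat" where
  "num = (SOME h. bij_betw h B {..<card B})"

lemma num: "bij_betw num B {..<card B}"
  using ex_bij_betw_finite_nat[OF fin_B] unfolding num_def atLeast0LessThan by (rule someI_ex)

definition enc :: "'b \<Rightarrow> 'a symb" where
  "enc x = Aux (num x)"

definition dec :: "'a symb \<Rightarrow> 'b option" where
  "dec y = (if y \<in> enc ` B then Some (inv_into B enc y) else None)"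

lemma dec_simps: "dec Blank = None" "x \<in> B \<Longrightarrow> dec (enc x) = Some x"
proof -
  have "inj_on enc B" using num by (auto simp: enc_def inj_on_def bij_betw_def)
  then show "x \<in> B \<Longrightarrow> dec (enc x) = Some x" by (simp add: dec_def)
qed (auto simp: dec_def enc_def)

lemma dec_range: "dec y \<in> insert None (Some ` B)"
  by (auto simp: dec_def inv_into_into)

text \<open>Symbols that encode nothing are read as an empty stack. They never occur on a stack, but the
transition function has to stay within the finite set of states for every list of symbols.\<close>

definition peeks :: "'a symb list \<Rightarrow> 'i \<Rightarrow> 'b option" where
  "peeks xs i = (case map_of (zip rs (tl xs)) i of None \<Rightarrow> None | Some y \<Rightarrow> dec y)"

lemma peeks_range: "peeks xs i \<in> insert None (Some ` B)"
  using dec_range by (auto simp: peeks_def split: option.split)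

definition acts :: "move \<Rightarrow> 'i \<Rightarrow> ('a symb \<Rightarrow> 'a symb \<times> move) \<Rightarrow> 'a symb list \<Rightarrow> ('a symb \<times> move) list" where
  "acts m i a xs = (hd xs, m) # map2 (\<lambda>j y. if j = i then a y else (y, MStay)) rs (tl xs)"

text \<open>A push takes two machine steps: the head moves, and the second component of the state
  remembers the symbol that it then writes.\<close>

fun delta :: "('i, 'b) state \<Rightarrow> 'a symb list \<Rightarrow> ('i, 'b) state \<times> ('a symb \<times> move) list" where
  "delta (m, Some (i, x)) xs = ((m, None), acts MStay i (\<lambda>_. (enc x, MStay)) xs)"
| "delta (Load, None) xs =
     (case hd xs of
        Letter a \<Rightarrow> ((Load, Some (ri, inp a)), acts MRight ri (\<lambda>y. (y, MRight)) xs)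
      | _ \<Rightarrow> ((Run [c], None), map (\<lambda>y. (y, MStay)) xs))"
| "delta (Run k, None) xs =
     (if k = []
      then ((if peeks xs ro = None then Accept else Reject, None), map (\<lambda>y. (y, MStay)) xs)
      else case control k (peeks xs) of
        (k', None) \<Rightarrow> ((Run k', None), map (\<lambda>y. (y, MStay)) xs)
      | (k', Some (i, Some x)) \<Rightarrow> ((Run k', Some (i, x)), acts MStay i (\<lambda>y. (y, MRight)) xs)
      | (k', Some (i, None)) \<Rightarrow>
          ((Run k', None),
           acts MStay i (\<lambda>y. if y = Blank then (Blank, MStay) else (Blank, MLeft)) xs))"
| "delta (m, None) xs = ((m, None), map (\<lambda>y. (y, MStay)) xs)"

definition states :: "('i, 'b) state set" where
  "states = ({Load, Accept, Reject} \<union> Run ` conts B c [])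
     \<times> insert None (Some ` (set rs \<times> B))"

lemma finite_states: "finite states"
  by (simp add: states_def finite_conts fin_B)

definition nst :: "('i, 'b) state \<Rightarrow> nat" where
  "nst = (SOME h. bij_betw h states {..<card states})"

lemma nst: "bij_betw nst states {..<card states}"
  using ex_bij_betw_finite_nat[OF finite_states] unfolding nst_def atLeast0LessThan by (rule someI_ex)

lemma nst_inv: "q \<in> states \<Longrightarrow> inv_into states nst (nst q) = q"
  using nst by (simp add: bij_betw_def)

definition machine :: "'a tm" where
  "machine = \<lparr>tm_tapes = Suc (length rs), tm_states = card states, tm_aux = card B,
     tm_start = nst (Load, None), tm_accept = nst (Accept, None), tm_reject = nst (Reject, None),
     tm_delta = (\<lambda>n xs. let (q, as) = delta (inv_into states nst n) xs in (nst q, as))\<rparr>"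

lemma basic_states:
  "(Load, None) \<in> states" "(Accept, None) \<in> states" "(Reject, None) \<in> states"
  by (auto simp: states_def)

text \<open>The bound on the continuations makes this hold for all combinations of symbols, reachable or not.\<close>

lemma delta_wf:
  assumes q: "q \<in> states" and xs: "xs \<in> lists (tm_symbols A machine)" "length xs = Suc (length rs)"
  shows "fst (delta q xs) \<in> states" "length (snd (delta q xs)) = Suc (length rs)"
    "fst ` set (snd (delta q xs)) \<subseteq> tm_symbols A machine"
proof -
  obtain m pend where qq: "q = (m, pend)" by (cases q)
  obtain x0 ys where xy: "xs = x0 # ys" "length ys = length rs" using xs by (cases xs) auto
  have xsym: "x0 \<in> tm_symbols A machine" "set ys \<subseteq> tm_symbols A machine"
    using xs xy by auto
  have enc_sym: "enc x \<in> tm_symbols A machine" if "x \<in> B" for x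
    using bij_betwE[OF num] that by (auto simp: tm_symbols_def machine_def enc_def)
  have blank_sym: "Blank \<in> tm_symbols A machine" by (simp add: tm_symbols_def)
  have len: "length (acts mv i a xs) = Suc (length rs)" for mv i a
    using xy by (simp add: acts_def)
  have sym: "fst ` set (acts mv i a xs) \<subseteq> tm_symbols A machine"
    if "\<And>y. y \<in> tm_symbols A machine \<Longrightarrow> fst (a y) \<in> tm_symbols A machine" for mv i a
  proof -
    have "\<forall>p \<in> set (zip rs ys). snd p \<in> tm_symbols A machine"
      using xsym by (auto dest: set_zip_rightD)
    then show ?thesis using xsym that by (auto simp: acts_def xy)
  qed
  have stay: "fst ` set (map (\<lambda>y. (y, MStay)) xs) \<subseteq> tm_symbols A machine"
    using xs by (auto simp: image_image)
  have "fst (delta q xs) \<in> states \<and> length (snd (delta q xs)) = Suc (length rs) \<and>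
    fst ` set (snd (delta q xs)) \<subseteq> tm_symbols A machine"
  proof (cases pend)
    case (Some ix)
    obtain i x where "ix = (i, x)" by (cases ix)
    moreover from this have "(m, None) \<in> states" "x \<in> B" using q qq Some by (auto simp: states_def)
    ultimately show ?thesis using qq Some len sym[of "\<lambda>_. (enc x, MStay)"] enc_sym by simp
  next
    case None
    show ?thesis
    proof (cases m)
      case Load
      show ?thesis
      proof (cases x0)
        case (Letter a)
        then have "a \<in> A" using xsym by (auto simp: tm_symbols_def)
        then have "(Load, Some (ri, inp a)) \<in> states" using ri inp by (auto simp: states_def)
        then show ?thesis using qq None Load Letter xy len sym[of "\<lambda>y. (y, MRight)"] by simp
      qed (use qq None Load xy xs stay conts_start[of c "[]" B] in \<open>auto simp: states_def\<close>)
    next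
      case (Run k)
      have k: "k \<in> conts B c []" using q qq Run by (auto simp: states_def)
      show ?thesis
      proof (cases "k = []")
        case True
        then show ?thesis using qq None Run xs stay by (auto simp: states_def)
      next
        case False
        obtain k' e where ke: "control k (peeks xs) = (k', e)" by (cases "control k (peeks xs)")
        have k': "k' \<in> conts B c []" using conts_closed[OF k, of "peeks xs"] peeks_range False ke by auto
        have wfk: "list_all (wf_com (set rs) B) k" using conts_wf[OF k wf_c] by simp
        have e: "i \<in> set rs \<and> x \<in> B" if "e = Some (i, Some x)" for i x
          using ke that wfk by (cases "(k, peeks xs)" rule: control.cases) auto
        show ?thesis
        proof (cases e)
          case None
          then show ?thesis using qq \<open>pend = None\<close> Run False ke k' xs stay by (auto simp: states_def)
        next
          case (Some ix)
          obtain i xo where ix: "ix = (i, xo)" by (cases ix)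
          show ?thesis
          proof (cases xo)
            case None
            show ?thesis using qq \<open>pend = None\<close> Run False ke k' Some ix None len blank_sym
                sym[of "\<lambda>y. if y = Blank then (Blank, MStay) else (Blank, MLeft)"]
              by (auto simp: states_def)
          next
            case (Some x)
            show ?thesis using qq \<open>pend = None\<close> Run False ke k' \<open>e = Some ix\<close> ix Some len e
                sym[of "\<lambda>y. (y, MRight)"]
              by (auto simp: states_def)
          qed
        qed
      qed
    qed (use q qq None xs stay in auto)
  qed
  then show "fst (delta q xs) \<in> states" "length (snd (delta q xs)) = Suc (length rs)"
    "fst ` set (snd (delta q xs)) \<subseteq> tm_symbols A machine" by auto
qed

lemma wf_machine: "wf_tm A machine"
proof -
  have fld: "tm_states machine = card states" "tm_tapes machine = Suc (length rs)"
    "tm_start machine = nst (Load, None)" "tm_accept machine = nst (Accept, None)"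
    "tm_reject machine = nst (Reject, None)"
    "tm_delta machine = (\<lambda>n xs. let (q, as) = delta (inv_into states nst n) xs in (nst q, as))"
    by (simp_all add: machine_def)
  have lt: "nst q < card states" if "q \<in> states" for q using bij_betwE[OF nst] that by auto
  have "nst (Accept, None) \<noteq> nst (Reject, None)"
    using nst_inv[OF basic_states(2)] nst_inv[OF basic_states(3)] by auto
  moreover have "inv_into states nst n \<in> states" if "n < card states" for n
    using nst that by (metis bij_betw_def inv_into_into lessThan_iff)
  ultimately show ?thesis unfolding wf_tm_def fld
    using fin_A lt basic_states delta_wf by (simp add: Let_def split_beta)
qed

definition tapes :: "'a tape \<Rightarrow> ('i \<Rightarrow> 'b list) \<Rightarrow> 'a tape list" where
  "tapes T s = T # map (\<lambda>i. stack_tape enc (s i)) rs"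

lemma step_machine:
  assumes "q \<in> states" "fst q \<noteq> Accept" "fst q \<noteq> Reject"
  shows "tm_step machine (nst q, ts) =
    (nst (fst (delta q (map tape_read ts))), map2 tape_act (snd (delta q (map tape_read ts))) ts)"
proof -
  have "nst q \<noteq> nst (Accept, None)" by (metis assms(1,2) basic_states(2) nst_inv fst_conv)
  moreover have "nst q \<noteq> nst (Reject, None)" by (metis assms(1,3) basic_states(3) nst_inv fst_conv)
  ultimately show ?thesis
    by (simp add: tm_step_def machine_def nst_inv[OF assms(1)] Let_def split_beta)
qed

lemma acts_tapes:
  assumes "\<And>i. i \<in> set rs \<Longrightarrow> f i = tape_act (if i = r then a (tape_read (g i)) else (tape_read (g i), MStay)) (g i)"
  shows "map2 tape_act (acts m r a (map tape_read (T # map g rs))) (T # map g rs)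
    = tape_act (tape_read T, m) T # map f rs"
  by (auto simp: acts_def assms intro!: nth_equalityI)

lemma stay_tapes: "map2 tape_act (map (\<lambda>y. (y, MStay)) (map tape_read ts)) ts = ts"
  by (auto simp: stay_tape intro!: nth_equalityI)

lemma peeks_tapes:
  assumes "\<And>i. set (s i) \<subseteq> B" "i \<in> set rs"
  shows "peeks (map tape_read (tapes T s)) i = peek (s i)"
proof -
  have "peeks (map tape_read (tapes T s)) i = dec (tape_read (stack_tape enc (s i)))"
    using assms(2) by (simp add: peeks_def tapes_def comp_def map_of_zip_map)
  then show ?thesis using assms(1)[of i]
    by (auto simp: read_stack_tape dec_simps split: list.split)
qed

lemma push_tapes:
  assumes q: "(m, None) \<in> states" "(m', Some (i, x)) \<in> states" "(m', None) \<in> states"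
    "m \<noteq> Accept" "m \<noteq> Reject" "m' \<noteq> Accept" "m' \<noteq> Reject"
    and d: "delta (m, None) (map tape_read (tapes T s))
      = ((m', Some (i, x)), acts mv i (\<lambda>y. (y, MRight)) (map tape_read (tapes T s)))"
  shows "(tm_step machine ^^ 2) (nst (m, None), tapes T s)
    = (nst (m', None), tapes (tape_act (tape_read T, mv) T) (s(i := x # s i)))"
proof -
  define g where "g j = (if j = i then tape_act (tape_read (stack_tape enc (s i)), MRight) (stack_tape enc (s i))
    else stack_tape enc (s j))" for j
  define T' where "T' = tape_act (tape_read T, mv) T"
  have 1: "tm_step machine (nst (m, None), tapes T s) = (nst (m', Some (i, x)), T' # map g rs)"
  proof -
    have "map2 tape_act (acts mv i (\<lambda>y. (y, MRight)) (map tape_read (tapes T s))) (tapes T s) = T' # map g rs"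
      unfolding tapes_def T'_def by (rule acts_tapes) (simp add: g_def stay_tape)
    then show ?thesis unfolding step_machine[OF q(1), simplified, OF q(4,5)] d by simp
  qed
  have 2: "tm_step machine (nst (m', Some (i, x)), T' # map g rs) = (nst (m', None), tapes T' (s(i := x # s i)))"
  proof -
    have "map2 tape_act (acts MStay i (\<lambda>_. (enc x, MStay)) (map tape_read (T' # map g rs))) (T' # map g rs)
      = tape_act (tape_read T', MStay) T' # map (\<lambda>j. stack_tape enc ((s(i := x # s i)) j)) rs"
      by (rule acts_tapes) (simp add: g_def stay_tape push_stack_tape)
    then show ?thesis
      unfolding step_machine[OF q(2), simplified, OF q(6,7)] delta.simps by (simp add: stay_tape tapes_def)
  qed
  show ?thesis using 1 2 by (simp add: numeral_2_eq_2 T'_def)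
qed

lemma control_tapes:
  assumes k: "k \<in> conts B c []" "k \<noteq> []" and s: "\<And>i. set (s i) \<subseteq> B"
    and ctl: "control k (\<lambda>i. peek (s i)) = (k', None)"
  shows "tm_step machine (nst (Run k, None), tapes T s) = (nst (Run k', None), tapes T s)"
proof -
  have st: "(Run k, None) \<in> states" using k by (auto simp: states_def)
  have wfk: "list_all (wf_com (set rs) B) k" using conts_wf[OF k(1) wf_c] by simp
  have "control k (peeks (map tape_read (tapes T s))) = (k', None)"
    using ctl wfk peeks_tapes[where s = s and T = T, OF s] by (cases "(k, \<lambda>i. peek (s i))" rule: control.cases) auto
  then show ?thesis unfolding step_machine[OF st, simplified]
    using k(2) stay_tapes by simp
qed

abbreviation conf :: "('i, 'b) com list \<Rightarrow> 'a tape \<Rightarrow> ('i \<Rightarrow> 'b list) \<Rightarrow> 'a tm_config" where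
  "conf k T s \<equiv> (nst (Run k, None), tapes T s)"

definition reaches :: "nat \<Rightarrow> 'a tm_config \<Rightarrow> 'a tm_config \<Rightarrow> bool" where
  "reaches t x y \<longleftrightarrow> (\<exists>t' \<le> t. (tm_step machine ^^ t') x = y)"

lemma reaches_trans:
  assumes "reaches t x y" "reaches u y z" "t + u \<le> v"
  shows "reaches v x z"
proof -
  obtain t' u' where "t' \<le> t" "(tm_step machine ^^ t') x = y" "u' \<le> u" "(tm_step machine ^^ u') y = z"
    using assms(1,2) by (auto simp: reaches_def)
  then show ?thesis using assms(3) unfolding reaches_def by (intro exI[of _ "u' + t'"]) (simp add: funpow_add)
qed

lemma reaches_mono: "reaches t x y \<Longrightarrow> t \<le> u \<Longrightarrow> reaches u x y"
  unfolding reaches_def using le_trans by blast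

lemma reaches_step: "tm_step machine x = y \<Longrightarrow> 1 \<le> t \<Longrightarrow> reaches t x y"
  unfolding reaches_def by (intro exI[of _ 1]) simp

text \<open>The factor \<open>2\<close> pays for pushes. The last premise says that \<open>d\<close> is executed as a subprogram of \<open>c\<close>, so
that all its control states belong to the machine.\<close>

lemma exec_tapes:
  assumes "exec d s t s'" "d # k \<in> conts B c []" "\<And>i. set (s i) \<subseteq> B"
    "conts B d k \<subseteq> conts B c []"
  shows "(\<forall>i. set (s' i) \<subseteq> B) \<and> reaches (2 * t) (conf (d # k) T s) (conf k T s')"
  using assms
proof (induction arbitrary: k rule: exec.induct)
  case (Skip s)
  have "tm_step machine (conf (Skip # k) T s) = conf k T s"
    by (rule control_tapes[OF Skip.prems(1) _ Skip.prems(2)]) simp_all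
  then show ?case using Skip.prems(2) by (intro conjI allI reaches_step) simp_all
next
  case (Push i x s)
  have wfk: "list_all (wf_com (set rs) B) (Push i x # k)" using conts_wf[OF Push(1) wf_c] by simp
  then have ix: "i \<in> set rs" "x \<in> B" by auto
  have "(tm_step machine ^^ 2) (conf (Push i x # k) T s)
    = conf k (tape_act (tape_read T, MStay) T) (s(i := x # s i))"
    using Push.prems(1,3) ix by (intro push_tapes) (simp_all add: states_def)
  then have "reaches (2 * 1) (conf (Push i x # k) T s) (conf k T (s(i := x # s i)))"
    unfolding reaches_def stay_tape by (intro exI[of _ 2]) simp
  then show ?case using Push.prems(2) ix by (simp add: fun_upd_def)
next
  case (Pop i s)
  have wfk: "list_all (wf_com (set rs) B) (Pop i # k)" using conts_wf[OF Pop(1) wf_c] by simp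
  then have ix: "i \<in> set rs" by auto
  have st: "(Run (Pop i # k), None) \<in> states" using Pop by (auto simp: states_def)
  have enb: "enc x \<noteq> Blank" for x by (simp add: enc_def)
  have tl: "set (tl (s j)) \<subseteq> B" for j using Pop(2)[of j] by (cases "s j") auto
  let ?a = "\<lambda>y. if y = Blank then (Blank, MStay) else (Blank, MLeft)"
  have pop: "stack_tape enc (tl (s i)) = tape_act (?a (tape_read (stack_tape enc (s i)))) (stack_tape enc (s i))"
  proof (cases "s i")
    case Nil
    then show ?thesis by (simp add: tape_read_def stack_tape_Nil tape_act_def fun_eq_iff)
  next
    case (Cons x xs)
    then show ?thesis by (simp add: read_stack_tape enb pop_stack_tape)
  qed
  have "map2 tape_act (acts MStay i ?a (map tape_read (tapes T s))) (tapes T s)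
    = tape_act (tape_read T, MStay) T # map (\<lambda>j. stack_tape enc ((s(i := tl (s i))) j)) rs"
    unfolding tapes_def by (rule acts_tapes) (simp add: pop stay_tape)
  then have "tm_step machine (conf (Pop i # k) T s) = conf k T (s(i := tl (s i)))"
    unfolding step_machine[OF st, simplified] by (simp add: stay_tape tapes_def[of T "s(i := tl (s i))"])
  then have "reaches (2 * 1) (conf (Pop i # k) T s) (conf k T (s(i := tl (s i))))"
    by (rule reaches_step) simp
  then show ?case using Pop.prems(2) tl by (simp add: fun_upd_def)
next
  case (Seq c1 s t s' d u s'')
  have sub: "conts B c1 (d # k) \<subseteq> conts B c []" "conts B d k \<subseteq> conts B c []"
    using Seq.prems(3) by auto
  have 1: "(\<forall>i. set (s' i) \<subseteq> B) \<and> reaches (2 * t) (conf (c1 # d # k) T s) (conf (d # k) T s')"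
    using Seq.IH(1)[of "d # k"] Seq.prems sub conts_start by blast
  have 2: "(\<forall>i. set (s'' i) \<subseteq> B) \<and> reaches (2 * u) (conf (d # k) T s') (conf k T s'')"
    using Seq.IH(2)[of k] 1 sub conts_start by blast
  have "tm_step machine (conf ((c1 ;; d) # k) T s) = conf (c1 # d # k) T s"
    by (rule control_tapes[OF Seq.prems(1) _ Seq.prems(2)]) simp_all
  from reaches_trans[OF reaches_step[OF this order_refl] reaches_trans[OF 1[THEN conjunct2] 2[THEN conjunct2] order_refl]] 2
  show ?case by simp
next
  case (Case f s i t s')
  have pk: "peek (s i) \<in> insert None (Some ` B)" using Case.prems(2)[of i] by (cases "s i") auto
  have sub: "conts B (f (peek (s i))) k \<subseteq> conts B c []"
    using Case.prems(3) pk by (cases "peek (s i)") (simp_all, blast)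
  have 1: "(\<forall>i. set (s' i) \<subseteq> B) \<and> reaches (2 * t) (conf (f (peek (s i)) # k) T s) (conf k T s')"
    using Case.IH[of k] Case.prems sub conts_start by blast
  have "tm_step machine (conf (Case i f # k) T s) = conf (f (peek (s i)) # k) T s"
    by (rule control_tapes[OF Case.prems(1) _ Case.prems(2)]) simp_all
  from reaches_trans[OF reaches_step[OF this order_refl] 1[THEN conjunct2]] 1 show ?case by simp
next
  case (While_False P s i d)
  have "tm_step machine (conf (While i P d # k) T s) = conf k T s"
    by (rule control_tapes[OF While_False.prems(1) _ While_False.prems(2)]) (use While_False.hyps in simp_all)
  then show ?case using While_False.prems(2) by (intro conjI allI reaches_step) simp_all
next
  case (While_True P s i d t s' u s'')
  let ?W = "While i P d"
  have sub: "conts B d (?W # k) \<subseteq> conts B c []" "conts B ?W k \<subseteq> conts B c []"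
    using While_True.prems(3) by auto
  have 1: "(\<forall>i. set (s' i) \<subseteq> B) \<and> reaches (2 * t) (conf (d # ?W # k) T s) (conf (?W # k) T s')"
    using While_True.IH(1)[of "?W # k"] While_True.prems sub conts_start by blast
  have 2: "(\<forall>i. set (s'' i) \<subseteq> B) \<and> reaches (2 * u) (conf (?W # k) T s') (conf k T s'')"
    using While_True.IH(2)[of k] 1 sub conts_start by blast
  have "tm_step machine (conf (?W # k) T s) = conf (d # ?W # k) T s"
    by (rule control_tapes[OF While_True.prems(1) _ While_True.prems(2)]) (use While_True.hyps(1) in simp_all)
  from reaches_trans[OF reaches_step[OF this order_refl] reaches_trans[OF 1[THEN conjunct2] 2[THEN conjunct2] order_refl]] 2
  show ?case by simp
next
  case (weaken c' s t s' u)
  then show ?case using reaches_mono[of "2 * t" _ _ "2 * u"] by simp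
qed

definition input_tape :: "'a list \<Rightarrow> nat \<Rightarrow> 'a tape" where
  "input_tape w n = (int n, \<lambda>i. if 0 \<le> i \<and> i < int (length w) then Letter (w ! nat i) else Blank)"

text \<open>Reading from left to right and pushing reverses the input: its last letter ends up on top.\<close>

lemma load_tapes:
  assumes "w \<in> lists A" "n \<le> length w"
  shows "(tm_step machine ^^ (2 * n)) (tm_init machine w)
    = (nst (Load, None), tapes (input_tape w n) ((\<lambda>_. [])(ri := map inp (rev (take n w)))))"
  using assms(2)
proof (induction n)
  case 0
  have "replicate (length rs) (0, \<lambda>_. Blank) = map (\<lambda>i. stack_tape enc ((\<lambda>_. []) i)) rs"
    by (simp add: stack_tape_Nil map_replicate_const)
  then show ?case
    by (simp add: tm_init_def machine_def tapes_def input_tape_def)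
next
  case (Suc n)
  let ?s = "(\<lambda>_. [])(ri := map inp (rev (take n w)))"
  have wn: "w ! n \<in> A" using assms(1) Suc.prems by auto
  have "(tm_step machine ^^ 2) (nst (Load, None), tapes (input_tape w n) ?s)
    = (nst (Load, None), tapes (tape_act (tape_read (input_tape w n), MRight) (input_tape w n)) (?s(ri := inp (w ! n) # ?s ri)))"
    using ri inp wn Suc.prems
    by (intro push_tapes) (auto simp: states_def tapes_def input_tape_def tape_read_def)
  moreover have "tape_act (tape_read (input_tape w n), MRight) (input_tape w n) = input_tape w (Suc n)"
    by (auto simp: tape_act_def tape_read_def input_tape_def fun_eq_iff)
  moreover have "?s(ri := inp (w ! n) # ?s ri) = (\<lambda>_. [])(ri := map inp (rev (take (Suc n) w)))"
    using Suc.prems by (simp add: take_Suc_conv_app_nth)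
  moreover have "2 * Suc n = 2 + 2 * n" by simp
  ultimately show ?case using Suc unfolding \<open>2 * Suc n = 2 + 2 * n\<close> funpow_add by (simp add: fun_upd_def)
qed

lemma machine_decides:
  assumes ex: "exec c ((\<lambda>_. [])(ri := map inp (rev w))) t s" and w: "w \<in> lists A"
  shows "\<exists>t' \<le> 2 * t + 2 * length w + 2. fst ((tm_step machine ^^ t') (tm_init machine w))
    = (if s ro = [] then tm_accept machine else tm_reject machine)"
proof -
  let ?T = "input_tape w (length w)" and ?s = "(\<lambda>_. [])(ri := map inp (rev w))"
  have 1: "(tm_step machine ^^ (2 * length w)) (tm_init machine w) = (nst (Load, None), tapes ?T ?s)"
    using load_tapes[OF w] by simp
  have 2: "tm_step machine (nst (Load, None), tapes ?T ?s) = (nst (Run [c], None), tapes ?T ?s)"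
    unfolding step_machine[OF basic_states(1), simplified]
    using stay_tapes[of "tapes ?T ?s"] by (simp add: tapes_def input_tape_def tape_read_def)
  have B: "set (?s i) \<subseteq> B" for i using w inp by auto
  have *: "(\<forall>i. set (s i) \<subseteq> B) \<and> reaches (2 * t) (conf [c] ?T ?s) (conf [] ?T s)"
    using exec_tapes[OF ex, of "[]" ?T] B conts_start by blast
  then obtain t' where sB: "\<forall>i. set (s i) \<subseteq> B" and t': "t' \<le> 2 * t"
    "(tm_step machine ^^ t') (conf [c] ?T ?s) = conf [] ?T s" by (auto simp: reaches_def)
  have st: "(Run [], None) \<in> states" by (auto simp: states_def conts_end)
  have "peeks (map tape_read (tapes ?T s)) ro = None \<longleftrightarrow> s ro = []"
    using peeks_tapes[of s ro ?T] sB ro by (cases "s ro") auto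
  then have 3: "fst (tm_step machine (nst (Run [], None), tapes ?T s))
    = (if s ro = [] then tm_accept machine else tm_reject machine)"
    unfolding step_machine[OF st, simplified] by (simp add: machine_def)
  have "fst ((tm_step machine ^^ (1 + (t' + (1 + 2 * length w)))) (tm_init machine w))
    = (if s ro = [] then tm_accept machine else tm_reject machine)"
    unfolding funpow_add using 1 2 3 t' by simp
  then show ?thesis using t'(1) by (intro exI[of _ "1 + (t' + (1 + 2 * length w))"]) auto
qed

end

text \<open>Loading takes two steps for each letter and every step of the program at most two machine steps.\<close>

theorem decidable_by_program:
  fixes c :: "('i, 'b) com"
  assumes "finite A" "finite B" "finite I" "inp ` A \<subseteq> B" "wf_com I B c" "ri \<in> I" "ro \<in> I"
    and ex: "\<And>w. w \<in> lists A \<Longrightarrow> \<exists>s. exec c ((\<lambda>_. [])(ri := map inp (rev w))) (T (length w)) s \<and>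
        (s ro = [] \<longleftrightarrow> w \<in> L)"
    and "mono T" "(\<lambda>n. real (2 * T n + 2 * n + 2)) \<preceq> f"
  shows "decidable_in_time A L f"
proof -
  obtain rs where rs: "set rs = I" using finite_list[OF \<open>finite I\<close>] by auto
  interpret compilation A B rs inp ri ro c
    using assms rs by unfold_locales auto
  have "tm_decides_within A machine L (\<lambda>n. real (2 * T n + 2 * n + 2))"
    unfolding tm_decides_within_def
  proof
    fix w assume w: "w \<in> lists A"
    then obtain s where s: "exec c ((\<lambda>_. [])(ri := map inp (rev w))) (T (length w)) s"
      "s ro = [] \<longleftrightarrow> w \<in> L" using ex by blast
    show "\<exists>t. real t \<le> real (2 * T (length w) + 2 * length w + 2) \<and>
      fst ((tm_step machine ^^ t) (tm_init machine w)) = (if w \<in> L then tm_accept machine else tm_reject machine)"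
    proof -
      obtain t where "t \<le> 2 * T (length w) + 2 * length w + 2"
        "fst ((tm_step machine ^^ t) (tm_init machine w)) = (if w \<in> L then tm_accept machine else tm_reject machine)"
        using machine_decides[OF s(1) w] s(2) by auto
      then show ?thesis by (intro exI[of _ t]) (simp only: of_nat_le_iff simp_thms)
    qed
  qed
  moreover have "mono (\<lambda>n. real (2 * T n + 2 * n + 2))"
    using \<open>mono T\<close> unfolding mono_def by (auto intro!: add_mono)
  ultimately show ?thesis unfolding decidable_in_time_def using wf_machine assms by blast
qed

section \<open>Simulating a Turing machine by a stack program\<close>

text \<open>\<open>RI\<close> holds the input, \<open>RA\<close> and \<open>RD\<close> sequences of blocks, \<open>RU\<close> the left factor of a product, \<open>RW\<close> a
syllable that is being copied. \<open>RP\<close> records whether a pass has multiplied anything, \<open>RC\<close> whether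
cancellation goes on, and \<open>RQ\<close> the state of the simulated machine, whose \<open>j\<close>-th tape is the pair
\<open>TL j\<close>, \<open>TR j\<close>.\<close>

datatype reg = RI | RA | RU | RW | RD | RP | RC | RQ | TL nat | TR nat

text \<open>A letter carries the tag of the group it belongs to, so that the group of a syllable can be read
off from either of its ends.\<close>

datatype ('x, 't, 'l) sym = Inp 'x | Let 't 'l | Sep | End | Mark | St nat | TS "'l symb"

type_synonym ('x, 't, 'l) stack = "('x, 't, 'l) sym list"
type_synonym ('x, 't, 'l) program = "(reg, ('x, 't, 'l) sym) com"

text \<open>A tape as two stacks: the cells to the left of the head, nearest first, and the cells from the
  head to the right. Cells beyond the ends of the lists are blank.\<close>

type_synonym 'a zipper = "'a symb list \<times> 'a symb list"

definition cell :: "'a symb list \<Rightarrow> nat \<Rightarrow> 'a symb" where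
  "cell xs i = (if i < length xs then xs ! i else Blank)"

definition represents :: "'a zipper \<Rightarrow> 'a tape \<Rightarrow> bool" where
  "represents z T \<longleftrightarrow> (\<forall>i. snd T (fst T + int i) = cell (snd z) i) \<and>
     (\<forall>i. snd T (fst T - 1 - int i) = cell (fst z) i)"

fun zipper_act :: "'a symb \<times> move \<Rightarrow> 'a zipper \<Rightarrow> 'a zipper" where
  "zipper_act (x, MStay) (l, r) = (l, x # tl r)"
| "zipper_act (x, MRight) (l, r) = (x # l, tl r)"
| "zipper_act (x, MLeft) (l, r) = (tl l, cell l 0 # x # tl r)"

lemma cell_simps [simp]: "cell [] i = Blank" "cell (x # xs) 0 = x" "cell (x # xs) (Suc i) = cell xs i"
  by (simp_all add: cell_def)

lemma cell_tl: "cell (tl xs) i = cell xs (Suc i)"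
  by (cases xs) simp_all

lemma represents_read: "represents z T \<Longrightarrow> tape_read T = cell (snd z) 0"
  unfolding represents_def tape_read_def by (metis add.right_neutral int_ops(1))

lemma represents_act:
  assumes "represents z T"
  shows "represents (zipper_act a z) (tape_act a T)"
proof -
  obtain p c where T: "T = (p, c)" by (cases T)
  obtain l r where z: "z = (l, r)" by (cases z)
  obtain x m where a: "a = (x, m)" by (cases a)
  have r: "c (p + int i) = cell r i" and l: "c (p - 1 - int i) = cell l i" for i
    using assms by (auto simp: represents_def T z)
  have r': "c (p + 1 + int i) = cell r (Suc i)" for i using r[of "Suc i"] by (simp add: algebra_simps)
  have l': "c (p - 2 - int i) = cell l (Suc i)" for i using l[of "Suc i"] by (simp add: algebra_simps)
  show ?thesis
  proof (cases m)
    case MLeft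
    have "(c(p := x)) (p - 1 + int i) = cell (cell l 0 # x # tl r) i" for i
    proof -
      consider "i = 0" | "i = 1" | j where "i = Suc (Suc j)" by (metis One_nat_def not0_implies_Suc)
      then show ?thesis
      proof cases
        case 1 then show ?thesis using l[of 0] by simp
      next
        case 3 then show ?thesis using r'[of j] by (simp add: cell_tl algebra_simps)
      qed simp
    qed
    moreover have "(c(p := x)) (p - 1 - 1 - int i) = cell (tl l) i" for i
      using l'[of i] by (simp add: cell_tl)
    ultimately show ?thesis by (simp add: represents_def T z a MLeft tape_act_def)
  next
    case MStay
    have "(c(p := x)) (p + int i) = cell (x # tl r) i" for i
      using r[of i] by (cases i) (auto simp: cell_tl)
    then show ?thesis using l by (simp add: represents_def T z a MStay tape_act_def)
  next
    case MRight
    have "(c(p := x)) (p - int i) = cell (x # l) i" for i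
      using l[of "i - 1"] by (cases i) (auto simp: algebra_simps)
    then show ?thesis using r' by (simp add: represents_def T z a MRight tape_act_def cell_tl)
  qed
qed

text \<open>This bounds the time needed to wipe the tapes after a simulation. A move to the left beyond the end
of both lists creates two cells.\<close>

lemma zipper_act_length:
  "length (fst (zipper_act a z)) + length (snd (zipper_act a z)) \<le> length (fst z) + length (snd z) + 2"
  by (cases "(a, z)" rule: zipper_act.cases) auto

lemma zipper_act_symbols:
  assumes "Blank \<in> Y" "fst a \<in> Y" "set (fst z) \<subseteq> Y" "set (snd z) \<subseteq> Y"
  shows "set (fst (zipper_act a z)) \<subseteq> Y" "set (snd (zipper_act a z)) \<subseteq> Y"
proof -
  have "set (tl xs) \<subseteq> Y" "cell xs 0 \<in> Y" if "set xs \<subseteq> Y" for xs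
    using that assms(1) by (cases xs; auto)+
  then show "set (fst (zipper_act a z)) \<subseteq> Y" "set (snd (zipper_act a z)) \<subseteq> Y"
    using assms by (cases "(a, z)" rule: zipper_act.cases; auto)+
qed

text \<open>All simulated tapes of a store are overridden at once, so that their evolution can be described
as that of a function of the tape number.\<close>

definition with_tapes :: "(reg \<Rightarrow> ('x, 't, 'l) stack) \<Rightarrow> (nat \<Rightarrow> 'l zipper) \<Rightarrow> reg \<Rightarrow> ('x, 't, 'l) stack" where
  "with_tapes s Z r = (case r of TL j \<Rightarrow> map TS (fst (Z j)) | TR j \<Rightarrow> map TS (snd (Z j)) | _ \<Rightarrow> s r)"

lemma with_tapes_simps [simp]:
  "with_tapes s Z (TL j) = map TS (fst (Z j))"
  "with_tapes s Z (TR j) = map TS (snd (Z j))"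
  "with_tapes s Z RQ = s RQ"
  by (simp_all add: with_tapes_def)

lemma with_tapes_upd:
  "(with_tapes s Z)(TL j := map TS l) = with_tapes s (Z(j := (l, snd (Z j))))"
  "(with_tapes s Z)(TR j := map TS r) = with_tapes s (Z(j := (fst (Z j), r)))"
  "(with_tapes s Z)(RQ := v) = with_tapes (s(RQ := v)) Z"
  by (auto simp: with_tapes_def fun_eq_iff split: reg.splits)

text \<open>Rules for building executions whose cost and final store are only determined up to a proof
  obligation, so that they can be chained without first bringing intermediate results into a
  particular form.\<close>

lemma exec_Skip: "1 \<le> t \<Longrightarrow> s' = s \<Longrightarrow> exec Skip s t s'"
  by (metis exec.Skip exec.weaken)

lemma exec_Push: "1 \<le> t \<Longrightarrow> s' = s(i := x # s i) \<Longrightarrow> exec (Push i x) s t s'"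
  by (metis exec.Push exec.weaken)

lemma exec_Pop: "1 \<le> t \<Longrightarrow> s' = s(i := tl (s i)) \<Longrightarrow> exec (Pop i) s t s'"
  by (metis exec.Pop exec.weaken)

lemma exec_Seq: "exec c s t s' \<Longrightarrow> exec d s' u s'' \<Longrightarrow> t + u + 1 \<le> v \<Longrightarrow> exec (c ;; d) s v s''"
  by (metis exec.Seq exec.weaken)

lemma exec_Case: "exec (f (peek (s i))) s t s' \<Longrightarrow> t + 1 \<le> v \<Longrightarrow> exec (Case i f) s v s'"
  by (metis exec.Case exec.weaken)

lemma exec_While_False: "\<not> P (peek (s i)) \<Longrightarrow> 1 \<le> t \<Longrightarrow> s' = s \<Longrightarrow> exec (While i P c) s t s'"
  by (metis exec.While_False exec.weaken)

lemma exec_While_True: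
  "P (peek (s i)) \<Longrightarrow> exec c s t s' \<Longrightarrow> exec (While i P c) s' u s'' \<Longrightarrow> t + u + 1 \<le> v
    \<Longrightarrow> exec (While i P c) s v s''"
  by (metis exec.While_True exec.weaken)

fun act_com :: "nat \<Rightarrow> 'l symb \<times> move \<Rightarrow> ('x, 't, 'l) program" where
  "act_com j (x, MStay) = Pop (TR j) ;; Push (TR j) (TS x)"
| "act_com j (x, MRight) = Pop (TR j) ;; Push (TL j) (TS x)"
| "act_com j (x, MLeft) = Pop (TR j) ;; Push (TR j) (TS x) ;;
     Case (TL j) (\<lambda>y. Pop (TL j) ;; Push (TR j) (case y of None \<Rightarrow> TS Blank | Some y \<Rightarrow> y))"

lemma exec_act_com:
  fixes s :: "reg \<Rightarrow> ('x, 't, 'l) stack"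
  shows "exec (act_com j a) (with_tapes s Z) 10 (with_tapes s (Z(j := zipper_act a (Z j))))"
proof -
  obtain x m where a: "a = (x, m)" by (cases a)
  obtain l r where z: "Z j = (l, r)" by (cases "Z j")
  have pop: "exec (Pop (TR j)) (with_tapes s Z) 1 (with_tapes s (Z(j := (l, tl r))))"
    by (rule exec_Pop) (simp_all add: z map_tl[symmetric] with_tapes_upd)
  have pushR: "exec (Push (TR j) (TS y)) (with_tapes s (Z(j := (l', r')))) 1 (with_tapes s (Z(j := (l', y # r'))))" for y l' r'
    by (rule exec_Push) (simp_all add: list.map(2)[symmetric] with_tapes_upd del: list.map)
  have pushL: "exec (Push (TL j) (TS y)) (with_tapes s (Z(j := (l', r')))) 1 (with_tapes s (Z(j := (y # l', r'))))" for y l' r'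
    by (rule exec_Push) (simp_all add: list.map(2)[symmetric] with_tapes_upd del: list.map)
  have popL: "exec (Pop (TL j)) (with_tapes s (Z(j := (l', r')))) 1 (with_tapes s (Z(j := (tl l', r'))))" for l' r'
    by (rule exec_Pop) (simp_all add: map_tl[symmetric] with_tapes_upd)
  show ?thesis
  proof (cases m)
    case MLeft
    have "(case peek (map TS l) of None \<Rightarrow> TS Blank | Some y \<Rightarrow> y) = (TS (cell l 0) :: ('x, 't, 'l) sym)"
      by (cases l) simp_all
    moreover have "exec (Pop (TL j) ;; Push (TR j) (TS (cell l 0))) (with_tapes s (Z(j := (l, x # tl r)))) 3
        (with_tapes s (Z(j := (tl l, cell l 0 # x # tl r))))"
      by (rule exec_Seq[OF popL pushR]) simp
    ultimately have "exec (Case (TL j) (\<lambda>y. Pop (TL j) ;; Push (TR j) (case y of None \<Rightarrow> TS Blank | Some y \<Rightarrow> y)))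
      (with_tapes s (Z(j := (l, x # tl r)))) 5 (with_tapes s (Z(j := (tl l, cell l 0 # x # tl r))))"
      by (intro exec_Case[where t = 3]) simp_all
    from exec_Seq[OF pop exec_Seq[OF pushR this order_refl]] show ?thesis
      unfolding a MLeft act_com.simps z zipper_act.simps by simp
  next
    case MStay
    then show ?thesis unfolding a MStay act_com.simps z zipper_act.simps
      by (intro exec_Seq[OF pop pushR]) simp_all
  next
    case MRight
    then show ?thesis unfolding a MRight act_com.simps z zipper_act.simps
      by (intro exec_Seq[OF pop pushL]) simp_all
  qed
qed

fun acts_com :: "nat \<Rightarrow> ('l symb \<times> move) list \<Rightarrow> ('x, 't, 'l) program" where
  "acts_com j [] = Skip"
| "acts_com j (a # as) = act_com j a ;; acts_com (Suc j) as"

lemma exec_acts_com: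
  "exec (acts_com j as) (with_tapes s Z) (11 * length as + 1)
     (with_tapes s (\<lambda>i. if j \<le> i \<and> i < j + length as then zipper_act (as ! (i - j)) (Z i) else Z i))"
proof (induction as arbitrary: j Z)
  case Nil
  have "(\<lambda>i. if j \<le> i \<and> i < j + length [] then zipper_act ([] ! (i - j)) (Z i) else Z i) = Z" by (auto simp: fun_eq_iff)
  then show ?case using exec_Skip[of 1] by auto
next
  case (Cons a as)
  let ?Z = "Z(j := zipper_act a (Z j))"
  have "(\<lambda>i. if Suc j \<le> i \<and> i < Suc j + length as then zipper_act (as ! (i - Suc j)) (?Z i) else ?Z i)
    = (\<lambda>i. if j \<le> i \<and> i < j + length (a # as) then zipper_act ((a # as) ! (i - j)) (Z i) else Z i)"
  proof
    fix i
    consider "i < j" | "i = j" | d where "i = Suc j + d"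
      by (metis add_Suc add_Suc_right less_iff_Suc_add linorder_neqE_nat)
    then show "(if Suc j \<le> i \<and> i < Suc j + length as then zipper_act (as ! (i - Suc j)) (?Z i) else ?Z i)
      = (if j \<le> i \<and> i < j + length (a # as) then zipper_act ((a # as) ! (i - j)) (Z i) else Z i)"
      by cases simp_all
  qed
  then show ?case using exec_Seq[OF exec_act_com Cons.IH[of "Suc j" ?Z]] by simp
qed

text \<open>Machines with different alphabets share the tape registers. Replacing foreign symbols by blanks
ensures that the transition function is only consulted where well-formedness controls its values.\<close>

fun tape_symbol :: "'l symb set \<Rightarrow> ('x, 't, 'l) sym option \<Rightarrow> 'l symb" where
  "tape_symbol Y (Some (TS x)) = (if x \<in> Y then x else Blank)"
| "tape_symbol Y _ = Blank"

text \<open>The symbols under the heads are collected by nested branching, one tape after the other, and the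
list is passed to the program that performs the step.\<close>

fun read_com :: "'l symb set \<Rightarrow> nat \<Rightarrow> nat \<Rightarrow> 'l symb list \<Rightarrow> ('l symb list \<Rightarrow> ('x, 't, 'l) program)
    \<Rightarrow> ('x, 't, 'l) program" where
  "read_com Y j 0 ys k = k ys"
| "read_com Y j (Suc n) ys k = Case (TR j) (\<lambda>y. read_com Y (Suc j) n (ys @ [tape_symbol Y y]) k)"

lemma exec_read_com:
  fixes s :: "reg \<Rightarrow> ('x, 't, 'l) stack"
  assumes "exec (k (ys @ map (\<lambda>i. cell (snd (Z i)) 0) [j..<j + n])) (with_tapes s Z) t s'"
    "\<And>i. set (snd (Z i)) \<subseteq> Y"
  shows "exec (read_com Y j n ys k) (with_tapes s Z) (t + n) s'"
  using assms(1)
proof (induction n arbitrary: j ys t)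
  case (Suc n)
  have "tape_symbol Y (peek (map TS (snd (Z j)) :: ('x, 't, 'l) stack)) = cell (snd (Z j)) 0"
    using assms(2)[of j] by (cases "snd (Z j)") auto
  moreover have "exec (read_com Y (Suc j) n (ys @ [cell (snd (Z j)) 0]) k) (with_tapes s Z) (t + n) s'"
  proof (rule Suc.IH)
    have "map (\<lambda>i. cell (snd (Z i)) 0) [j..<j + Suc n]
      = cell (snd (Z j)) 0 # map (\<lambda>i. cell (snd (Z i)) 0) [Suc j..<Suc j + n]"
      by (subst upt_conv_Cons) (auto simp del: upt_Suc)
    then show "exec (k ((ys @ [cell (snd (Z j)) 0]) @ map (\<lambda>i. cell (snd (Z i)) 0) [Suc j..<Suc j + n]))
      (with_tapes s Z) t s'"
      using Suc.prems by (simp del: upt_Suc)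
  qed
  ultimately show ?case by (auto intro!: exec_Case[where t = "t + n"])
qed simp

definition drain :: "reg \<Rightarrow> (reg, 'b) com" where
  "drain r = While r (\<lambda>x. x \<noteq> None) (Pop r)"

lemma exec_drain: "exec (drain r) s (2 * length (s r) + 1) (s(r := []))"
proof (induction "length (s r)" arbitrary: s)
  case 0
  then show ?case unfolding drain_def by (intro exec_While_False) auto
next
  case (Suc n)
  have "exec (drain r) (s(r := tl (s r))) (2 * n + 1) (s(r := []))"
    using Suc(1)[of "s(r := tl (s r))"] Suc(2)[symmetric] by simp
  moreover have "peek (s r) \<noteq> None" using Suc(2) by (cases "s r") auto
  ultimately show ?case unfolding drain_def
    using exec_While_True[of "\<lambda>x. x \<noteq> None" s r, OF _ exec.Pop] Suc(2) by auto
qed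

fun clear_com :: "nat \<Rightarrow> (reg, 'b) com" where
  "clear_com 0 = Skip"
| "clear_com (Suc n) = drain (TL n) ;; drain (TR n) ;; clear_com n"

lemma exec_clear_com:
  assumes "\<And>j. length (fst (Z j)) + length (snd (Z j)) \<le> b" "\<And>j. n \<le> j \<Longrightarrow> Z j = ([], [])"
  shows "exec (clear_com n) (with_tapes s Z) ((2 * b + 4) * n + 1) (with_tapes s (\<lambda>_. ([], [])))"
  using assms
proof (induction n arbitrary: Z)
  case 0
  then have "Z = (\<lambda>_. ([], []))" by auto
  then show ?case using exec_Skip[of 1] by simp
next
  case (Suc n)
  let ?Z = "Z(n := ([], []))"
  have L: "exec (drain (TL n)) (with_tapes s Z) (2 * length (fst (Z n)) + 1) (with_tapes s (Z(n := ([], snd (Z n)))))"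
    using exec_drain[of "TL n" "with_tapes s Z"] with_tapes_upd(1)[of s Z n "[]"] by simp
  have R: "exec (drain (TR n)) (with_tapes s (Z(n := ([], snd (Z n))))) (2 * length (snd (Z n)) + 1) (with_tapes s ?Z)"
    using exec_drain[of "TR n" "with_tapes s (Z(n := ([], snd (Z n))))"]
      with_tapes_upd(2)[of s "Z(n := ([], snd (Z n)))" n "[]"] by simp
  have "?Z j = ([], [])" if "n \<le> j" for j using Suc.prems(2)[of j] that by (cases "j = n") auto
  then have "exec (clear_com n) (with_tapes s ?Z) ((2 * b + 4) * n + 1) (with_tapes s (\<lambda>_. ([], [])))"
    using Suc.prems(1) by (intro Suc.IH) auto
  then show ?case unfolding clear_com.simps
    using Suc.prems(1)[of n] by (intro exec_Seq[OF L exec_Seq[OF R]]) auto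
qed

definition step_com :: "'l set \<Rightarrow> 'l tm \<Rightarrow> nat \<Rightarrow> ('x, 't, 'l) program" where
  "step_com Y M q = read_com (tm_symbols Y M) 0 (tm_tapes M) []
     (\<lambda>ys. Push RQ (St (fst (tm_delta M q ys))) ;; acts_com 0 (snd (tm_delta M q ys)))"

definition halted :: "'l tm \<Rightarrow> nat \<Rightarrow> bool" where
  "halted M q \<longleftrightarrow> q = tm_accept M \<or> q = tm_reject M"

fun iterate_com :: "'l set \<Rightarrow> 'l tm \<Rightarrow> ('x, 't, 'l) sym option \<Rightarrow> ('x, 't, 'l) program" where
  "iterate_com Y M (Some (St q)) = (if q < tm_states M then Pop RQ ;; step_com Y M q else Skip)"
| "iterate_com Y M _ = Skip"

definition run_com :: "'l set \<Rightarrow> 'l tm \<Rightarrow> ('x, 't, 'l) program" where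
  "run_com Y M = While RQ (\<lambda>x. \<forall>q. x = Some (St q) \<longrightarrow> \<not> halted M q) (Case RQ (iterate_com Y M))"

definition sim_com :: "'l set \<Rightarrow> 'l tm \<Rightarrow> ('x, 't, 'l) program" where
  "sim_com Y M = Push RQ (St (tm_start M)) ;; run_com Y M ;; clear_com (tm_tapes M)"

definition encodes :: "'l set \<Rightarrow> 'l tm \<Rightarrow> (nat \<Rightarrow> 'l zipper) \<Rightarrow> 'l tape list \<Rightarrow> bool" where
  "encodes Y M Z ts \<longleftrightarrow> length ts = tm_tapes M \<and> (\<forall>j < tm_tapes M. represents (Z j) (ts ! j)) \<and>
     (\<forall>j \<ge> tm_tapes M. Z j = ([], [])) \<and>
     (\<forall>j. set (fst (Z j)) \<subseteq> tm_symbols Y M \<and> set (snd (Z j)) \<subseteq> tm_symbols Y M)"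

definition zlen :: "'l zipper \<Rightarrow> nat" where
  "zlen z = length (fst z) + length (snd z)"

lemma exec_step_com:
  assumes wf: "wf_tm Y M" and q: "q < tm_states M" "\<not> halted M q" and RQ: "s RQ = []"
    and enc: "encodes Y M Z ts"
  obtains Z' q' ts' where "tm_step M (q, ts) = (q', ts')" "q' < tm_states M" "encodes Y M Z' ts'"
    "exec (step_com Y M q) (with_tapes s Z) (12 * tm_tapes M + 3) (with_tapes (s(RQ := [St q'])) Z')"
    "\<And>j. zlen (Z' j) \<le> zlen (Z j) + 2"
proof -
  have len: "length ts = tm_tapes M" and rep: "j < tm_tapes M \<Longrightarrow> represents (Z j) (ts ! j)"
    and out: "tm_tapes M \<le> j \<Longrightarrow> Z j = ([], [])"
    and sym: "set (fst (Z j)) \<subseteq> tm_symbols Y M" "set (snd (Z j)) \<subseteq> tm_symbols Y M" for j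
    using enc by (auto simp: encodes_def)
  define ys where "ys = map tape_read ts"
  obtain q' as where d: "tm_delta M q ys = (q', as)" by (cases "tm_delta M q ys")
  define Z' where "Z' i = (if i < length as then zipper_act (as ! i) (Z i) else Z i)" for i
  have bl: "Blank \<in> tm_symbols Y M" by (simp add: tm_symbols_def)
  have ys: "ys = map (\<lambda>i. cell (snd (Z i)) 0) [0..<tm_tapes M]"
    using rep len by (auto simp: ys_def intro!: nth_equalityI represents_read)
  have "cell xs 0 \<in> tm_symbols Y M" if "set xs \<subseteq> tm_symbols Y M" for xs
    using that bl by (cases xs) auto
  then have "ys \<in> lists (tm_symbols Y M)" using sym by (auto simp: ys)
  moreover have "length ys = tm_tapes M" by (simp add: ys)
  ultimately have d': "q' < tm_states M" "length as = tm_tapes M" "fst ` set as \<subseteq> tm_symbols Y M"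
    using wf q d unfolding wf_tm_def by fastforce+
  have step: "tm_step M (q, ts) = (q', map2 tape_act as ts)"
    using q d by (simp add: tm_step_def halted_def ys_def)
  have "exec (Push RQ (St q')) (with_tapes s Z) 1 (with_tapes (s(RQ := [St q'])) Z)"
    by (rule exec_Push) (simp_all add: RQ with_tapes_upd)
  moreover have "exec (acts_com 0 as) (with_tapes (s(RQ := [St q'])) Z) (11 * length as + 1) (with_tapes (s(RQ := [St q'])) Z')"
    using exec_acts_com[of 0 as "s(RQ := [St q'])" Z] unfolding Z'_def[abs_def] by (simp cong del: if_weak_cong)
  ultimately have "exec (Push RQ (St q') ;; acts_com 0 as) (with_tapes s Z) (11 * length as + 3) (with_tapes (s(RQ := [St q'])) Z')"
    by (rule exec_Seq) simp
  then have ex: "exec (step_com Y M q) (with_tapes s Z) (12 * tm_tapes M + 3) (with_tapes (s(RQ := [St q'])) Z')"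
    unfolding step_com_def using d d' sym(2) ys
    by (intro exec.weaken[OF exec_read_com[where t = "11 * length as + 3"]]) auto
  show thesis
  proof (rule that[OF step d'(1) _ ex])
    have "fst (as ! j) \<in> tm_symbols Y M" if "j < length as" for j using d'(3) that by auto
    then have "set (fst (Z' j)) \<subseteq> tm_symbols Y M" "set (snd (Z' j)) \<subseteq> tm_symbols Y M" for j
      using sym zipper_act_symbols[OF bl] by (auto simp: Z'_def)
    moreover have "represents (Z' j) (map2 tape_act as ts ! j)" if "j < tm_tapes M" for j
      using that d' len rep by (simp add: Z'_def represents_act)
    ultimately show "encodes Y M Z' (map2 tape_act as ts)"
      using d' len out by (simp add: encodes_def Z'_def)
    show "zlen (Z' j) \<le> zlen (Z j) + 2" for j
      using zipper_act_length[of "as ! j" "Z j"] by (simp add: Z'_def zlen_def)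
  qed
qed

lemma exec_run_com:
  assumes wf: "wf_tm Y M" and "q < tm_states M" "s RQ = [St q]" "encodes Y M Z ts"
    and "fst ((tm_step M ^^ t) (q, ts)) = qf" "halted M qf"
  shows "\<exists>Z'. exec (run_com Y M) (with_tapes s Z) ((12 * tm_tapes M + 8) * t + 1) (with_tapes (s(RQ := [St qf])) Z') \<and>
    (\<forall>j \<ge> tm_tapes M. Z' j = ([], [])) \<and> (\<forall>j. zlen (Z' j) \<le> zlen (Z j) + 2 * t)"
  using assms(2-)
proof (induction t arbitrary: q s ts Z)
  case 0
  have "s(RQ := [St qf]) = s" using 0 by auto
  then have "exec (run_com Y M) (with_tapes s Z) 1 (with_tapes (s(RQ := [St qf])) Z)"
    unfolding run_com_def using 0 by (intro exec_While_False) auto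
  then show ?case using 0(3) by (intro exI[of _ Z]) (simp add: fun_upd_def encodes_def)
next
  case (Suc t)
  show ?case
  proof (cases "halted M q")
    case True
    have "(tm_step M ^^ n) (q, ts) = (q, ts)" for n
      using True by (induction n) (auto simp: tm_step_def halted_def)
    then have "qf = q" using Suc.prems(4) by (metis fst_conv)
    then have "s(RQ := [St qf]) = s" using Suc.prems(2) by auto
    then have "exec (run_com Y M) (with_tapes s Z) ((12 * tm_tapes M + 8) * Suc t + 1) (with_tapes (s(RQ := [St qf])) Z)"
      unfolding run_com_def using Suc.prems True by (intro exec_While_False) auto
    then show ?thesis using Suc.prems(3) by (intro exI[of _ Z]) (simp add: fun_upd_def encodes_def)
  next
    case False
    have RQ: "(s(RQ := [])) RQ = []" by simp
    obtain Z' q' ts' where st: "tm_step M (q, ts) = (q', ts')" "q' < tm_states M" "encodes Y M Z' ts'"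
      and ex: "exec (step_com Y M q) (with_tapes (s(RQ := [])) Z) (12 * tm_tapes M + 3) (with_tapes ((s(RQ := []))(RQ := [St q'])) Z')"
      and Z': "\<And>j. zlen (Z' j) \<le> zlen (Z j) + 2"
      using exec_step_com[where s = "s(RQ := [])", OF wf Suc.prems(1) False RQ Suc.prems(3)] by metis
    have fin: "fst ((tm_step M ^^ t) (q', ts')) = qf"
      using Suc.prems(4) st(1) by (simp add: funpow_swap1)
    have RQ': "(s(RQ := [St q'])) RQ = [St q']" by simp
    obtain Z'' where Z'': "exec (run_com Y M) (with_tapes (s(RQ := [St q'])) Z') ((12 * tm_tapes M + 8) * t + 1)
        (with_tapes ((s(RQ := [St q']))(RQ := [St qf])) Z'')"
      "\<forall>j \<ge> tm_tapes M. Z'' j = ([], [])" "\<forall>j. zlen (Z'' j) \<le> zlen (Z' j) + 2 * t"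
      using Suc.IH[of q' "s(RQ := [St q'])" Z' ts', OF st(2) RQ' st(3) fin Suc.prems(5)] by blast
    have pop: "exec (Pop RQ) (with_tapes s Z) 1 (with_tapes (s(RQ := [])) Z)"
      by (rule exec_Pop) (simp_all add: Suc.prems(2) with_tapes_upd)
    have body: "exec (Case RQ (iterate_com Y M)) (with_tapes s Z) (12 * tm_tapes M + 6) (with_tapes (s(RQ := [St q'])) Z')"
      using Suc.prems(1,2) ex by (intro exec_Case[where t = "12 * tm_tapes M + 5"]) (auto intro!: exec_Seq[OF pop])
    have "exec (run_com Y M) (with_tapes s Z) ((12 * tm_tapes M + 8) * Suc t + 1) (with_tapes (s(RQ := [St qf])) Z'')"
      unfolding run_com_def
      by (rule exec_While_True[OF _ body Z''(1)[unfolded run_com_def fun_upd_upd]]) (use Suc.prems(2) False in auto)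
    moreover have "zlen (Z'' j) \<le> zlen (Z j) + 2 * Suc t" for j
      using Z'[of j] spec[OF Z''(3), of j] by simp
    ultimately show ?thesis using Z''(2) by blast
  qed
qed

text \<open>The simulated tapes are empty before and after, apart from the input, so that one set of registers
serves all machines and all calls. The verdict is the final state left on \<open>RQ\<close>.\<close>

lemma exec_sim_com:
  fixes w :: "'l list"
  assumes wf: "wf_tm Y M" and w: "w \<in> lists Y"
    and halt: "fst ((tm_step M ^^ t) (tm_init M w)) = qf" "halted M qf"
    and s: "s RQ = []" "\<And>j. s (TL j) = []" "s (TR 0) = map (TS \<circ> Letter) w" "\<And>j. s (TR (Suc j)) = []"
  shows "exec (sim_com Y M) s ((16 * tm_tapes M + 10) * (t + length w + 1)) (s(TR 0 := [], RQ := [St qf]))"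
proof -
  define Z :: "nat \<Rightarrow> 'l zipper" where "Z j = (if j = 0 then ([], map Letter w) else ([], []))" for j :: nat
  have sTR: "s (TR j) = (if j = 0 then map (TS \<circ> Letter) w else [])" for j
    using s by (cases j) auto
  have sZ: "with_tapes s Z = s"
    using s(1,2) sTR by (auto simp: with_tapes_def Z_def fun_eq_iff split: reg.split)
  have wf': "1 \<le> tm_tapes M" "tm_start M < tm_states M" using wf by (auto simp: wf_tm_def)
  define ts where "ts = snd (tm_init M w)"
  have ts: "tm_init M w = (tm_start M, ts)" by (simp add: ts_def tm_init_def)
  have rep: "represents (Z j) (ts ! j)" if "j < tm_tapes M" for j
    using that by (cases j) (auto simp: ts_def tm_init_def Z_def represents_def cell_def)
  let ?s = "s(RQ := [St (tm_start M)])"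
  have "encodes Y M Z ts"
    using rep wf' w by (auto simp: encodes_def ts_def tm_init_def Z_def tm_symbols_def)
  moreover have "fst ((tm_step M ^^ t) (tm_start M, ts)) = qf" using halt(1) by (simp add: ts)
  moreover have "?s RQ = [St (tm_start M)]" by simp
  ultimately obtain Z' where Z': "exec (run_com Y M) (with_tapes ?s Z) ((12 * tm_tapes M + 8) * t + 1)
      (with_tapes (?s(RQ := [St qf])) Z')"
    "\<forall>j \<ge> tm_tapes M. Z' j = ([], [])" "\<forall>j. zlen (Z' j) \<le> zlen (Z j) + 2 * t"
    using exec_run_com[OF wf wf'(2), of ?s Z ts t qf] halt(2) by blast
  have len: "length (fst (Z' j)) + length (snd (Z' j)) \<le> length w + 2 * t" for j
    using spec[OF Z'(3), of j] by (auto simp: Z_def zlen_def split: if_splits)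
  have cl: "exec (clear_com (tm_tapes M)) (with_tapes (s(RQ := [St qf])) Z') ((2 * (length w + 2 * t) + 4) * tm_tapes M + 1)
     (with_tapes (s(RQ := [St qf])) (\<lambda>_. ([], [])))"
    using Z'(2) by (intro exec_clear_com len) auto
  have fin: "with_tapes (s(RQ := [St qf])) (\<lambda>_. ([], [])) = s(TR 0 := [], RQ := [St qf])"
    using s(1,2) sTR by (auto simp: with_tapes_def fun_eq_iff split: reg.split)
  have push: "exec (Push RQ (St (tm_start M))) s 1 (with_tapes (s(RQ := [St (tm_start M)])) Z)"
    by (rule exec_Push) (simp_all add: s with_tapes_upd(3)[symmetric] sZ)
  from exec_Seq[OF push exec_Seq[OF Z'(1)[unfolded fun_upd_upd] cl[unfolded fin] order_refl] order_refl]
  show ?thesis unfolding sim_com_def by (rule exec.weaken) (simp add: algebra_simps)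
qed

lemma wf_sim_com:
  assumes wf: "wf_tm Y M" and I: "RQ \<in> I" "TL ` {..<tm_tapes M} \<subseteq> I" "TR ` {..<tm_tapes M} \<subseteq> I"
    and B: "St ` {..<tm_states M} \<subseteq> B" "TS ` tm_symbols Y M \<subseteq> B"
  shows "wf_com I B (sim_com Y M)"
proof -
  have bl: "Blank \<in> tm_symbols Y M" by (simp add: tm_symbols_def)
  have act: "wf_com I B (act_com j a)" if "j < tm_tapes M" "fst a \<in> tm_symbols Y M" for j a
    using that I B bl by (cases "(j, a)" rule: act_com.cases) (auto simp: image_subset_iff)
  have acts: "wf_com I B (acts_com j as)" if "j + length as \<le> tm_tapes M" "fst ` set as \<subseteq> tm_symbols Y M" for j as
    using that by (induction as arbitrary: j) (auto intro!: act)
  have rd: "wf_com I B (read_com (tm_symbols Y M) j n ys k)"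
    if "j + n \<le> tm_tapes M" "ys \<in> lists (tm_symbols Y M)"
      "\<And>zs. zs \<in> lists (tm_symbols Y M) \<Longrightarrow> length zs = length ys + n \<Longrightarrow> wf_com I B (k zs)" for j n ys k
    using that
  proof (induction n arbitrary: j ys)
    case (Suc n)
    have "tape_symbol (tm_symbols Y M) y \<in> tm_symbols Y M" for y :: "('b, 'c, 'a) sym option"
      by (cases "(tm_symbols Y M, y)" rule: tape_symbol.cases) (auto simp: bl)
    then show ?case using Suc I by (auto intro!: Suc.IH)
  qed auto
  have step: "wf_com I B (step_com Y M q)" if q: "q < tm_states M" for q
    unfolding step_com_def
  proof (rule rd)
    fix zs assume zs: "zs \<in> lists (tm_symbols Y M)" "length zs = length [] + tm_tapes M"
    then have "fst (tm_delta M q zs) < tm_states M \<and> length (snd (tm_delta M q zs)) = tm_tapes M \<and>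
      fst ` set (snd (tm_delta M q zs)) \<subseteq> tm_symbols Y M" using wf q by (auto simp: wf_tm_def)
    then show "wf_com I B (Push RQ (St (fst (tm_delta M q zs))) ;; acts_com 0 (snd (tm_delta M q zs)))"
      using I B acts[of 0] by auto
  qed auto
  have iter: "wf_com I B (iterate_com Y M x)" for x
    using step I by (cases "(Y, M, x)" rule: iterate_com.cases) auto
  have clear: "wf_com I B (clear_com n)" if "n \<le> tm_tapes M" for n
    using that I by (induction n) (auto simp: drain_def)
  show ?thesis using I B wf iter clear by (auto simp: sim_com_def run_com_def wf_tm_def)
qed

section \<open>Merging words by divide and conquer\<close>

definition holds :: "('b \<Rightarrow> bool) \<Rightarrow> 'b option \<Rightarrow> bool" where
  "holds P z = (case z of None \<Rightarrow> False | Some x \<Rightarrow> P x)"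

lemma holds_simps [simp]: "holds P None = False" "holds P (Some x) = P x"
  by (simp_all add: holds_def)

text \<open>Moving the part of a stack above the first symbol that violates \<open>P\<close> to another stack, which
  reverses it; the symbols are rewritten by \<open>h\<close>.\<close>

definition move_com :: "'i \<Rightarrow> 'i \<Rightarrow> ('b \<Rightarrow> bool) \<Rightarrow> ('b \<Rightarrow> 'b) \<Rightarrow> ('i, 'b) com" where
  "move_com i j P h = While i (holds P)
     (Case i (\<lambda>z. case z of None \<Rightarrow> Skip | Some x \<Rightarrow> Pop i ;; Push j (h x)))"

lemma exec_move_com:
  assumes "s i = xs @ ys" "\<And>x. x \<in> set xs \<Longrightarrow> P x" "\<not> holds P (peek ys)" "i \<noteq> j"
  shows "exec (move_com i j P h) s (5 * length xs + 1) (s(i := ys, j := rev (map h xs) @ s j))"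
  using assms(1,2)
proof (induction xs arbitrary: s)
  case Nil
  show ?case unfolding move_com_def
    by (rule exec_While_False) (use Nil assms(3) in \<open>auto simp: fun_eq_iff\<close>)
next
  case (Cons x xs)
  let ?s = "s(i := xs @ ys, j := h x # s j)"
  have "exec (Pop i) s 1 (s(i := xs @ ys))" using Cons.prems by (intro exec_Pop) auto
  moreover have "exec (Push j (h x)) (s(i := xs @ ys)) 1 ?s"
    using assms(4) by (intro exec_Push) auto
  ultimately have "exec (Pop i ;; Push j (h x)) s 3 ?s" by (rule exec_Seq) simp
  then have body: "exec (Case i (\<lambda>z. case z of None \<Rightarrow> Skip | Some x \<Rightarrow> Pop i ;; Push j (h x))) s 4 ?s"
    using Cons.prems by (intro exec_Case[where t = 3]) auto
  have "exec (move_com i j P h) ?s (5 * length xs + 1) (?s(i := ys, j := rev (map h xs) @ ?s j))"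
    using Cons.prems(2) assms(4) by (intro Cons.IH) auto
  moreover have "?s(i := ys, j := rev (map h xs) @ ?s j) = s(i := ys, j := rev (map h (x # xs)) @ s j)"
    using assms(4) by (auto simp: fun_eq_iff)
  ultimately have rest: "exec (move_com i j P h) ?s (5 * length xs + 1) (s(i := ys, j := rev (map h (x # xs)) @ s j))"
    by simp
  show ?case unfolding move_com_def
    by (rule exec_While_True[OF _ body rest[unfolded move_com_def]]) (use Cons.prems in auto)
qed

lemma exec_move:
  assumes "s i = xs @ ys" "list_all P xs" "\<not> holds P (peek ys)" "i \<noteq> j" "5 * length xs + 1 \<le> t"
    "s' = s(i := ys, j := rev (map h xs) @ s j)"
  shows "exec (move_com i j P h) s t s'"
  using exec_move_com[of s i xs ys P j h] assms by (auto simp: list_all_iff intro: exec.weaken)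

lemma wf_move_com: "\<lbrakk>i \<in> I; j \<in> I; h ` B \<subseteq> B\<rbrakk> \<Longrightarrow> wf_com I B (move_com i j P h)"
  by (auto simp: move_com_def)

definition push_all :: "'i \<Rightarrow> 'b list \<Rightarrow> ('i, 'b) com" where
  "push_all i xs = foldr (\<lambda>x c. Push i x ;; c) xs Skip"

lemma exec_push_all: "exec (push_all i xs) s (2 * length xs + 1) (s(i := rev xs @ s i))"
proof (induction xs arbitrary: s)
  case Nil
  show ?case unfolding push_all_def by (simp, rule exec_Skip) auto
next
  case (Cons x xs)
  have "exec (push_all i xs) (s(i := x # s i)) (2 * length xs + 1) (s(i := rev (x # xs) @ s i))"
    using Cons.IH[of "s(i := x # s i)"] by (simp add: fun_upd_def cong: if_cong)
  from exec_Seq[OF exec.Push this order_refl] show ?case by (simp add: push_all_def fun_upd_def)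
qed

lemma wf_push_all: "i \<in> I \<Longrightarrow> set xs \<subseteq> B \<Longrightarrow> wf_com I B (push_all i xs)"
  by (induction xs) (auto simp: push_all_def)

text \<open>Stores of the program are written out by their contents, in the order of the registers; the last
argument is the right half of tape \<open>0\<close>. Updates then simplify to a normal form.\<close>

fun store :: "'b list \<Rightarrow> 'b list \<Rightarrow> 'b list \<Rightarrow> 'b list \<Rightarrow> 'b list \<Rightarrow> 'b list \<Rightarrow> 'b list \<Rightarrow> 'b list \<Rightarrow> 'b list
    \<Rightarrow> reg \<Rightarrow> 'b list" where
  "store i a u w d p c q r RI = i"
| "store i a u w d p c q r RA = a"
| "store i a u w d p c q r RU = u"
| "store i a u w d p c q r RW = w"
| "store i a u w d p c q r RD = d"
| "store i a u w d p c q r RP = p"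
| "store i a u w d p c q r RC = c"
| "store i a u w d p c q r RQ = q"
| "store i a u w d p c q r (TL j) = []"
| "store i a u w d p c q r (TR j) = (if j = 0 then r else [])"

lemma store_upd [simp]:
  "(store i a u w d p c q r)(RI := x) = store x a u w d p c q r"
  "(store i a u w d p c q r)(RA := x) = store i x u w d p c q r"
  "(store i a u w d p c q r)(RU := x) = store i a x w d p c q r"
  "(store i a u w d p c q r)(RW := x) = store i a u x d p c q r"
  "(store i a u w d p c q r)(RD := x) = store i a u w x p c q r"
  "(store i a u w d p c q r)(RP := x) = store i a u w d x c q r"
  "(store i a u w d p c q r)(RC := x) = store i a u w d p x q r"
  "(store i a u w d p c q r)(RQ := x) = store i a u w d p c x r"
  "(store i a u w d p c q r)(TR 0 := x) = store i a u w d p c q x"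
  by ((rule ext, rename_tac z, case_tac z, simp_all)[1])+

text \<open>The stores between calls of the simulated machines.\<close>

abbreviation state :: "'b list \<Rightarrow> 'b list \<Rightarrow> 'b list \<Rightarrow> 'b list \<Rightarrow> 'b list \<Rightarrow> 'b list \<Rightarrow> reg \<Rightarrow> 'b list" where
  "state i a u d p c \<equiv> store i a u [] d p c [] []"

type_synonym ('t, 'l) syllable = "'t \<times> 'l list"

fun is_let :: "('x, 't, 'l) sym \<Rightarrow> bool" where
  "is_let (Let x l) = True"
| "is_let _ = False"

fun tape_letter :: "('x, 't, 'l) sym \<Rightarrow> ('x, 't, 'l) sym" where
  "tape_letter (Let x l) = TS (Letter l)"
| "tape_letter _ = TS Blank"

fun code :: "('t, 'l) syllable \<Rightarrow> ('x, 't, 'l) stack" where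
  "code (x, a) = map (Let x) a @ [Sep]"

definition codes :: "('t, 'l) syllable list \<Rightarrow> ('x, 't, 'l) stack" where
  "codes v = concat (map code v)"

definition block :: "('t, 'l) syllable list \<Rightarrow> ('x, 't, 'l) stack" where
  "block v = codes v @ [End]"

definition blocks :: "('t, 'l) syllable list list \<Rightarrow> ('x, 't, 'l) stack" where
  "blocks bs = concat (map block bs)"

text \<open>A left factor lies on its stack in reverse, with its last syllable on top, and is described by the
reversed list of its syllables.\<close>

definition rcodes :: "('t, 'l) syllable list \<Rightarrow> ('x, 't, 'l) stack" where
  "rcodes u = rev (codes (rev u))"

lemma codes_simps [simp]: "codes [] = []" "codes ((x, a) # v) = map (Let x) a @ Sep # codes v"
  "codes (u @ v) = codes u @ codes v"
  by (simp_all add: codes_def)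

lemma rcodes_simps [simp]: "rcodes [] = []" "rcodes ((x, a) # u) = Sep # map (Let x) (rev a) @ rcodes u"
  by (simp_all add: rcodes_def rev_map)

lemma blocks_simps [simp]: "blocks [] = []" "blocks (b # bs) = codes b @ End # blocks bs"
  "blocks (bs @ bs') = blocks bs @ blocks bs'"
  by (simp_all add: blocks_def block_def)

lemma codes_no_End: "z \<in> set (codes v) \<Longrightarrow> z \<noteq> End"
  by (induction v) auto

definition letters :: "('t, 'l) syllable list \<Rightarrow> nat" where
  "letters v = sum_list (map (length \<circ> snd) v)"

lemma letters_simps [simp]: "letters [] = 0" "letters ((x, a) # v) = length a + letters v"
  "letters (u @ v) = letters u + letters v" "letters (rev v) = letters v"
  by (simp_all add: letters_def rev_map[symmetric] sum_list_rev)

definition clen :: "('t, 'l) syllable list \<Rightarrow> nat" where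
  "clen v = letters v + length v"

definition blen :: "('t, 'l) syllable list list \<Rightarrow> nat" where
  "blen bs = sum_list (map (\<lambda>b. clen b + 1) bs)"

lemma clen_simps [simp]: "clen [] = 0" "clen ((x, a) # v) = length a + clen v + 1" "clen (u @ v) = clen u + clen v"
  "clen (rev v) = clen v"
  by (simp_all add: clen_def)

lemma blen_simps [simp]: "blen [] = 0" "blen (b # bs) = clen b + 1 + blen bs" "blen (bs @ bs') = blen bs + blen bs'"
  by (simp_all add: blen_def)

lemma length_codes [simp]: "length (codes v) = clen v"
  by (induction v) auto

lemma length_blocks [simp]: "length (blocks bs) = blen bs"
  by (induction bs) auto

text \<open>The group enters through two things only: which neighbouring syllables can be joined, and whether
the joined syllable vanishes, which is decided by the given machines. The inclusion of alphabets is what allows the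
letters of the left syllable to be read as letters of the right one.\<close>

locale merging =
  fixes X :: "'t set" and Y :: "'t \<Rightarrow> 'l set" and M :: "'t \<Rightarrow> 'l tm"
    and compat :: "'t \<Rightarrow> 't \<Rightarrow> bool" and triv :: "'t \<Rightarrow> 'l list \<Rightarrow> bool"
    and G :: "nat \<Rightarrow> nat"
  assumes finite_X: "finite X"
    and wf_M: "x \<in> X \<Longrightarrow> wf_tm (Y x) (M x)"
    and decides: "\<lbrakk>x \<in> X; w \<in> lists (Y x); w \<noteq> []\<rbrakk> \<Longrightarrow> \<exists>t \<le> G (length w).
      fst ((tm_step (M x) ^^ t) (tm_init (M x) w)) = (if triv x w then tm_accept (M x) else tm_reject (M x))"
    and compat: "\<lbrakk>compat x y; x \<in> X; y \<in> X\<rbrakk> \<Longrightarrow> Y x \<subseteq> Y y"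
    and superadditive: "G m + G n \<le> G (m + n)"
begin

text \<open>Syllables are nonempty because their tag is read off from a letter.\<close>

definition wf_syl :: "('t, 'l) syllable \<Rightarrow> bool" where
  "wf_syl s \<longleftrightarrow> fst s \<in> X \<and> snd s \<in> lists (Y (fst s)) \<and> snd s \<noteq> []"

text \<open>The left factor is given in reverse, so that recursion proceeds from the seam outwards.\<close>

fun merge :: "('t, 'l) syllable list \<Rightarrow> ('t, 'l) syllable list \<Rightarrow> ('t, 'l) syllable list" where
  "merge [] v = v"
| "merge (s # u) [] = rev (s # u)"
| "merge ((x, a) # u) ((y, b) # v) =
     (if compat x y then if triv y (a @ b) then merge u v else rev u @ (y, a @ b) # v
      else rev u @ (x, a) # (y, b) # v)"

fun pass :: "('t, 'l) syllable list list \<Rightarrow> ('t, 'l) syllable list list" where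
  "pass (b # b' # bs) = merge (rev b) b' # pass bs"
| "pass bs = bs"

lemma merge_wf: "list_all wf_syl u \<Longrightarrow> list_all wf_syl v \<Longrightarrow> list_all wf_syl (merge u v)"
proof (induction u v rule: merge.induct)
  case (3 x a u y b v)
  then show ?case using compat[of x y] by (auto simp: wf_syl_def list_all_iff)
qed (auto simp: list_all_iff)

lemma merge_size: "clen (merge u v) \<le> clen u + clen v"
proof (induction u v rule: merge.induct)
  case (2 s u)
  show ?case by (cases s) simp
qed auto

definition sim_factor :: nat where
  "sim_factor = (\<Sum>x\<in>X. 16 * tm_tapes (M x) + 10)"

text \<open>Time for treating syllables with \<open>n\<close> letters in total. The constant \<open>100\<close> is a generous allowance for
copying. Like \<open>G\<close> this is superadditive.\<close>

definition cost :: "nat \<Rightarrow> nat" where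
  "cost n = (100 + 2 * sim_factor) * (G n + n)"

lemma cost_superadditive: "cost m + cost n \<le> cost (m + n)"
proof -
  have "cost m + cost n = (100 + 2 * sim_factor) * ((G m + G n) + (m + n))"
    by (simp add: cost_def algebra_simps)
  also have "\<dots> \<le> cost (m + n)" unfolding cost_def
    by (intro mult_left_mono add_right_mono superadditive) simp
  finally show ?thesis .
qed

lemma cost_mono: "m \<le> n \<Longrightarrow> cost m \<le> cost n"
  using cost_superadditive[of m "n - m"] by simp

definition retag :: "'t \<Rightarrow> ('x, 't, 'l) sym \<Rightarrow> ('x, 't, 'l) sym" where
  "retag y z = (case z of Let x l \<Rightarrow> if l \<in> Y y then Let y l else Mark | _ \<Rightarrow> Mark)"

definition feed_com :: "('x, 't, 'l) program" where
  "feed_com = While RW (\<lambda>z. z \<noteq> None) (Case RW (\<lambda>z. case z of None \<Rightarrow> Skip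
     | Some z \<Rightarrow> Pop RW ;; Push RA z ;; Push (TR 0) (tape_letter z)))"

text \<open>The left syllable is moved on top of the right one with the tag of the latter. The joined
syllable is taken off to \<open>RW\<close> and put back while a copy is fed to the machine. If it vanishes
it is removed; otherwise popping \<open>RC\<close> ends the cancellation.\<close>

definition combine_com :: "'t \<Rightarrow> ('x, 't, 'l) program" where
  "combine_com y = move_com RU RA is_let (retag y) ;; move_com RA RW is_let id ;; feed_com ;;
     sim_com (Y y) (M y) ;;
     Case RQ (\<lambda>q. Pop RQ ;; (if q = Some (St (tm_accept (M y)))
       then While RA (holds is_let) (Pop RA) ;; Pop RA else Pop RC))"

definition merge_step :: "('x, 't, 'l) program" where
  "merge_step = Case RU (\<lambda>u. if u = None then Pop RC else
     Case RA (\<lambda>z. case z of Some (Let y l) \<Rightarrow>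
         Pop RU ;; Case RU (\<lambda>z. case z of Some (Let x l) \<Rightarrow>
             if compat x y then combine_com y else Push RU Sep ;; Pop RC
           | _ \<Rightarrow> Pop RC)
       | _ \<Rightarrow> Pop RC))"

definition merge_com :: "('x, 't, 'l) program" where
  "merge_com = Push RC Mark ;; While RC (\<lambda>z. z \<noteq> None) merge_step"

lemma exec_feed_com:
  fixes z :: "('x, 't, 'l) stack"
  shows "exec feed_com (store i a u z d p c q r) (8 * length z + 1)
    (store i (rev z @ a) u [] d p c q (rev (map tape_letter z) @ r))"
proof (induction z arbitrary: a r)
  case Nil
  show ?case unfolding feed_com_def by (rule exec_While_False) simp_all
next
  case (Cons x z)
  let ?s = "store i (x # a) u z d p c q (tape_letter x # r)"
  have 1: "exec (Pop RW) (store i a u (x # z) d p c q r) 1 (store i a u z d p c q r)"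
    by (rule exec_Pop) simp_all
  have 2: "exec (Push RA x) (store i a u z d p c q r) 1 (store i (x # a) u z d p c q r)"
    by (rule exec_Push) simp_all
  have 3: "exec (Push (TR 0) (tape_letter x)) (store i (x # a) u z d p c q r) 1 ?s"
    by (rule exec_Push) simp_all
  have 4: "exec (Case RW (\<lambda>z. case z of None \<Rightarrow> Skip | Some z \<Rightarrow> Pop RW ;; Push RA z ;; Push (TR 0) (tape_letter z)))
    (store i a u (x # z) d p c q r) 6 ?s"
    using exec_Seq[OF 1 exec_Seq[OF 2 3 order_refl] order_refl] by (intro exec_Case[where t = "1 + (1 + 1 + 1) + 1"]) simp_all
  show ?case unfolding feed_com_def
    using exec_While_True[OF _ 4 Cons.IH[of "x # a" "tape_letter x # r", unfolded feed_com_def],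
        where v = "8 * length (x # z) + 1"]
    by simp
qed

lemma exec_skip_letters:
  fixes a :: "('x, 't, 'l) stack"
  assumes "list_all is_let zs" "\<not> holds is_let (peek a)"
  shows "exec (While RA (holds is_let) (Pop RA)) (store i (zs @ a) u w d p c q r) (2 * length zs + 1)
    (store i a u w d p c q r)"
  using assms(1)
proof (induction zs)
  case Nil
  then show ?case using assms(2) by (intro exec_While_False) simp_all
next
  case (Cons z zs)
  have "exec (Pop RA) (store i ((z # zs) @ a) u w d p c q r) 1 (store i (zs @ a) u w d p c q r)"
    by (rule exec_Pop) simp_all
  from exec_While_True[OF _ this, of "holds is_let"] Cons show ?case by auto
qed

lemma combine_bound:
  fixes g n m k k' c :: nat
  assumes "k \<le> k'" "c = 100 * g + k'" "1 \<le> n" "n \<le> g" "m \<le> n"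
  shows "5 * m + 1 + (5 * n + 1 + (8 * n + 1 + (k + (2 * n + 6) + 1) + 1) + 1) + 1 \<le> c - 20"
  using assms by linarith

text \<open>The \<open>20\<close> steps that are left of the allowance pay for the branching around the call.\<close>

lemma exec_combine_com:
  fixes v :: "('t, 'l) syllable list"
  assumes wf: "wf_syl (x, a)" "wf_syl (y, b)" and xy: "compat x y"
  shows "exec (combine_com y)
      (state i (codes ((y, b) # v) @ End # (rest :: ('x, 't, 'l) stack)) (map (Let x) (rev a) @ rcodes u) d p [Mark])
      (cost (length a + length b) - 20)
      (if triv y (a @ b) then state i (codes v @ End # rest) (rcodes u) d p [Mark]
       else state i (codes ((y, a @ b) # v) @ End # rest) (rcodes u) d p [])"
proof -
  let ?ab = "a @ b" and ?r = "codes v @ End # rest"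
  let ?A = "map (Let y) ?ab @ Sep # ?r"
  let ?n = "length a + length b"
  have aY: "a \<in> lists (Y y)" "a \<noteq> []" "b \<in> lists (Y y)" "y \<in> X"
    using wf compat[OF xy] by (auto simp: wf_syl_def)
  have u: "\<not> holds is_let (peek (rcodes u))" by (cases u) auto
  have re: "rev (map (retag y :: ('x, 't, 'l) sym \<Rightarrow> _) (map (Let x) (rev a))) = map (Let y) a"
    using aY(1) by (auto simp: rev_map retag_def)
  have 1: "exec (move_com RU RA is_let (retag y)) (state i (codes ((y, b) # v) @ End # rest) (map (Let x) (rev a) @ rcodes u) d p [Mark])
      (5 * length a + 1) (state i (?A) (rcodes u) d p [Mark])"
    by (rule exec_move[where xs = "map (Let x) (rev a)" and ys = "rcodes u"]) (use u re in \<open>auto simp: list_all_iff\<close>)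
  have 2: "exec (move_com RA RW is_let id) (state i (?A) (rcodes u) d p [Mark])
      (5 * ?n + 1) (store i (Sep # ?r) (rcodes u) (rev (map (Let y) ?ab)) d p [Mark] [] [])"
    by (rule exec_move[where xs = "map (Let y) ?ab" and ys = "Sep # ?r"]) (auto simp: list_all_iff)
  have 3: "exec feed_com (store i (Sep # ?r) (rcodes u) (rev (map (Let y) ?ab)) d p [Mark] [] [])
      (8 * ?n + 1) (store i (?A) (rcodes u) [] d p [Mark] [] (map (TS \<circ> Letter) ?ab))"
    using exec_feed_com[of i "Sep # ?r" "rcodes u" "rev (map (Let y) ?ab)" d p "[Mark]" "[]" "[]"]
    by (simp add: rev_map comp_def add.commute)
  let ?q = "if triv y ?ab then tm_accept (M y) else tm_reject (M y)"
  obtain t where t: "t \<le> G ?n" "fst ((tm_step (M y) ^^ t) (tm_init (M y) ?ab)) = ?q"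
    using decides[of y ?ab] aY by auto
  have sim: "exec (sim_com (Y y) (M y)) (store i (?A) (rcodes u) [] d p [Mark] [] (map (TS \<circ> Letter) ?ab))
      ((16 * tm_tapes (M y) + 10) * (t + length ?ab + 1))
      ((store i (?A) (rcodes u) [] d p [Mark] [] (map (TS \<circ> Letter) ?ab))(TR 0 := [], RQ := [St ?q]))"
    using aY t by (intro exec_sim_com[OF wf_M]) (auto simp: halted_def)
  have le: "(16 * tm_tapes (M y) + 10) * (t + length ?ab + 1) \<le> sim_factor * (G ?n + ?n + 1)"
    using t(1) aY finite_X unfolding sim_factor_def
    by (intro mult_mono) (auto intro!: member_le_sum[where f = "\<lambda>x. 16 * tm_tapes (M x) + 10"])
  have eq: "(store i (?A) (rcodes u) [] d p [Mark] [] (map (TS \<circ> Letter) ?ab))(TR 0 := [], RQ := [St ?q])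
      = store i (?A) (rcodes u) [] d p [Mark] [St ?q] []"
    by (simp only: store_upd)
  have 4: "exec (sim_com (Y y) (M y)) (store i (?A) (rcodes u) [] d p [Mark] [] (map (TS \<circ> Letter) ?ab))
      (sim_factor * (G ?n + ?n + 1)) (store i (?A) (rcodes u) [] d p [Mark] [St ?q] [])"
    using exec.weaken[OF sim le] unfolding eq .
  let ?f = "if triv y ?ab then state i ?r (rcodes u) d p [Mark]
       else state i (codes ((y, ?ab) # v) @ End # rest) (rcodes u) d p []"
  have acc: "St (tm_accept (M y)) \<noteq> (St (tm_reject (M y)) :: ('x, 't, 'l) sym)"
    using wf_M[OF aY(4)] by (simp add: wf_tm_def)
  have 5: "exec (Case RQ (\<lambda>q. Pop RQ ;; (if q = Some (St (tm_accept (M y)))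
       then While RA (holds is_let) (Pop RA) ;; Pop RA else Pop RC)))
      (store i (?A) (rcodes u) [] d p [Mark] [St ?q] []) (2 * ?n + 6) ?f"
  proof (rule exec_Case)
    have p: "exec (Pop RQ) (store i (?A) (rcodes u) [] d p [Mark] [St ?q] []) 1
      (state i (?A) (rcodes u) d p [Mark])"
      by (rule exec_Pop) simp_all
    have "exec (if Some (St ?q) = Some (St (tm_accept (M y)) :: ('x, 't, 'l) sym)
       then While RA (holds is_let) (Pop RA) ;; Pop RA else Pop RC)
      (state i (?A) (rcodes u) d p [Mark]) (2 * ?n + 3) ?f"
    proof (cases "triv y ?ab")
      case True
      have lets: "list_all is_let (map (Let y) ?ab :: ('x, 't, 'l) stack)" by (auto simp: list_all_iff)
      have sk: "exec (While RA (holds is_let) (Pop RA)) (state i (?A) (rcodes u) d p [Mark])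
        (2 * ?n + 1) (state i (Sep # ?r) (rcodes u) d p [Mark])"
        using exec_skip_letters[OF lets, of "Sep # ?r"] by simp
      have "exec (Pop RA) (state i (Sep # ?r) (rcodes u) d p [Mark]) 1 (state i ?r (rcodes u) d p [Mark])"
        by (rule exec_Pop) simp_all
      from exec_Seq[OF sk this, of "2 * ?n + 3"] True show ?thesis by simp
    next
      case False
      then show ?thesis using acc by (auto intro!: exec_Pop)
    qed
    from exec_Seq[OF p this order_refl]
    show "exec (Pop RQ ;; (if peek (store i (?A) (rcodes u) [] d p [Mark] [St ?q] [] RQ)
         = Some (St (tm_accept (M y))) then While RA (holds is_let) (Pop RA) ;; Pop RA else Pop RC))
      (store i (?A) (rcodes u) [] d p [Mark] [St ?q] []) (1 + (2 * ?n + 3) + 1) ?f"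
      by simp
  qed simp
  have n: "1 \<le> ?n" using aY(2) by (cases a) auto
  have "sim_factor * (G ?n + ?n + 1) \<le> sim_factor * (2 * (G ?n + ?n))" by (rule mult_le_mono2) (use n in simp)
  moreover have "cost ?n = 100 * (G ?n + ?n) + sim_factor * (2 * (G ?n + ?n))"
    unfolding cost_def by (simp only: add_mult_distrib mult.assoc mult.left_commute)
  ultimately have bound: "5 * length a + 1 + (5 * ?n + 1 + (8 * ?n + 1 + (sim_factor * (G ?n + ?n + 1) + (2 * ?n + 6) + 1) + 1) + 1) + 1 \<le> cost ?n - 20"
    using n by (rule combine_bound) simp_all
  show ?thesis unfolding combine_com_def
    using exec_Seq[OF 1 exec_Seq[OF 2 exec_Seq[OF 3 exec_Seq[OF 4 5 order_refl] order_refl] order_refl] bound] .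
qed


lemma exec_merge_step_stop:
  fixes rest :: "('x, 't, 'l) stack"
  assumes "u = [] \<or> v = [] \<or> \<not> compat (fst (hd u)) (fst (hd v))"
    "list_all wf_syl u" "list_all wf_syl v"
  shows "exec merge_step (state i (codes v @ End # rest) (rcodes u) d p [Mark]) 9
    (state i (codes v @ End # rest) (rcodes u) d p [])"
proof -
  have pop: "exec (Pop RC) (state i a u' d p [Mark]) 1 (state i a u' d p [])" for a u'
    by (rule exec_Pop) simp_all
  show ?thesis
  proof (cases u)
    case Nil
    then show ?thesis unfolding merge_step_def by (intro exec_Case[where t = 1]) (use pop in auto)
  next
    case (Cons xa u')
    obtain x a where xa: "xa = (x, a)" by (cases xa)
    obtain l a' where a: "rev a = l # a'"
      using assms(2) by (cases "rev a") (auto simp: Cons xa wf_syl_def)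
    show ?thesis
    proof (cases v)
      case Nil
      then show ?thesis unfolding merge_step_def Cons xa
        using pop[THEN exec.weaken, of 7]
        by (intro exec_Case[where t = 8]) (auto intro!: exec_Case[where t = 7])
    next
      case (Cons yb v')
      obtain y b where yb: "yb = (y, b)" by (cases yb)
      obtain l' b' where b: "b = l' # b'"
        using assms(3) by (cases b) (auto simp: Cons yb wf_syl_def)
      have nc: "\<not> compat x y" using assms(1) \<open>u = xa # u'\<close> xa Cons yb by simp
      have p: "exec (Pop RU) (state i (codes v @ End # rest) (rcodes u) d p [Mark]) 1
        (state i (codes v @ End # rest) (tl (rcodes u)) d p [Mark])"
        by (rule exec_Pop) simp_all
      have q: "exec (Push RU Sep) (state i (codes v @ End # rest) (tl (rcodes u)) d p [Mark]) 1
        (state i (codes v @ End # rest) (rcodes u) d p [Mark])"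
        by (rule exec_Push) (simp_all add: \<open>u = xa # u'\<close> xa)
      have "exec (Push RU Sep ;; Pop RC) (state i (codes v @ End # rest) (tl (rcodes u)) d p [Mark]) 3
        (state i (codes v @ End # rest) (rcodes u) d p [])"
        by (rule exec_Seq[OF q pop]) simp
      then have "exec (Case RU (\<lambda>z. case z of Some (Let x l) \<Rightarrow>
             if compat x y then combine_com y else Push RU Sep ;; Pop RC
           | _ \<Rightarrow> Pop RC)) (state i (codes v @ End # rest) (tl (rcodes u)) d p [Mark]) 4
        (state i (codes v @ End # rest) (rcodes u) d p [])"
        by (intro exec_Case[where t = 3]) (simp_all add: \<open>u = xa # u'\<close> xa a nc)
      from exec_Seq[OF p this, of 6] show ?thesis unfolding merge_step_def
        by (intro exec_Case[where t = 8] exec_Case[where t = 7])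
          (auto simp: Cons yb b \<open>u = xa # u'\<close> xa a intro!: exec_Case[where t = 7] intro: exec.weaken)
    qed
  qed
qed

lemma exec_merge_step_combine:
  fixes rest :: "('x, 't, 'l) stack"
  assumes "compat x y" "wf_syl (x, a)" "wf_syl (y, b)"
  shows "exec merge_step (state i (codes ((y, b) # v) @ End # rest) (rcodes ((x, a) # u)) d p [Mark])
    (cost (length a + length b) - 10)
    (if triv y (a @ b) then state i (codes v @ End # rest) (rcodes u) d p [Mark]
       else state i (codes ((y, a @ b) # v) @ End # rest) (rcodes u) d p [])"
proof -
  let ?A = "codes ((y, b) # v) @ End # rest" and ?U = "map (Let x) (rev a) @ rcodes u"
  let ?f = "if triv y (a @ b) then state i (codes v @ End # rest) (rcodes u) d p [Mark]
       else state i (codes ((y, a @ b) # v) @ End # rest) (rcodes u) d p []"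
  let ?n = "length a + length b"
  obtain l a' where a: "rev a = l # a'"
    using assms(2) by (cases "rev a") (auto simp: wf_syl_def)
  obtain l' b' where b: "b = l' # b'"
    using assms(3) by (cases b) (auto simp: wf_syl_def)
  have n: "20 \<le> cost ?n" by (auto simp: cost_def b)
  have p: "exec (Pop RU) (state i ?A (Sep # ?U) d p [Mark]) 1 (state i ?A ?U d p [Mark])"
    by (rule exec_Pop) simp_all
  have "exec (Case RU (\<lambda>z. case z of Some (Let x l) \<Rightarrow>
             if compat x y then combine_com y else Push RU Sep ;; Pop RC
           | _ \<Rightarrow> Pop RC)) (state i ?A ?U d p [Mark]) (cost ?n - 20 + 1) ?f"
    by (intro exec_Case[where t = "cost ?n - 20"])
      (use exec_combine_com[OF assms(2,3,1), of i v rest u d p] assms(1) in \<open>simp_all add: a\<close>)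
  from exec_Seq[OF p this order_refl] show ?thesis unfolding merge_step_def
    by (intro exec_Case[where t = "1 + (cost ?n - 20 + 1) + 1 + 1"])
      (use n in \<open>auto simp: b intro!: exec_Case[where t = "1 + (cost ?n - 20 + 1) + 1"]\<close>)
qed

lemma exec_merge_loop_stop:
  fixes rest :: "('x, 't, 'l) stack"
  assumes "u = [] \<or> v = [] \<or> \<not> compat (fst (hd u)) (fst (hd v))"
    "list_all wf_syl u" "list_all wf_syl v" "12 \<le> t"
  shows "exec (While RC (\<lambda>z. z \<noteq> None) merge_step) (state i (codes v @ End # rest) (rcodes u) d p [Mark]) t
    (state i (codes v @ End # rest) (rcodes u) d p [])"
  by (rule exec_While_True[OF _ exec_merge_step_stop[OF assms(1-3)] exec_While_False[OF _ order_refl HOL.refl]])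
    (use assms(4) in simp_all)

text \<open>The pairs of syllables that are combined are disjoint pieces of the two words, so that
  superadditivity bounds the total time by the cost of one run on all letters.\<close>

lemma exec_merge_loop:
  fixes rest :: "('x, 't, 'l) stack"
  assumes "list_all wf_syl u" "list_all wf_syl v"
  shows "\<exists>u' v'. merge u v = rev u' @ v' \<and>
    exec (While RC (\<lambda>z. z \<noteq> None) merge_step) (state i (codes v @ End # rest) (rcodes u) d p [Mark])
      (cost (letters u + letters v) + 12) (state i (codes v' @ End # rest) (rcodes u') d p [])"
  using assms
proof (induction u v rule: merge.induct)
  case (1 v)
  show ?case by (intro exI[of _ "[]"] exI[of _ v] conjI exec_merge_loop_stop) (use 1 in simp_all)
next
  case (2 s u)
  show ?case by (intro exI[of _ "s # u"] exI[of _ "[]"] conjI exec_merge_loop_stop) (use 2 in simp_all)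
next
  case (3 x a u y b v)
  let ?s = "state i (codes ((y, b) # v) @ End # rest) (rcodes ((x, a) # u)) d p [Mark]"
  let ?W = "While RC (\<lambda>z. z \<noteq> None) merge_step"
  let ?n = "letters ((x, a) # u) + letters ((y, b) # v)"
  have wf: "wf_syl (x, a)" "wf_syl (y, b)" using 3 by auto
  show ?case
  proof (cases "compat x y")
    case False
    then show ?thesis
      by (intro exI[of _ "(x, a) # u"] exI[of _ "(y, b) # v"] conjI exec_merge_loop_stop) (use 3 in simp_all)
  next
    case True
    have c: "cost (length a + length b) + cost (letters u + letters v) \<le> cost ?n"
      using cost_superadditive[of "length a + length b" "letters u + letters v"] by (simp add: ac_simps)
    have c20: "20 \<le> cost (length a + length b)"
      using wf by (cases a) (auto simp: cost_def wf_syl_def)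
    show ?thesis
    proof (cases "triv y (a @ b)")
      case t: True
      obtain u' v' where uv: "merge u v = rev u' @ v'"
        "exec ?W (state i (codes v @ End # rest) (rcodes u) d p [Mark])
          (cost (letters u + letters v) + 12) (state i (codes v' @ End # rest) (rcodes u') d p [])"
        using "3.IH"[OF True t] "3.prems" by auto
      have 1: "exec merge_step ?s (cost (length a + length b) - 10)
        (state i (codes v @ End # rest) (rcodes u) d p [Mark])"
        using exec_merge_step_combine[OF True wf, of i v rest u d p] t by simp
      have "exec ?W ?s (cost ?n + 12) (state i (codes v' @ End # rest) (rcodes u') d p [])"
        by (rule exec_While_True[OF _ 1 uv(2)]) (use c c20 in simp_all)
      then show ?thesis using uv(1) True t by (intro exI[of _ u'] exI[of _ v']) simp
    next
      case t: False
      have 1: "exec merge_step ?s (cost (length a + length b) - 10)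
        (state i (codes ((y, a @ b) # v) @ End # rest) (rcodes u) d p [])"
        using exec_merge_step_combine[OF True wf, of i v rest u d p] t by simp
      have 2: "exec ?W (state i (codes ((y, a @ b) # v) @ End # rest) (rcodes u) d p []) 1
        (state i (codes ((y, a @ b) # v) @ End # rest) (rcodes u) d p [])"
        by (rule exec_While_False) simp_all
      have "exec ?W ?s (cost ?n + 12) (state i (codes ((y, a @ b) # v) @ End # rest) (rcodes u) d p [])"
        by (rule exec_While_True[OF _ 1 2]) (use c c20 in simp_all)
      then show ?thesis using True t by (intro exI[of _ u] exI[of _ "(y, a @ b) # v"]) simp
    qed
  qed
qed

end

section \<open>The merging program\<close>

context merging
begin

definition merge_blocks_com :: "('x, 't, 'l) program" where
  "merge_blocks_com = Push RP Mark ;; merge_com ;; move_com RA RU (\<lambda>z. z \<noteq> End) id ;; Pop RA"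

text \<open>The first block goes to \<open>RU\<close>, in reverse. If another block follows, the two are multiplied, and the
result is assembled on \<open>RU\<close> before it is moved to \<open>RD\<close>, which puts it in forward order again.\<close>

definition pair_com :: "('x, 't, 'l) program" where
  "pair_com = move_com RA RU (\<lambda>z. z \<noteq> End) id ;; Pop RA ;;
     Case RA (\<lambda>z. if z = None then Skip else merge_blocks_com) ;;
     Push RD End ;; move_com RU RD (\<lambda>_. True) id"

definition pass_com :: "('x, 't, 'l) program" where
  "pass_com = While RA (\<lambda>z. z \<noteq> None) pair_com"

text \<open>A pass leaves the blocks in the opposite order on \<open>RD\<close>. Returning them to \<open>RA\<close> restores the order.\<close>

definition back_com :: "('x, 't, 'l) program" where
  "back_com = While RD (\<lambda>z. z \<noteq> None)
     (move_com RD RU (\<lambda>z. z \<noteq> End) id ;; Pop RD ;; Push RA End ;; move_com RU RA (\<lambda>_. True) id)"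

definition loop_com :: "('x, 't, 'l) program" where
  "loop_com = While RP (\<lambda>z. z \<noteq> None) (drain RP ;; pass_com ;; back_com)"

text \<open>Each input letter is replaced by a block that represents it. The input arrives with its last
letter on top, hence the block of the first letter is pushed last.\<close>

definition translate_com :: "('x \<Rightarrow> ('t, 'l) syllable list) \<Rightarrow> ('x, 't, 'l) program" where
  "translate_com Bl = While RI (\<lambda>z. z \<noteq> None)
     (Case RI (\<lambda>z. case z of Some (Inp x) \<Rightarrow> Pop RI ;; push_all RA (rev (block (Bl x))) | _ \<Rightarrow> Pop RI))"

definition main_com :: "('x \<Rightarrow> ('t, 'l) syllable list) \<Rightarrow> ('x, 't, 'l) program" where
  "main_com Bl = translate_com Bl ;; Push RP Mark ;; loop_com ;; Pop RA"

lemma codes_all: "list_all (\<lambda>z. z \<noteq> End) (codes v)"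
  using codes_no_End by (auto simp: list_all_iff)

lemma exec_merge_blocks_com:
  fixes rest :: "('x, 't, 'l) stack"
  assumes "list_all wf_syl b" "list_all wf_syl b'"
  shows "exec merge_blocks_com (state i (codes b' @ End # rest) (rev (codes b)) d p [])
    (cost (letters b + letters b') + 5 * (clen b + clen b') + 20)
    (state i rest (rev (codes (merge (rev b) b'))) d (Mark # p) [])"
proof -
  let ?m = "merge (rev b) b'"
  have "list_all wf_syl (rev b)" using assms(1) by simp
  from exec_merge_loop[OF this assms(2), of i rest d "Mark # p"] obtain u' v' where m: "?m = rev u' @ v'"
    and loop: "exec (While RC (\<lambda>z. z \<noteq> None) merge_step) (state i (codes b' @ End # rest) (rcodes (rev b)) d (Mark # p) [Mark])
      (cost (letters (rev b) + letters b') + 12) (state i (codes v' @ End # rest) (rcodes u') d (Mark # p) [])"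
    by auto
  have rb: "rcodes (rev b) = (rev (codes b) :: ('x, 't, 'l) stack)" by (simp add: rcodes_def)
  have 1: "exec (Push RP Mark) (state i (codes b' @ End # rest) (rev (codes b)) d p []) 1
    (state i (codes b' @ End # rest) (rev (codes b)) d (Mark # p) [])"
    by (rule exec_Push) simp_all
  have 2: "exec (Push RC Mark) (state i (codes b' @ End # rest) (rev (codes b)) d (Mark # p) []) 1
    (state i (codes b' @ End # rest) (rev (codes b)) d (Mark # p) [Mark])"
    by (rule exec_Push) simp_all
  have 3: "exec merge_com (state i (codes b' @ End # rest) (rev (codes b)) d (Mark # p) [])
    (cost (letters b + letters b') + 14) (state i (codes v' @ End # rest) (rcodes u') d (Mark # p) [])"
    unfolding merge_com_def by (rule exec_Seq[OF 2 loop[unfolded rb]]) simp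
  have "clen v' \<le> clen ?m" by (simp add: m)
  also have "\<dots> \<le> clen b + clen b'" using merge_size[of "rev b" b'] by simp
  finally have s: "clen v' \<le> clen b + clen b'" .
  have 4: "exec (move_com RA RU (\<lambda>z. z \<noteq> End) id) (state i (codes v' @ End # rest) (rcodes u') d (Mark # p) [])
    (5 * (clen b + clen b') + 1) (state i (End # rest) (rev (codes ?m)) d (Mark # p) [])"
    by (rule exec_move[where xs = "codes v'" and ys = "End # rest"])
      (use s codes_all[of v'] in \<open>auto simp: m rcodes_def\<close>)
  have 5: "exec (Pop RA) (state i (End # rest) (rev (codes ?m)) d (Mark # p) []) 1
    (state i rest (rev (codes ?m)) d (Mark # p) [])"
    by (rule exec_Pop) simp_all
  show ?thesis unfolding merge_blocks_com_def
    by (rule exec_Seq[OF 1 exec_Seq[OF 3 exec_Seq[OF 4 5 order_refl] order_refl]]) simp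
qed

lemma exec_collect:
  fixes d :: "('x, 't, 'l) stack"
  shows "exec (Push RD End ;; move_com RU RD (\<lambda>_. True) id) (state i a (rev (codes m)) d p [])
    (5 * clen m + 3) (state i a [] (codes m @ End # d) p [])"
proof -
  have 1: "exec (Push RD End) (state i a (rev (codes m)) d p []) 1 (state i a (rev (codes m)) (End # d) p [])"
    by (rule exec_Push) simp_all
  have 2: "exec (move_com RU RD (\<lambda>_. True) id) (state i a (rev (codes m)) (End # d) p [])
    (5 * clen m + 1) (state i a [] (codes m @ End # d) p [])"
    by (rule exec_move[where xs = "rev (codes m)" and ys = "[]"]) (auto simp: list_all_iff)
  show ?thesis by (rule exec_Seq[OF 1 2]) simp
qed

lemma exec_first_block:
  fixes a :: "('x, 't, 'l) stack"
  shows "exec (move_com RA RU (\<lambda>z. z \<noteq> End) id) (state i (codes b @ End # a) [] d p [])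
    (5 * clen b + 1) (state i (End # a) (rev (codes b)) d p [])"
  by (rule exec_move[where xs = "codes b" and ys = "End # a"]) (use codes_all[of b] in auto)

text \<open>Different products involve different blocks, so superadditivity bounds the time for all of them by
the cost of the total length.\<close>

lemma exec_pass_com:
  fixes d :: "('x, 't, 'l) stack"
  assumes "list_all (list_all wf_syl) bs"
  shows "exec pass_com (state i (blocks bs) [] d p [])
    (cost (blen bs) + 60 * blen bs + 1)
    (state i [] [] (blocks (rev (pass bs)) @ d) (replicate (length bs div 2) Mark @ p) [])"
  using assms
proof (induction bs arbitrary: d p rule: pass.induct)
  case (1 b b' bs)
  define rest where "rest = blen bs"
  let ?m = "merge (rev b) b'"
  let ?A = "codes b' @ End # blocks bs :: ('x, 't, 'l) stack"
  have wf: "list_all wf_syl b" "list_all wf_syl b'" using 1 by auto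
  have sm: "clen ?m \<le> clen b + clen b'" using merge_size[of "rev b" b'] by simp
  have pop: "exec (Pop RA) (state i (End # ?A) (rev (codes b)) d p []) 1 (state i ?A (rev (codes b)) d p [])"
    by (rule exec_Pop) simp_all
  have cs: "exec (Case RA (\<lambda>z. if z = None then Skip else merge_blocks_com)) (state i ?A (rev (codes b)) d p [])
    (cost (letters b + letters b') + 5 * (clen b + clen b') + 21)
    (state i (blocks bs) (rev (codes ?m)) d (Mark # p) [])"
  proof (rule exec_Case)
    have "peek ?A \<noteq> None" by (cases "codes b' :: ('x, 't, 'l) stack") auto
    then show "exec (if peek (state i ?A (rev (codes b)) d p [] RA) = None then Skip else merge_blocks_com)
      (state i ?A (rev (codes b)) d p []) (cost (letters b + letters b') + 5 * (clen b + clen b') + 20)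
      (state i (blocks bs) (rev (codes ?m)) d (Mark # p) [])"
      using exec_merge_blocks_com[where i = i and rest = "blocks bs" and d = d and p = p, OF wf] by auto
  qed simp
  have pair: "exec pair_com (state i (blocks (b # b' # bs)) [] d p [])
    (cost (letters b + letters b') + 15 * (clen b + clen b') + 40)
    (state i (blocks bs) [] (codes ?m @ End # d) (Mark # p) [])"
    unfolding pair_com_def blocks_simps
    by (rule exec_Seq[OF exec_first_block exec_Seq[OF pop exec_Seq[OF cs exec_collect order_refl] order_refl]])
      (use sm in simp)
  have "list_all (list_all wf_syl) bs" using 1 by simp
  from "1.IH"[OF this, of "codes ?m @ End # d" "Mark # p"]
  have IH: "exec pass_com (state i (blocks bs) [] (codes ?m @ End # d) (Mark # p) []) (cost rest + 60 * rest + 1)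
    (state i [] [] (blocks (rev (pass (b # b' # bs))) @ d) (replicate (length (b # b' # bs) div 2) Mark @ p) [])"
    by (simp add: rest_def replicate_app_Cons_same)
  have "letters b + letters b' \<le> clen b + clen b' + 2"
    by (simp add: clen_def)
  then have "cost (letters b + letters b') + cost rest \<le> cost (clen b + clen b' + 2) + cost rest"
    by (simp add: cost_mono)
  also have "\<dots> \<le> cost (clen b + clen b' + 2 + rest)" by (rule cost_superadditive)
  finally have c: "cost (letters b + letters b') + cost rest \<le> cost (clen b + clen b' + 2 + rest)" .
  have len: "blen (b # b' # bs) = clen b + clen b' + 2 + rest"
    by (simp add: rest_def)
  have ne: "peek (blocks (b # b' # bs) :: ('x, 't, 'l) stack) \<noteq> None"
    by (cases "codes b :: ('x, 't, 'l) stack") auto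
  show ?case unfolding len pass_com_def
    by (rule exec_While_True[OF _ pair IH[unfolded pass_com_def]]) (use c ne in simp_all)
next
  case "2_1"
  show ?case unfolding pass_com_def by (rule exec_While_False) simp_all
next
  case ("2_2" b)
  have pop: "exec (Pop RA) (state i [End] (rev (codes b)) d p []) 1 (state i [] (rev (codes b)) d p [])"
    by (rule exec_Pop) simp_all
  have cs: "exec (Case RA (\<lambda>z. if z = None then Skip else merge_blocks_com)) (state i [] (rev (codes b)) d p []) 2
    (state i [] (rev (codes b)) d p [])"
    by (rule exec_Case[where t = 1]) (simp_all add: exec_Skip)
  have pair: "exec pair_com (state i (blocks [b]) [] d p [])
    (10 * clen b + 20)
    (state i [] [] (codes b @ End # d) p [])"
    unfolding pair_com_def blocks_simps
    by (rule exec_Seq[OF exec_first_block exec_Seq[OF pop exec_Seq[OF cs exec_collect order_refl] order_refl]]) simp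
  have 2: "exec pass_com (state i [] [] (codes b @ End # d) p []) 1
      (state i [] [] (blocks (rev (pass [b])) @ d) (replicate (length [b] div 2) Mark @ p) [])"
    unfolding pass_com_def by (rule exec_While_False) simp_all
  have bound: "10 * n + 20 + 1 + 1 \<le> cost (n + 1) + 60 * (n + 1) + 1" for n by simp
  have ne: "peek (blocks [b] :: ('x, 't, 'l) stack) \<noteq> None"
    by (cases "codes b :: ('x, 't, 'l) stack") auto
  show ?case unfolding pass_com_def
    by (rule exec_While_True[OF _ pair 2[unfolded pass_com_def]]) (use ne bound in auto)
qed

lemma exec_back_com:
  fixes a :: "('x, 't, 'l) stack"
  shows "exec back_com (state i a [] (blocks ds) p []) (20 * blen ds + 1)
    (state i (blocks (rev ds) @ a) [] [] p [])"
proof (induction ds arbitrary: a)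
  case Nil
  show ?case unfolding back_com_def by (rule exec_While_False) simp_all
next
  case (Cons b ds)
  define n where "n = clen b"
  have 1: "exec (move_com RD RU (\<lambda>z. z \<noteq> End) id) (state i a [] (blocks (b # ds)) p []) (5 * n + 1)
    (state i a (rev (codes b)) (End # blocks ds) p [])"
    by (rule exec_move[where xs = "codes b" and ys = "End # blocks ds"]) (use codes_all[of b] in \<open>auto simp: n_def\<close>)
  have 2: "exec (Pop RD) (state i a (rev (codes b)) (End # blocks ds) p []) 1
    (state i a (rev (codes b)) (blocks ds) p [])"
    by (rule exec_Pop) simp_all
  have 3: "exec (Push RA End) (state i a (rev (codes b)) (blocks ds) p []) 1
    (state i (End # a) (rev (codes b)) (blocks ds) p [])"
    by (rule exec_Push) simp_all
  have 4: "exec (move_com RU RA (\<lambda>_. True) id) (state i (End # a) (rev (codes b)) (blocks ds) p []) (5 * n + 1)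
    (state i (codes b @ End # a) [] (blocks ds) p [])"
    by (rule exec_move[where xs = "rev (codes b)" and ys = "[]"]) (auto simp: list_all_iff n_def)
  have ne: "peek (blocks (b # ds) :: ('x, 't, 'l) stack) \<noteq> None"
    by (cases "codes b :: ('x, 't, 'l) stack") auto
  have IH: "exec back_com (state i (codes b @ End # a) [] (blocks ds) p []) (20 * blen ds + 1)
    (state i (blocks (rev (b # ds)) @ a) [] [] p [])"
    using Cons.IH[of "codes b @ End # a"] by simp
  show ?case unfolding back_com_def
    by (rule exec_While_True[OF _ exec_Seq[OF 1 exec_Seq[OF 2 exec_Seq[OF 3 4 order_refl] order_refl] order_refl] IH[unfolded back_com_def]])
      (use ne in \<open>simp_all add: n_def\<close>)
qed

lemma length_pass: "length (pass bs) = (length bs + 1) div 2"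
  by (induction bs rule: pass.induct) auto

lemma pass_wf: "list_all (list_all wf_syl) bs \<Longrightarrow> list_all (list_all wf_syl) (pass bs)"
  by (induction bs rule: pass.induct) (auto simp: merge_wf)

lemma pass_size: "blen (pass bs) \<le> blen bs"
proof (induction bs rule: pass.induct)
  case (1 b b' bs)
  then show ?case using merge_size[of "rev b" b'] by simp
qed simp_all

lemma blen_rev: "blen (rev bs) = blen bs"
  by (induction bs) auto

lemma length_le_blen: "length bs \<le> blen bs"
  by (induction bs) auto

definition round_cost :: "nat \<Rightarrow> nat" where
  "round_cost n = cost n + 85 * n + 10"

text \<open>A pass halves the number of blocks, rounding up; the last round finds nothing left to merge
  and leaves the flag stack \<open>RP\<close> empty.\<close>

lemma exec_loop_com:
  fixes bs :: "('t, 'l) syllable list list" and i :: "('x, 't, 'l) stack"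
  assumes "list_all (list_all wf_syl) bs" "length bs \<le> 2 ^ r" "blen bs \<le> n"
    "0 < m" "m \<le> n + 1"
  shows "\<exists>k. length ((pass ^^ k) bs) \<le> 1 \<and>
    exec loop_com (state i (blocks bs) [] [] (replicate m Mark) []) ((r + 1) * round_cost n + 1)
      (state i (blocks ((pass ^^ k) bs)) [] [] [] [])"
proof -
  have iter: "exec loop_com (state i (blocks bs) [] [] (replicate m Mark) []) (round_cost n + t) s'"
    if bs: "list_all (list_all wf_syl) bs" "blen bs \<le> n" "0 < m" "m \<le> n + 1"
      and next_round: "exec loop_com (state i (blocks (pass bs)) [] [] (replicate (length bs div 2) Mark) []) t s'"
    for bs :: "('t, 'l) syllable list list" and m t s'
  proof -
  define p where "p = (replicate (length bs div 2) Mark :: ('x, 't, 'l) stack)"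
  have 1: "exec (drain RP) (state i (blocks bs) [] [] (replicate m Mark) []) (2 * m + 1)
    (state i (blocks bs) [] [] [] [])"
    using exec_drain[of RP "state i (blocks bs) [] [] (replicate m Mark) []"] by simp
  have 2: "exec pass_com (state i (blocks bs) [] [] [] []) (cost n + 60 * n + 1)
    (state i [] [] (blocks (rev (pass bs))) p [])"
    by (rule exec.weaken) (use exec_pass_com[OF bs(1), of i "[]" "[]"] in \<open>simp add: p_def\<close>,
      use bs(2) cost_mono[OF bs(2)] in simp)
  have 3: "exec back_com (state i [] [] (blocks (rev (pass bs))) p []) (20 * n + 1)
    (state i (blocks (pass bs)) [] [] p [])"
    by (rule exec.weaken) (use exec_back_com[of i "[]" "rev (pass bs)" p] in simp,
      use bs(2) pass_size[of bs] in \<open>simp add: blen_rev\<close>)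
  have body: "exec (drain RP ;; pass_com ;; back_com) (state i (blocks bs) [] [] (replicate m Mark) [])
    (round_cost n - 1) (state i (blocks (pass bs)) [] [] p [])"
    by (rule exec_Seq[OF 1 exec_Seq[OF 2 3 order_refl]]) (use bs(4) in \<open>simp add: round_cost_def\<close>)
  show "exec loop_com (state i (blocks bs) [] [] (replicate m Mark) []) (round_cost n + t) s'"
    unfolding loop_com_def
    by (rule exec_While_True[OF _ body next_round[folded p_def, unfolded loop_com_def]])
      (use bs(3) in \<open>cases m, simp_all add: round_cost_def\<close>)
  qed
  have small: "\<exists>k. length ((pass ^^ k) bs) \<le> 1 \<and>
      exec loop_com (state i (blocks bs) [] [] (replicate m Mark) []) ((r + 1) * round_cost n + 1)
        (state i (blocks ((pass ^^ k) bs)) [] [] [] [])"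
    if bs: "list_all (list_all wf_syl) bs" "blen bs \<le> n" "0 < m" "m \<le> n + 1"
      and le: "length bs \<le> 1" for r m and bs :: "('t, 'l) syllable list list"
  proof -
    have "length bs div 2 = 0" using le by simp
    then have "exec loop_com (state i (blocks (pass bs)) [] [] (replicate (length bs div 2) Mark) []) 1
        (state i (blocks (pass bs)) [] [] [] [])"
      unfolding loop_com_def by (intro exec_While_False) simp_all
    from exec.weaken[OF iter[OF bs this], of "(r + 1) * round_cost n + 1"]
    show ?thesis using le by (intro exI[of _ 1]) (simp add: length_pass)
  qed
  show ?thesis using assms
  proof (induction r arbitrary: bs m)
    case 0
    then show ?case using small[of bs m 0] by simp
  next
    case (Suc r)
    show ?case
    proof (cases "length bs \<le> 1")
      case True
      then show ?thesis using small[of bs m "Suc r"] Suc.prems by simp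
    next
      case False
      have "length (pass bs) \<le> 2 ^ r" "0 < length bs div 2"
        using Suc.prems(2) False by (auto simp: length_pass)
      moreover have "blen (pass bs) \<le> n"
        using pass_size[of bs] Suc.prems(3) by simp
      moreover have "length bs \<le> n"
        using length_le_blen[of bs] Suc.prems(3) by simp
      then have "length bs div 2 \<le> n + 1" by simp
      ultimately obtain k where k: "length ((pass ^^ k) (pass bs)) \<le> 1"
        "exec loop_com (state i (blocks (pass bs)) [] [] (replicate (length bs div 2) Mark) [])
          ((r + 1) * round_cost n + 1) (state i (blocks ((pass ^^ k) (pass bs))) [] [] [] [])"
        using Suc.IH[OF pass_wf[OF Suc.prems(1)], of "length bs div 2"] by blast
      from exec.weaken[OF iter[OF Suc.prems(1,3,4,5) k(2)], of "(Suc r + 1) * round_cost n + 1"]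
      show ?thesis using k(1) by (intro exI[of _ "Suc k"]) (simp add: funpow_swap1)
    qed
  qed
qed

lemma exec_translate_com:
  fixes Bl :: "'x \<Rightarrow> ('t, 'l) syllable list"
  assumes "\<And>x. x \<in> set xs \<Longrightarrow> clen (Bl x) + 1 \<le> c"
  shows "exec (translate_com Bl) (state (map Inp xs) a [] [] [] []) ((2 * c + 6) * length xs + 1)
    (state [] (blocks (map Bl (rev xs)) @ a) [] [] [] [])"
  using assms
proof (induction xs arbitrary: a)
  case Nil
  show ?case unfolding translate_com_def by (rule exec_While_False) simp_all
next
  case (Cons x xs)
  let ?s = "state (map Inp (x # xs)) a [] [] [] []"
  have 1: "exec (Pop RI) ?s 1 (state (map Inp xs) a [] [] [] [])"
    by (rule exec_Pop) simp_all
  have "exec (push_all RA (rev (block (Bl x)))) (state (map Inp xs) a [] [] [] [])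
    (2 * (clen (Bl x) + 1) + 1) (state (map Inp xs) (block (Bl x) @ a) [] [] [] [])"
    using exec_push_all[of RA "rev (block (Bl x))" "state (map Inp xs) a [] [] [] []"]
    by (simp add: block_def)
  then have 2: "exec (push_all RA (rev (block (Bl x)))) (state (map Inp xs) a [] [] [] [])
    (2 * c + 1) (state (map Inp xs) (block (Bl x) @ a) [] [] [] [])"
    by (rule exec.weaken) (use Cons.prems[of x] in simp)
  have body: "exec (Case RI (\<lambda>z. case z of Some (Inp x) \<Rightarrow> Pop RI ;; push_all RA (rev (block (Bl x))) | _ \<Rightarrow> Pop RI))
    ?s (2 * c + 4) (state (map Inp xs) (block (Bl x) @ a) [] [] [] [])"
    by (rule exec_Case[where t = "1 + (2 * c + 1) + 1"]) (use exec_Seq[OF 1 2 order_refl] in simp_all)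
  have IH: "exec (translate_com Bl) (state (map Inp xs) (block (Bl x) @ a) [] [] [] []) ((2 * c + 6) * length xs + 1)
    (state [] (blocks (map Bl (rev (x # xs))) @ a) [] [] [] [])"
    using Cons.IH[of "block (Bl x) @ a"] Cons.prems by (simp add: block_def)
  show ?case unfolding translate_com_def
    by (rule exec_While_True[OF _ body IH[unfolded translate_com_def]]) simp_all
qed

definition total_cost :: "nat \<Rightarrow> nat \<Rightarrow> nat" where
  "total_cost c n = (2 * c + 6) * n + (floor_log n + 2) * round_cost (c * n) + 10"

text \<open>At the end at most one block is left on \<open>RA\<close>. Removing the topmost symbol makes the stack empty
exactly if there was no block at all, or a single one consisting of its end marker only.\<close>

lemma exec_main_com:
  fixes Bl :: "'x \<Rightarrow> ('t, 'l) syllable list"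
  assumes c: "\<And>x. x \<in> T \<Longrightarrow> clen (Bl x) + 1 \<le> c"
    and wf: "\<And>x. x \<in> T \<Longrightarrow> list_all wf_syl (Bl x)" and w: "w \<in> lists T"
  shows "\<exists>s k. length ((pass ^^ k) (map Bl w)) \<le> 1 \<and>
    exec (main_com Bl) ((\<lambda>_. [])(RI := map Inp (rev w))) (total_cost c (length w)) s \<and>
    (s RA = [] \<longleftrightarrow> concat ((pass ^^ k) (map Bl w)) = [])"
proof -
  have s0: "(\<lambda>_. [])(RI := map Inp (rev w)) = state (map Inp (rev w)) [] [] [] [] []"
    by (rule ext, rename_tac z, case_tac z) simp_all
  have 1: "exec (translate_com Bl) (state (map Inp (rev w)) [] [] [] [] []) ((2 * c + 6) * length w + 1)
    (state [] (blocks (map Bl w)) [] [] [] [])"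
    using exec_translate_com[of "rev w" Bl c "[]"] c w by auto
  have 2: "exec (Push RP Mark) (state [] (blocks (map Bl w)) [] [] [] []) 1
    (state [] (blocks (map Bl w)) [] [] [Mark] [])"
    by (rule exec_Push) simp_all
  have bw: "list_all (list_all wf_syl) (map Bl w)" using wf w by (auto simp: list_all_iff)
  have lw: "length (map Bl w) \<le> 2 ^ (floor_log (length w) + 1)" using floor_log_exp2_ge[of "length w"] by simp
  have "blen (map Bl w) = (\<Sum>x\<leftarrow>w. clen (Bl x) + 1)"
    by (simp add: blen_def comp_def)
  also have "\<dots> \<le> (\<Sum>x\<leftarrow>w. c)" using c w by (intro sum_list_mono) auto
  finally have n: "blen (map Bl w) \<le> c * length w"
    by (simp add: sum_list_triv mult.commute)
  obtain k where k: "length ((pass ^^ k) (map Bl w)) \<le> 1"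
    and 3: "exec loop_com (state ([] :: ('x, 't, 'l) stack) (blocks (map Bl w)) [] [] (replicate 1 Mark) [])
      ((floor_log (length w) + 1 + 1) * round_cost (c * length w) + 1)
      (state [] (blocks ((pass ^^ k) (map Bl w))) [] [] [] [])"
    using exec_loop_com[OF bw lw n, of 1 "[]"] by auto
  have 4: "exec (Pop RA) (state [] (blocks ((pass ^^ k) (map Bl w))) [] [] [] []) 1
    (state [] (tl (blocks ((pass ^^ k) (map Bl w)))) [] [] [] [])"
    by (rule exec_Pop) simp_all
  have loop: "exec loop_com (state ([] :: ('x, 't, 'l) stack) (blocks (map Bl w)) [] [] [Mark] [])
      ((floor_log (length w) + 2) * round_cost (c * length w) + 1)
      (state [] (blocks ((pass ^^ k) (map Bl w))) [] [] [] [])"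
    using 3 by simp
  have "exec (main_com Bl) (state (map Inp (rev w)) [] [] [] [] []) (total_cost c (length w))
    (state [] (tl (blocks ((pass ^^ k) (map Bl w)))) [] [] [] [])"
    unfolding main_com_def
    by (rule exec_Seq[OF 1 exec_Seq[OF 2 exec_Seq[OF loop 4 order_refl] order_refl]]) (simp add: total_cost_def)
  moreover have "tl (blocks bs :: ('x, 't, 'l) stack) = [] \<longleftrightarrow> concat bs = []" if small: "length bs \<le> 1" for bs
  proof (cases bs)
    case (Cons b bs')
    then have bs: "bs = [b]" using small by simp
    show ?thesis
    proof (cases b)
      case (Cons s b')
      then show ?thesis by (cases s; cases "snd s") (auto simp: bs)
    qed (simp add: bs)
  qed simp
  ultimately show ?thesis using k unfolding s0
    by (intro exI[of _ "state [] (tl (blocks ((pass ^^ k) (map Bl w)))) [] [] [] []"] exI[of _ k]) simp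
qed

definition symbols :: "'x set \<Rightarrow> ('x, 't, 'l) sym set" where
  "symbols T = Inp ` T \<union> (\<Union>x\<in>X. Let x ` Y x) \<union> {Sep, End, Mark, TS Blank} \<union>
     (\<Union>x\<in>X. St ` {..<tm_states (M x)} \<union> TS ` tm_symbols (Y x) (M x))"

definition registers :: "reg set" where
  "registers = {RI, RA, RU, RW, RD, RP, RC, RQ, TR 0} \<union>
     (\<Union>x\<in>X. TL ` {..<tm_tapes (M x)} \<union> TR ` {..<tm_tapes (M x)})"

lemma finite_symbols: "finite T \<Longrightarrow> finite (symbols T)"
  using finite_X wf_M by (auto simp: symbols_def tm_symbols_def wf_tm_def)

lemma wf_main_com:
  assumes wf: "\<And>x. x \<in> T \<Longrightarrow> list_all wf_syl (Bl x)"
  shows "wf_com registers (symbols T) (main_com Bl)"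
proof -
  let ?I = registers and ?B = "symbols T"
  have I: "RI \<in> ?I" "RA \<in> ?I" "RU \<in> ?I" "RW \<in> ?I" "RD \<in> ?I" "RP \<in> ?I" "RC \<in> ?I" "RQ \<in> ?I" "TR 0 \<in> ?I"
    by (auto simp: registers_def)
  have B: "Sep \<in> ?B" "End \<in> ?B" "Mark \<in> ?B" "TS Blank \<in> ?B" by (auto simp: symbols_def)
  have letB: "Let x l \<in> ?B \<longleftrightarrow> x \<in> X \<and> l \<in> Y x" for x l by (auto simp: symbols_def)
  have retag: "retag y ` ?B \<subseteq> ?B" if "y \<in> X" for y
    using B that letB by (auto simp: retag_def split: sym.split)
  have tl: "tape_letter z \<in> ?B" if "z \<in> ?B" for z
  proof -
    have "TS (Letter l) \<in> ?B" if "x \<in> X" "l \<in> Y x" for x l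
    proof -
      have "TS (Letter l) \<in> TS ` tm_symbols (Y x) (M x)" using that by (auto simp: tm_symbols_def)
      then show ?thesis unfolding symbols_def by (rule UnI2[OF UN_I[OF that(1) UnI2]])
    qed
    then show ?thesis using that B letB by (cases z) (simp_all, blast)
  qed
  have sim: "wf_com ?I ?B (sim_com (Y y) (M y))" if "y \<in> X" for y
    using that by (intro wf_sim_com wf_M) (auto simp: registers_def symbols_def)
  have feed: "wf_com ?I ?B feed_com" using I tl by (simp add: feed_com_def)
  have comb: "wf_com ?I ?B (combine_com y)" if "y \<in> X" for y
    using that I B sim feed retag by (auto simp: combine_com_def wf_move_com)
  have step: "wf_com ?I ?B merge_step"
    using I B comb letB by (auto simp: merge_step_def split: sym.split)
  have pass: "wf_com ?I ?B pass_com"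
    using I B step by (auto simp: pass_com_def pair_com_def merge_blocks_com_def merge_com_def wf_move_com)
  have bk: "wf_com ?I ?B back_com" using I B by (auto simp: back_com_def wf_move_com)
  have loop: "wf_com ?I ?B loop_com" using I B pass bk by (auto simp: loop_com_def drain_def)
  have codes: "set (codes v) \<subseteq> ?B" if "list_all wf_syl v" for v
    using that B letB by (induction v) (auto simp: wf_syl_def)
  have "set (block (Bl x)) \<subseteq> ?B" if "Inp x \<in> ?B" for x
  proof -
    have "x \<in> T" using that by (auto simp: symbols_def)
    then show ?thesis using codes[OF wf] B by (auto simp: block_def)
  qed
  then have "wf_com ?I ?B (push_all RA (rev (block (Bl x))))" if "Inp x \<in> ?B" for x
    using that I by (intro wf_push_all) simp_all
  then have "wf_com ?I ?B (translate_com Bl)"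
    using I B by (auto simp: translate_com_def split: sym.split)
  then show ?thesis using I B loop by (auto simp: main_com_def)
qed

text \<open>The number of passes that is needed is not made explicit: any number that leaves at most one
block will do, which is why the condition on \<open>L\<close> refers to all of them.\<close>

theorem decidable_by_merging:
  fixes Bl :: "'x \<Rightarrow> ('t, 'l) syllable list"
  assumes T: "finite T" and wf: "\<And>x. x \<in> T \<Longrightarrow> list_all wf_syl (Bl x)"
    and L: "\<And>w k. \<lbrakk>w \<in> lists T; length ((pass ^^ k) (map Bl w)) \<le> 1\<rbrakk>
      \<Longrightarrow> w \<in> L \<longleftrightarrow> concat ((pass ^^ k) (map Bl w)) = []"
    and time: "\<And>c. (\<lambda>n. real (2 * total_cost c n + 2 * n + 2)) \<preceq> f"
  shows "decidable_in_time T L f"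
proof -
  define c where "c = (\<Sum>x\<in>T. clen (Bl x) + 1)"
  have c: "clen (Bl x) + 1 \<le> c" if "x \<in> T" for x
    unfolding c_def using that T by (intro member_le_sum) auto
  have mono: "mono (total_cost c)"
    unfolding mono_def total_cost_def round_cost_def
    by (intro allI impI add_mono mult_mono cost_mono floor_log_le_iff) auto
  show ?thesis
  proof (rule decidable_by_program[OF T finite_symbols[OF T], where I = registers and inp = Inp and ri = RI and ro = RA
        and c = "main_com Bl" and T = "total_cost c"])
    show "finite registers" using finite_X by (auto simp: registers_def)
    show "Inp ` T \<subseteq> symbols T" by (auto simp: symbols_def)
    show "wf_com registers (symbols T) (main_com Bl)" by (rule wf_main_com[OF wf])
    show "RI \<in> registers" "RA \<in> registers" by (auto simp: registers_def)
    show "mono (total_cost c)" by (rule mono)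
    show "(\<lambda>n. real (2 * total_cost c n + 2 * n + 2)) \<preceq> f" by (rule time)
    fix w assume w: "w \<in> lists T"
    show "\<exists>s. exec (main_com Bl) ((\<lambda>_. [])(RI := map Inp (rev w))) (total_cost c (length w)) s \<and>
        (s RA = [] \<longleftrightarrow> w \<in> L)"
      using exec_main_com[of T Bl c w] c wf w L by blast
  qed
qed

end

section \<open>Normal forms in the fundamental group\<close>

lemma presented_eq_lists: "presented_eq A R u v \<Longrightarrow> u \<in> lists A \<and> v \<in> lists A"
  by (induction rule: presented_eq.induct) auto

lemma presented_eq_cong:
  assumes "presented_eq A R u v" "x \<in> lists A" "y \<in> lists A"
  shows "presented_eq A R (x @ u @ y) (x @ v @ y)"
  using assms
proof (induction rule: presented_eq.induct)
  case (relation u v x' y')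
  from presented_eq.relation[OF relation(1), of "x @ x'" A "y' @ y"] relation
  show ?case by simp
next
  case (refl u)
  then show ?case by (intro presented_eq.refl) auto
qed (auto intro: presented_eq.sym presented_eq.trans)

lemma presented_eq_append:
  assumes "presented_eq A R u u'" "presented_eq A R v v'"
  shows "presented_eq A R (u @ v) (u' @ v')"
proof -
  note l = presented_eq_lists[OF assms(1)] presented_eq_lists[OF assms(2)]
  have "presented_eq A R (u @ v) (u' @ v)"
    using presented_eq_cong[OF assms(1), of "[]" v] l by simp
  moreover have "presented_eq A R (u' @ v) (u' @ v')"
    using presented_eq_cong[OF assms(2), of u' "[]"] l by simp
  ultimately show ?thesis by (rule presented_eq.trans)
qed

lemma presented_eq_relation:
  assumes "(u, v) \<in> R" "u \<in> lists A" "v \<in> lists A"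
  shows "presented_eq A R u v"
  using presented_eq.relation[OF assms(1), of "[]" A "[]"] assms by simp

text \<open>Words are told apart by finding a set on which the generators act in accordance with the
  relations.\<close>

lemma presented_eq_action:
  assumes "presented_eq A R u v" "x \<in> X"
    and closed: "\<And>a x. a \<in> A \<Longrightarrow> x \<in> X \<Longrightarrow> act a x \<in> X"
    and rel: "\<And>u v x. (u, v) \<in> R \<Longrightarrow> x \<in> X \<Longrightarrow> foldr act u x = foldr act v x"
  shows "foldr act u x = foldr act v x"
proof -
  have cl: "foldr act w x \<in> X" if "w \<in> lists A" "x \<in> X" for w x
    using that by (induction w) (auto intro: closed)
  show ?thesis using assms(1,2)
    by (induction arbitrary: x rule: presented_eq.induct) (auto simp: cl rel)
qed

text \<open>Working with explicit representatives turns the group operations into operations on words.\<close>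

definition word_class :: "'a set \<Rightarrow> ('a list \<times> 'a list) set \<Rightarrow> 'a list \<Rightarrow> 'a list set" where
  "word_class A R w = {v. presented_eq A R w v}"

lemma word_class_eq: "u \<in> lists A \<Longrightarrow> word_class A R u = word_class A R v \<longleftrightarrow> presented_eq A R u v"
  by (auto simp: word_class_def intro: presented_eq.intros)

lemma carrier_presented: "carrier (presented A R) = word_class A R ` lists A"
  by (auto simp: presented_def quotient_def word_class_def)

lemma one_presented: "\<one>\<^bsub>presented A R\<^esub> = word_class A R []"
  by (simp add: presented_def word_class_def)

lemma mult_presented:
  assumes "u \<in> lists A" "v \<in> lists A"
  shows "word_class A R u \<otimes>\<^bsub>presented A R\<^esub> word_class A R v = word_class A R (u @ v)"
proof -
  have "presented_eq A R (u @ v) w" if "presented_eq A R u u'" "presented_eq A R v v'" "presented_eq A R (u' @ v') w" for u' v' w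
    using that by (blast intro: presented_eq.trans presented_eq_append)
  moreover have "presented_eq A R u u" "presented_eq A R v v" using assms by (auto intro: presented_eq.refl)
  ultimately show ?thesis by (auto simp: presented_def word_class_def)
qed

lemma group_presented:
  assumes "\<And>a. a \<in> A \<Longrightarrow> \<exists>b \<in> lists A. presented_eq A R (b @ [a]) []"
  shows "group (presented A R)"
proof (rule groupI)
  fix x y z
  assume "x \<in> carrier (presented A R)" "y \<in> carrier (presented A R)" "z \<in> carrier (presented A R)"
  then obtain u v w where uvw: "u \<in> lists A" "v \<in> lists A" "w \<in> lists A"
    "x = word_class A R u" "y = word_class A R v" "z = word_class A R w"
    by (auto simp: carrier_presented)
  show "x \<otimes>\<^bsub>presented A R\<^esub> y \<in> carrier (presented A R)"
    unfolding uvw(4,5) mult_presented[OF uvw(1,2)] carrier_presented using uvw by (intro imageI) auto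
  show "x \<otimes>\<^bsub>presented A R\<^esub> y \<otimes>\<^bsub>presented A R\<^esub> z = x \<otimes>\<^bsub>presented A R\<^esub> (y \<otimes>\<^bsub>presented A R\<^esub> z)"
    using uvw by (simp add: mult_presented)
  show "\<one>\<^bsub>presented A R\<^esub> \<otimes>\<^bsub>presented A R\<^esub> x = x"
    using uvw by (simp add: mult_presented one_presented)
  have "\<exists>u' \<in> lists A. presented_eq A R (u' @ u) []" using uvw(1)
  proof (induction u)
    case Nil
    then show ?case by (auto intro!: bexI[of _ "[]"] presented_eq.refl)
  next
    case (Cons a u)
    have "a \<in> A" using Cons by auto
    then obtain b where b: "b \<in> lists A" "presented_eq A R (b @ [a]) []" using assms by blast
    obtain u' where u': "u' \<in> lists A" "presented_eq A R (u' @ u) []" using Cons by auto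
    have "presented_eq A R (u' @ (b @ [a]) @ u) (u' @ [] @ u)"
      using b u' Cons by (intro presented_eq_cong) auto
    then have "presented_eq A R ((u' @ b) @ a # u) []" using u'(2) by (auto intro: presented_eq.trans)
    then show ?case using b u' by (intro bexI[of _ "u' @ b"]) auto
  qed
  then obtain u' where u': "u' \<in> lists A" "presented_eq A R (u' @ u) []" by blast
  have "word_class A R u' \<otimes>\<^bsub>presented A R\<^esub> x = \<one>\<^bsub>presented A R\<^esub>"
    unfolding uvw(4) mult_presented[OF u'(1) uvw(1)] one_presented using u' uvw(1) by (simp add: word_class_eq)
  then show "\<exists>y\<in>carrier (presented A R). y \<otimes>\<^bsub>presented A R\<^esub> x = \<one>\<^bsub>presented A R\<^esub>"
    using u'(1) by (auto simp: carrier_presented)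
qed (auto simp: one_presented carrier_presented)

lemma (in group) word_value_closed: "w \<in> lists (S \<times> UNIV) \<Longrightarrow> S \<subseteq> carrier G \<Longrightarrow> word_value G w \<in> carrier G"
  by (induction w) (auto simp: word_value_def)

lemma (in group) word_value_append:
  assumes "u \<in> lists (S \<times> UNIV)" "v \<in> lists (S \<times> UNIV)" "S \<subseteq> carrier G"
  shows "word_value G (u @ v) = word_value G u \<otimes> word_value G v"
  using assms(1)
proof (induction u)
  case Nil
  then show ?case using word_value_closed[OF assms(2,3)] by (simp add: word_value_def)
next
  case (Cons x u)
  obtain s b where "x = (s, b)" by (cases x)
  then show ?case using Cons assms word_value_closed[of u S] word_value_closed[of v S]
    by (auto simp: word_value_def m_assoc)
qed

lemma (in group) generate_word_value:
  assumes "g \<in> generate G S" "S \<subseteq> carrier G"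
  shows "\<exists>w \<in> lists (S \<times> UNIV). word_value G w = g"
  using assms(1)
proof (induction rule: generate.induct)
  case one
  then show ?case by (auto simp: word_value_def intro!: bexI[of _ "[]"])
next
  case (incl h)
  then show ?case using assms(2) by (auto simp: word_value_def intro!: bexI[of _ "[(h, True)]"])
next
  case (inv h)
  then show ?case using assms(2) by (auto simp: word_value_def intro!: bexI[of _ "[(h, False)]"])
next
  case (eng g h)
  then obtain u v where "u \<in> lists (S \<times> UNIV)" "v \<in> lists (S \<times> UNIV)" "word_value G u = g" "word_value G v = h"
    by auto
  then show ?case using word_value_append[of u S v] assms(2) by (intro bexI[of _ "u @ v"]) auto
qed

text \<open>Since \<open>Tr\<close> is closed under reversal, the stable letters outside it come in pairs of mutually inverse
ones, which are the free generators and their inverses.\<close>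

locale trivial_edge_groups = graph_of_groups \<Gamma> bar GV GE \<tau>
  for \<Gamma> :: "('v, 'e) pre_digraph" and bar :: "'e \<Rightarrow> 'e" and GV :: "'v \<Rightarrow> 'g monoid"
    and GE :: "'e \<Rightarrow> 'h monoid" and \<tau> :: "'e \<Rightarrow> 'h \<Rightarrow> 'g" +
  fixes Tr :: "'e set"
  assumes Tr: "Tr \<subseteq> arcs \<Gamma>" "bar ` Tr \<subseteq> Tr"
    and trivial: "\<And>\<alpha>. \<alpha> \<in> arcs \<Gamma> \<Longrightarrow> trivial_group (GE \<alpha>)"
begin

abbreviation "gens \<equiv> pi1_gens \<Gamma> GV"
abbreviation "rels \<equiv> pi1_rels \<Gamma> bar GV GE \<tau> Tr"
abbreviation pi1_eq :: "('v, 'e, 'g) pi1_gen list \<Rightarrow> ('v, 'e, 'g) pi1_gen list \<Rightarrow> bool" (infix "\<approx>" 50)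
  where "u \<approx> v \<equiv> presented_eq gens rels u v"

fun clash :: "('v, 'e, 'g) pi1_gen \<Rightarrow> ('v, 'e, 'g) pi1_gen \<Rightarrow> bool" where
  "clash (Elem \<mu> g) (Elem \<nu> h) \<longleftrightarrow> \<mu> = \<nu>"
| "clash (Stable \<alpha>) (Stable \<beta>) \<longleftrightarrow> \<beta> = bar \<alpha>"
| "clash _ _ \<longleftrightarrow> False"

fun proper :: "('v, 'e, 'g) pi1_gen \<Rightarrow> bool" where
  "proper (Elem \<mu> g) \<longleftrightarrow> \<mu> \<in> verts \<Gamma> \<and> g \<in> carrier (GV \<mu>) \<and> g \<noteq> \<one>\<^bsub>GV \<mu>\<^esub>"
| "proper (Stable \<alpha>) \<longleftrightarrow> \<alpha> \<in> arcs \<Gamma> \<and> \<alpha> \<notin> Tr"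
| "proper (StableInv \<alpha>) \<longleftrightarrow> False"

text \<open>Normal forms are themselves words in the generators: nontrivial elements of vertex groups and
letters \<open>t\<^sub>\<alpha>\<close> outside the tree, with nothing to multiply or cancel between neighbours.\<close>

fun reduced :: "('v, 'e, 'g) pi1_gen list \<Rightarrow> bool" where
  "reduced [] \<longleftrightarrow> True"
| "reduced (x # w) \<longleftrightarrow> proper x \<and> reduced w \<and> (w = [] \<or> \<not> clash x (hd w))"

fun prepend :: "'v \<Rightarrow> 'g \<Rightarrow> ('v, 'e, 'g) pi1_gen list \<Rightarrow> ('v, 'e, 'g) pi1_gen list" where
  "prepend \<mu> g w = (if g = \<one>\<^bsub>GV \<mu>\<^esub> then w else Elem \<mu> g # w)"

definition starts_at :: "'v \<Rightarrow> ('v, 'e, 'g) pi1_gen list \<Rightarrow> bool" where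
  "starts_at \<mu> w \<longleftrightarrow> (\<exists>g r. w = Elem \<mu> g # r)"

fun act_elem :: "'v \<Rightarrow> 'g \<Rightarrow> ('v, 'e, 'g) pi1_gen list \<Rightarrow> ('v, 'e, 'g) pi1_gen list" where
  "act_elem \<mu> g (Elem \<nu> h # r) = (if \<mu> = \<nu> then prepend \<mu> (g \<otimes>\<^bsub>GV \<mu>\<^esub> h) r else prepend \<mu> g (Elem \<nu> h # r))"
| "act_elem \<mu> g w = prepend \<mu> g w"

text \<open>Left multiplication on normal forms. It has to be checked that this respects the relations
(\<open>act_relation\<close>); then a reduced word can be recovered from its class by letting it act on \<open>[]\<close>.\<close>

definition act_stable :: "'e \<Rightarrow> ('v, 'e, 'g) pi1_gen list \<Rightarrow> ('v, 'e, 'g) pi1_gen list" where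
  "act_stable \<alpha> w = (if \<alpha> \<in> Tr then w else if w \<noteq> [] \<and> hd w = Stable (bar \<alpha>) then tl w else Stable \<alpha> # w)"

fun act :: "('v, 'e, 'g) pi1_gen \<Rightarrow> ('v, 'e, 'g) pi1_gen list \<Rightarrow> ('v, 'e, 'g) pi1_gen list" where
  "act (Elem \<mu> g) w = act_elem \<mu> g w"
| "act (Stable \<alpha>) w = act_stable \<alpha> w"
| "act (StableInv \<alpha>) w = act_stable (bar \<alpha>) w"

lemma bar_Tr: "bar \<alpha> \<in> Tr \<longleftrightarrow> \<alpha> \<in> Tr"
  using Tr(2) arev_arev by (metis image_subset_iff)

text \<open>Splitting off a possibly trivial element \<open>k\<close> of the vertex group avoids case distinctions:
the group acts by multiplication on \<open>k\<close> and leaves \<open>r\<close> alone.\<close>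

lemma reduced_split:
  assumes "reduced w" "\<mu> \<in> verts \<Gamma>"
  obtains k r where "k \<in> carrier (GV \<mu>)" "reduced r" "\<not> starts_at \<mu> r" "w = prepend \<mu> k r"
proof (cases "starts_at \<mu> w")
  case True
  then obtain g r where w: "w = Elem \<mu> g # r" by (auto simp: starts_at_def)
  then have "\<not> starts_at \<mu> r" using assms by (auto simp: starts_at_def)
  then show ?thesis using that[of g r] assms w by auto
next
  case False
  interpret group "GV \<mu>" using vertex_group[OF assms(2)] .
  show ?thesis using that[of "\<one>\<^bsub>GV \<mu>\<^esub>" w] False assms by simp
qed

lemma act_elem_not_start: "\<not> starts_at \<mu> r \<Longrightarrow> act_elem \<mu> g r = prepend \<mu> g r"
  by (cases "(\<mu>, g, r)" rule: act_elem.cases) (auto simp: starts_at_def)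

lemma act_elem_prepend:
  assumes "\<mu> \<in> verts \<Gamma>" "g \<in> carrier (GV \<mu>)" "k \<in> carrier (GV \<mu>)" "\<not> starts_at \<mu> r"
  shows "act_elem \<mu> g (prepend \<mu> k r) = prepend \<mu> (g \<otimes>\<^bsub>GV \<mu>\<^esub> k) r"
proof -
  interpret group "GV \<mu>" using vertex_group[OF assms(1)] .
  show ?thesis using assms act_elem_not_start by simp
qed

lemma reduced_prepend:
  "\<lbrakk>\<mu> \<in> verts \<Gamma>; g \<in> carrier (GV \<mu>); reduced r; \<not> starts_at \<mu> r\<rbrakk> \<Longrightarrow> reduced (prepend \<mu> g r)"
  by (cases r; cases "hd r") (auto simp: starts_at_def)

lemma reduced_act_elem:
  assumes "\<mu> \<in> verts \<Gamma>" "g \<in> carrier (GV \<mu>)" "reduced w"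
  shows "reduced (act_elem \<mu> g w)"
proof -
  interpret group "GV \<mu>" using vertex_group[OF assms(1)] .
  obtain k r where "k \<in> carrier (GV \<mu>)" "reduced r" "\<not> starts_at \<mu> r" "w = prepend \<mu> k r"
    using reduced_split[OF assms(3,1)] .
  then show ?thesis using act_elem_prepend reduced_prepend assms by simp
qed

lemma act_elem_mult:
  assumes "\<mu> \<in> verts \<Gamma>" "g \<in> carrier (GV \<mu>)" "h \<in> carrier (GV \<mu>)" "reduced w"
  shows "act_elem \<mu> g (act_elem \<mu> h w) = act_elem \<mu> (g \<otimes>\<^bsub>GV \<mu>\<^esub> h) w"
proof -
  interpret group "GV \<mu>" using vertex_group[OF assms(1)] .
  obtain k r where "k \<in> carrier (GV \<mu>)" "reduced r" "\<not> starts_at \<mu> r" "w = prepend \<mu> k r"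
    using reduced_split[OF assms(4,1)] .
  then show ?thesis using act_elem_prepend assms by (simp add: m_assoc del: prepend.simps)
qed

lemma act_elem_one:
  assumes "\<mu> \<in> verts \<Gamma>" "reduced w"
  shows "act_elem \<mu> \<one>\<^bsub>GV \<mu>\<^esub> w = w"
proof -
  interpret group "GV \<mu>" using vertex_group[OF assms(1)] .
  obtain k r where "k \<in> carrier (GV \<mu>)" "reduced r" "\<not> starts_at \<mu> r" "w = prepend \<mu> k r"
    using reduced_split[OF assms(2,1)] .
  then show ?thesis using act_elem_prepend assms by (simp del: prepend.simps)
qed

lemma reduced_act_stable: "\<lbrakk>\<alpha> \<in> arcs \<Gamma>; reduced w\<rbrakk> \<Longrightarrow> reduced (act_stable \<alpha> w)"
  by (cases w; cases "hd w") (auto simp: act_stable_def)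

lemma act_stable_inverse:
  assumes "reduced w"
  shows "act_stable \<alpha> (act_stable (bar \<alpha>) w) = w"
  using assms by (cases w; cases "tl w") (auto simp: act_stable_def bar_Tr)

lemma reduced_act: "x \<in> gens \<Longrightarrow> reduced w \<Longrightarrow> reduced (act x w)"
  using reduced_act_elem reduced_act_stable by (auto simp: pi1_gens_def)

lemma act_relation:
  assumes "(u, v) \<in> rels" "reduced w"
  shows "foldr act u w = foldr act v w"
  using assms(1)
proof cases
  case (vertex_mult \<mu> g h)
  then show ?thesis using act_elem_mult assms(2) by simp
next
  case (vertex_one \<mu>)
  then show ?thesis using act_elem_one assms(2) by simp
next
  case (stable_right_inv \<alpha>)
  then show ?thesis using act_stable_inverse assms(2) by simp
next
  case (stable_left_inv \<alpha>)
  then show ?thesis using act_stable_inverse[of w "bar \<alpha>"] assms(2) by simp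
next
  case (stable_rev \<alpha>)
  then show ?thesis by simp
next
  case (stable_tree \<alpha>)
  then show ?thesis by (simp add: act_stable_def)
next
  case (edge_conj \<alpha> x)
  have unit: "\<tau> \<beta> x = \<one>\<^bsub>GV (head \<Gamma> \<beta>)\<^esub>" if "\<beta> \<in> arcs \<Gamma>" "x \<in> carrier (GE \<beta>)" for \<beta>
  proof -
    have "x = \<one>\<^bsub>GE \<beta>\<^esub>" using trivial[OF that(1)] that(2) by (auto simp: trivial_group_def)
    moreover have "head \<Gamma> \<beta> \<in> verts \<Gamma>" using that by simp
    ultimately show ?thesis
      using hom_one[OF edge_hom edge_group vertex_group] that by simp
  qed
  have h: "head \<Gamma> \<alpha> \<in> verts \<Gamma>" "head \<Gamma> (bar \<alpha>) \<in> verts \<Gamma>" using edge_conj by auto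
  have "\<tau> \<alpha> x = \<one>\<^bsub>GV (head \<Gamma> \<alpha>)\<^esub>" "\<tau> (bar \<alpha>) x = \<one>\<^bsub>GV (head \<Gamma> (bar \<alpha>))\<^esub>"
    using unit edge_conj edge_group_rev by auto
  moreover have "reduced (act_stable (bar \<alpha>) w)" using edge_conj assms(2) by (intro reduced_act_stable) auto
  ultimately show ?thesis using edge_conj assms(2) h act_elem_one act_stable_inverse by simp
qed

lemma act_invariant: "u \<approx> v \<Longrightarrow> foldr act u [] = foldr act v []"
  by (rule presented_eq_action[where X = "Collect reduced"]) (auto intro: reduced_act act_relation)

lemma act_reduced: "reduced w \<Longrightarrow> foldr act w [] = w"
proof (induction w)
  case (Cons x w)
  then have "act x w = x # w"
    by (cases x; cases w; cases "hd w") (auto simp: act_stable_def)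
  then show ?case using Cons by simp
qed simp

text \<open>A reduced word acts on the empty word by producing itself, whereas a word equal to the identity
fixes the empty word.\<close>

theorem reduced_trivial: "reduced w \<Longrightarrow> w \<approx> [] \<Longrightarrow> w = []"
  using act_invariant[of w "[]"] act_reduced by simp

lemma proper_gens: "proper x \<Longrightarrow> x \<in> gens"
  by (cases x) (auto simp: pi1_gens_def)

lemma reduced_gens: "reduced w \<Longrightarrow> w \<in> lists gens"
  by (induction w) (auto intro: proper_gens)

lemma gens_intros:
  "\<mu> \<in> verts \<Gamma> \<Longrightarrow> g \<in> carrier (GV \<mu>) \<Longrightarrow> Elem \<mu> g \<in> gens"
  "\<alpha> \<in> arcs \<Gamma> \<Longrightarrow> Stable \<alpha> \<in> gens" "\<alpha> \<in> arcs \<Gamma> \<Longrightarrow> StableInv \<alpha> \<in> gens"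
  by (auto simp: pi1_gens_def)

lemma vertex_mult_eq:
  assumes "\<mu> \<in> verts \<Gamma>" "g \<in> carrier (GV \<mu>)" "h \<in> carrier (GV \<mu>)"
  shows "[Elem \<mu> g, Elem \<mu> h] \<approx> [Elem \<mu> (g \<otimes>\<^bsub>GV \<mu>\<^esub> h)]"
proof -
  interpret group "GV \<mu>" using vertex_group[OF assms(1)] .
  show ?thesis using assms by (intro presented_eq_relation pi1_rels.vertex_mult) (auto intro: gens_intros)
qed

lemma vertex_one_eq:
  assumes "\<mu> \<in> verts \<Gamma>"
  shows "[Elem \<mu> \<one>\<^bsub>GV \<mu>\<^esub>] \<approx> []"
proof -
  interpret group "GV \<mu>" using vertex_group[OF assms(1)] .
  show ?thesis using assms by (intro presented_eq_relation pi1_rels.vertex_one) (auto intro: gens_intros)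
qed

lemma stable_inv_eq: "\<alpha> \<in> arcs \<Gamma> \<Longrightarrow> [StableInv \<alpha>] \<approx> [Stable (bar \<alpha>)]"
proof -
  assume a: "\<alpha> \<in> arcs \<Gamma>"
  have "[Stable (bar \<alpha>)] \<approx> [StableInv (bar (bar \<alpha>))]"
    using a by (intro presented_eq_relation pi1_rels.stable_rev) (auto simp: gens_intros)
  from presented_eq.sym[OF this] show ?thesis by simp
qed

lemma stable_cancel_eq:
  assumes "\<alpha> \<in> arcs \<Gamma>"
  shows "[Stable \<alpha>, Stable (bar \<alpha>)] \<approx> []"
proof -
  have "[Stable \<alpha>] @ [Stable (bar \<alpha>)] @ [] \<approx> [Stable \<alpha>] @ [StableInv \<alpha>] @ []"
    using presented_eq.sym[OF stable_inv_eq[OF assms]] assms by (intro presented_eq_cong) (auto simp: gens_intros)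
  moreover have "[Stable \<alpha>, StableInv \<alpha>] \<approx> []"
    using assms by (intro presented_eq_relation pi1_rels.stable_right_inv) (auto simp: gens_intros)
  ultimately show ?thesis by (auto intro: presented_eq.trans)
qed

lemma stable_tree_eq: "\<alpha> \<in> Tr \<Longrightarrow> [Stable \<alpha>] \<approx> []"
  using Tr by (intro presented_eq_relation pi1_rels.stable_tree) (auto simp: gens_intros)

lemma prepend_eq:
  assumes "\<mu> \<in> verts \<Gamma>" "g \<in> carrier (GV \<mu>)" "w \<in> lists gens"
  shows "Elem \<mu> g # w \<approx> prepend \<mu> g w"
proof (cases "g = \<one>\<^bsub>GV \<mu>\<^esub>")
  case True
  then show ?thesis using presented_eq_append[OF vertex_one_eq[OF assms(1)] presented_eq.refl[OF assms(3)]] by simp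
next
  case False
  then show ?thesis using assms by (auto intro!: presented_eq.refl gens_intros)
qed

lemma act_eq:
  assumes "x \<in> gens" "reduced w"
  shows "x # w \<approx> act x w"
proof -
  have w: "w \<in> lists gens" using assms reduced_gens by blast
  have stable: "Stable \<alpha> # w \<approx> act_stable \<alpha> w" if a: "\<alpha> \<in> arcs \<Gamma>" for \<alpha>
  proof -
    have "Stable \<alpha> # w \<in> lists gens" using a w by (auto simp: gens_intros)
    then have 1: "Stable \<alpha> # w \<approx> Stable \<alpha> # w" by (rule presented_eq.refl)
    have 2: "Stable \<alpha> # w \<approx> w" if "\<alpha> \<in> Tr"
      using presented_eq_append[OF stable_tree_eq[OF that] presented_eq.refl[OF w]] by simp
    have 3: "Stable \<alpha> # w \<approx> tl w" if "w \<noteq> []" "hd w = Stable (bar \<alpha>)"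
    proof -
      obtain r where r: "w = Stable (bar \<alpha>) # r" using \<open>w \<noteq> []\<close> \<open>hd w = _\<close> by (cases w) auto
      then have "r \<in> lists gens" using w by auto
      from presented_eq_append[OF stable_cancel_eq[OF a] presented_eq.refl[OF this]] show ?thesis by (simp add: r)
    qed
    show ?thesis using 1 2 3 by (auto simp: act_stable_def)
  qed
  consider \<mu> g where "x = Elem \<mu> g" "\<mu> \<in> verts \<Gamma>" "g \<in> carrier (GV \<mu>)"
    | \<alpha> where "x = Stable \<alpha>" "\<alpha> \<in> arcs \<Gamma>" | \<alpha> where "x = StableInv \<alpha>" "\<alpha> \<in> arcs \<Gamma>"
    using assms(1) by (auto simp: pi1_gens_def)
  then show ?thesis
  proof cases
    case 1
    then interpret group "GV \<mu>" using vertex_group by blast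
    show ?thesis
    proof (cases "starts_at \<mu> w")
      case True
      then obtain h r where r: "w = Elem \<mu> h # r" by (auto simp: starts_at_def)
      then have h: "h \<in> carrier (GV \<mu>)" "r \<in> lists gens" using assms(2) w by auto
      have "Elem \<mu> g # w \<approx> Elem \<mu> (g \<otimes>\<^bsub>GV \<mu>\<^esub> h) # r"
        using presented_eq_append[OF vertex_mult_eq presented_eq.refl[OF h(2)]] 1 h r by fastforce
      moreover have "Elem \<mu> (g \<otimes>\<^bsub>GV \<mu>\<^esub> h) # r \<approx> prepend \<mu> (g \<otimes>\<^bsub>GV \<mu>\<^esub> h) r"
        using 1 h by (intro prepend_eq) auto
      ultimately have "Elem \<mu> g # w \<approx> prepend \<mu> (g \<otimes>\<^bsub>GV \<mu>\<^esub> h) r" by (rule presented_eq.trans)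
      then show ?thesis using 1 r by simp
    next
      case False
      then show ?thesis using act_elem_not_start prepend_eq 1 w by simp
    qed
  next
    case 2
    then show ?thesis using stable by simp
  next
    case 3
    have "x # w \<approx> Stable (bar \<alpha>) # w"
      using presented_eq_append[OF stable_inv_eq[OF 3(2)] presented_eq.refl[OF w]] 3 by simp
    then show ?thesis using stable[of "bar \<alpha>"] 3 by (auto intro: presented_eq.trans)
  qed
qed

text \<open>The action also computes normal forms, since every step stays in the class (\<open>act_eq\<close>).\<close>

lemma reduced_form:
  assumes "w \<in> lists gens"
  obtains r where "reduced r" "w \<approx> r"
proof -
  have "reduced (foldr act w []) \<and> w \<approx> foldr act w []" using assms
  proof (induction w)
    case Nil
    then show ?case by (auto intro: presented_eq.refl)
  next
    case (Cons x w)
    then have IH: "reduced (foldr act w [])" "w \<approx> foldr act w []" "x \<in> gens" by auto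
    have "x # w \<approx> x # foldr act w []"
      using presented_eq_append[OF presented_eq.refl IH(2), of "[x]"] IH(3) by simp
    then show ?case using IH reduced_act act_eq by (auto intro: presented_eq.trans)
  qed
  then show ?thesis using that by blast
qed

lemma group_pi1: "group (pi1 \<Gamma> bar GV GE \<tau> Tr)"
  unfolding pi1_def
proof (rule group_presented)
  fix a assume "a \<in> gens"
  then consider \<mu> g where "a = Elem \<mu> g" "\<mu> \<in> verts \<Gamma>" "g \<in> carrier (GV \<mu>)"
    | \<alpha> where "a = Stable \<alpha>" "\<alpha> \<in> arcs \<Gamma>" | \<alpha> where "a = StableInv \<alpha>" "\<alpha> \<in> arcs \<Gamma>"
    by (auto simp: pi1_gens_def)
  then show "\<exists>b\<in>lists gens. b @ [a] \<approx> []"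
  proof cases
    case 1
    then interpret group "GV \<mu>" using vertex_group by blast
    have "[Elem \<mu> (inv\<^bsub>GV \<mu>\<^esub> g)] @ [a] \<approx> []"
      using vertex_mult_eq[of \<mu> "inv\<^bsub>GV \<mu>\<^esub> g" g] vertex_one_eq[of \<mu>] 1 by (auto intro: presented_eq.trans)
    then show ?thesis using 1 by (intro bexI[of _ "[Elem \<mu> (inv\<^bsub>GV \<mu>\<^esub> g)]"]) (auto intro: gens_intros)
  next
    case 2
    have "[StableInv \<alpha>] @ [a] \<approx> []"
      unfolding 2(1) append.simps
      using 2 by (intro presented_eq_relation pi1_rels.stable_left_inv) (auto simp: gens_intros)
    then show ?thesis using 2 by (intro bexI[of _ "[StableInv \<alpha>]"]) (auto intro: gens_intros)
  next
    case 3
    have "[Stable \<alpha>] @ [a] \<approx> []"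
      unfolding 3(1) append.simps
      using 3 by (intro presented_eq_relation pi1_rels.stable_right_inv) (auto simp: gens_intros)
    then show ?thesis using 3 by (intro bexI[of _ "[Stable \<alpha>]"]) (auto intro: gens_intros)
  qed
qed

lemma pi1_finitely_generated:
  assumes S: "\<And>\<mu>. \<mu> \<in> verts \<Gamma> \<Longrightarrow> finite_generating_set (GV \<mu>) (S \<mu>)"
  shows "\<exists>T. finite_generating_set (pi1 \<Gamma> bar GV GE \<tau> Tr) T"
proof -
  let ?P = "pi1 \<Gamma> bar GV GE \<tau> Tr"
  interpret P: group ?P by (rule group_pi1)
  define cl where "cl = word_class gens rels"
  define T where "T = (\<Union>\<mu> \<in> verts \<Gamma>. (\<lambda>s. cl [Elem \<mu> s]) ` S \<mu>) \<union> (\<lambda>\<alpha>. cl [Stable \<alpha>]) ` arcs \<Gamma>"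
  have carr: "carrier ?P = cl ` lists gens" by (simp add: pi1_def carrier_presented cl_def)
  have mult: "cl u \<otimes>\<^bsub>?P\<^esub> cl v = cl (u @ v)" if "u \<in> lists gens" "v \<in> lists gens" for u v
    using mult_presented[OF that] by (simp add: pi1_def cl_def)
  have S': "finite (S \<mu>)" "S \<mu> \<subseteq> carrier (GV \<mu>)" "generate (GV \<mu>) (S \<mu>) = carrier (GV \<mu>)" if "\<mu> \<in> verts \<Gamma>" for \<mu>
    using S[OF that] by (auto simp: finite_generating_set_def)
  have finT: "finite T" using S'(1) by (auto simp: T_def)
  have subT: "T \<subseteq> carrier ?P" by (auto simp: T_def carr intro!: imageI gens_intros intro: subsetD[OF S'(2)])
  have elem: "cl [Elem \<mu> g] \<in> generate ?P T" if m: "\<mu> \<in> verts \<Gamma>" and g: "g \<in> generate (GV \<mu>) (S \<mu>)" for \<mu> g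
  proof -
    interpret V: group "GV \<mu>" using vertex_group[OF m] .
    have hom: "(\<lambda>g. cl [Elem \<mu> g]) \<in> hom (GV \<mu>) ?P"
    proof (rule homI)
      fix x y assume xy: "x \<in> carrier (GV \<mu>)" "y \<in> carrier (GV \<mu>)"
      then have "cl [Elem \<mu> x] \<otimes>\<^bsub>?P\<^esub> cl [Elem \<mu> y] = cl [Elem \<mu> x, Elem \<mu> y]"
        using m mult[of "[Elem \<mu> x]" "[Elem \<mu> y]"] by (simp add: gens_intros)
      also have "\<dots> = cl [Elem \<mu> (x \<otimes>\<^bsub>GV \<mu>\<^esub> y)]"
        unfolding cl_def using vertex_mult_eq[OF m xy] m xy by (subst word_class_eq) (auto intro: gens_intros)
      finally show "cl [Elem \<mu> (x \<otimes>\<^bsub>GV \<mu>\<^esub> y)] = cl [Elem \<mu> x] \<otimes>\<^bsub>?P\<^esub> cl [Elem \<mu> y]" by simp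
    qed (use m in \<open>auto simp: carr intro!: imageI gens_intros\<close>)
    interpret h: group_hom "GV \<mu>" ?P "\<lambda>g. cl [Elem \<mu> g]"
      using hom by (unfold_locales) (simp_all add: group_hom_def group_hom_axioms_def)
    have "cl [Elem \<mu> g] \<in> generate ?P ((\<lambda>s. cl [Elem \<mu> s]) ` S \<mu>)"
      using h.generate_img[OF S'(2)[OF m]] g by blast
    moreover have "(\<lambda>s. cl [Elem \<mu> s]) ` S \<mu> \<subseteq> T" using m by (auto simp: T_def)
    ultimately show ?thesis using P.mono_generate by blast
  qed
  have stab: "cl [Stable \<alpha>] \<in> generate ?P T" if "\<alpha> \<in> arcs \<Gamma>" for \<alpha>
    using that by (intro generate.incl) (auto simp: T_def)
  have single: "cl [x] \<in> generate ?P T" if "x \<in> gens" for x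
  proof -
    have "cl [StableInv \<alpha>] = cl [Stable (bar \<alpha>)]" if "\<alpha> \<in> arcs \<Gamma>" for \<alpha>
      using that stable_inv_eq by (simp add: cl_def word_class_eq gens_intros)
    then show ?thesis using that elem S'(3) stab by (auto simp: pi1_gens_def)
  qed
  have "cl w \<in> generate ?P T" if "w \<in> lists gens" for w using that
  proof (induction w)
    case Nil
    have "cl [] = \<one>\<^bsub>?P\<^esub>" by (simp add: pi1_def one_presented cl_def)
    then show ?case using generate.one by metis
  next
    case (Cons x w)
    then have "cl (x # w) = cl [x] \<otimes>\<^bsub>?P\<^esub> cl w" using mult[of "[x]" w] by simp
    then show ?case using generate.eng[OF single] Cons by auto
  qed
  then have "carrier ?P \<subseteq> generate ?P T" by (auto simp: carr)
  moreover have "generate ?P T \<subseteq> carrier ?P" using P.generate_incl[OF subT] .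
  ultimately show ?thesis using finT subT by (auto simp: finite_generating_set_def)
qed

end

section \<open>Growth of the running time\<close>

lemma convex_nat_chord:
  assumes "convex_nat f"
  shows "f m + f n \<le> f (m + n) + f 0"
proof (cases "m = 0 \<or> n = 0")
  case False
  then have mn: "0 < m" "0 < n" by auto
  have "(real (m + n) - 0) * f m \<le> (real (m + n) - real m) * f 0 + (real m - 0) * f (m + n)"
    using assms mn unfolding convex_nat_def by (metis less_add_same_cancel1 of_nat_0)
  moreover have "(real (m + n) - 0) * f n \<le> (real (m + n) - real n) * f 0 + (real n - 0) * f (m + n)"
    using assms mn unfolding convex_nat_def by (metis less_add_same_cancel2 of_nat_0)
  ultimately have "real (m + n) * (f m + f n) \<le> real (m + n) * (f (m + n) + f 0)"
    by (simp add: algebra_simps)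
  then show ?thesis using mn by (simp add: mult_le_cancel_left)
qed auto

lemma convex_nat_affine:
  assumes "convex_nat f" "0 < C"
  shows "convex_nat (\<lambda>n. f (C * n + C))"
  unfolding convex_nat_def
proof (intro allI impI)
  fix a b c :: nat assume abc: "a < b \<and> b < c"
  then have "C * a + C < C * b + C" "C * b + C < C * c + C" using assms(2) by auto
  then have "(real (C * c + C) - real (C * a + C)) * f (C * b + C)
    \<le> (real (C * c + C) - real (C * b + C)) * f (C * a + C) + (real (C * b + C) - real (C * a + C)) * f (C * c + C)"
    using assms(1) unfolding convex_nat_def by blast
  then have "real C * ((real c - real a) * f (C * b + C))
    \<le> real C * ((real c - real b) * f (C * a + C) + (real b - real a) * f (C * c + C))"
    by (simp add: algebra_simps)
  then show "(real c - real a) * f (C * b + C) \<le> (real c - real b) * f (C * a + C) + (real b - real a) * f (C * c + C)"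
    using assms(2) by (simp add: mult_le_cancel_left)
qed

lemma convex_nat_bound:
  assumes "convex_nat f" "\<And>n. real n \<le> f n" "m \<le> n"
  shows "f m \<le> f 0 + f n"
proof -
  have "0 \<le> f (n - m)" using assms(2)[of "n - m"] by (meson of_nat_0_le_iff order_trans)
  then show ?thesis using convex_nat_chord[OF assms(1), of m "n - m"] assms(3) by simp
qed

text \<open>A common superadditive bound for the running times of finitely many machines. Subtracting
  the value at \<open>0\<close> turns convexity into superadditivity, and adding a linear term makes the
  result nonnegative.\<close>

definition envelope :: "(nat \<Rightarrow> real) \<Rightarrow> nat \<Rightarrow> nat \<Rightarrow> nat" where
  "envelope f C n = nat \<lfloor>real C * (f (C * n + C) + (real n - 1) * f C) + real C * real n + real C * real n\<rfloor>"

lemma envelope_superadditive: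
  assumes f: "convex_nat f" "\<And>n. real n \<le> f n" and C: "0 < C"
  shows "envelope f C m + envelope f C n \<le> envelope f C (m + n)"
proof -
  define F where "F n = real C * (f (C * n + C) + (real n - 1) * f C) + real C * real n + real C * real n" for n
  have fC: "0 \<le> f C" using f(2)[of C] by (meson of_nat_0_le_iff order_trans)
  have pos: "0 \<le> F n" for n
  proof (cases n)
    case (Suc k)
    have "0 \<le> f (C * n + C)" using f(2)[of "C * n + C"] by (meson of_nat_0_le_iff order_trans)
    then show ?thesis using fC by (simp add: F_def Suc)
  qed (simp add: F_def)
  have "f (C * m + C) + f (C * n + C) \<le> f (C * (m + n) + C) + f C"
    using convex_nat_chord[OF convex_nat_affine[OF f(1) C], of m n] by simp
  then have "real C * (f (C * m + C) + f (C * n + C)) \<le> real C * (f (C * (m + n) + C) + f C)"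
    by (intro mult_left_mono) auto
  then have sup: "F m + F n \<le> F (m + n)" by (simp add: F_def algebra_simps)
  have e: "int (envelope f C k) = \<lfloor>F k\<rfloor>" for k
  proof -
    have "envelope f C k = nat \<lfloor>F k\<rfloor>" by (simp only: envelope_def F_def)
    then show ?thesis using pos[of k] by simp
  qed
  have "\<lfloor>F m\<rfloor> + \<lfloor>F n\<rfloor> \<le> \<lfloor>F m + F n\<rfloor>" by (rule le_floor_add)
  also have "\<dots> \<le> \<lfloor>F (m + n)\<rfloor>" using sup by (rule floor_mono)
  finally show ?thesis using e by (metis of_nat_add of_nat_le_iff)
qed

text \<open>The assumption \<open>0 < n\<close> is essential, because the envelope vanishes at \<open>0\<close>.\<close>

lemma le_envelope:
  assumes f: "convex_nat f" "\<And>n. real n \<le> f n" and "0 < n" "real t \<le> real C * f (C * n + C) + real C * real n + real C"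
  shows "t \<le> envelope f C n"
proof -
  have "0 \<le> f C" using f(2)[of C] by (meson of_nat_0_le_iff order_trans)
  then have "0 \<le> real C * ((real n - 1) * f C)" using assms(3) by simp
  moreover have "real C \<le> real C * real n" using assms(3) by (simp add: mult_le_cancel_left1)
  ultimately have "real t \<le> real C * (f (C * n + C) + (real n - 1) * f C) + real C * real n + real C * real n"
    using assms(4) by (simp add: distrib_left)
  then show ?thesis unfolding envelope_def by (rule le_nat_floor)
qed

text \<open>A larger constant moves the argument of \<open>f\<close> to the right, and \<open>f\<close> may first decrease. It exceeds
later values by at most \<open>f 0\<close> (\<open>convex_nat_bound\<close>), which the final constant absorbs.\<close>

lemma preceq_uniform:
  assumes fin: "finite V" and f: "convex_nat f" "\<And>n. real n \<le> f n"
    and g: "\<And>\<mu>. \<mu> \<in> V \<Longrightarrow> g \<mu> \<preceq> f"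
  obtains C :: nat where "0 < C" "\<And>\<mu> n. \<mu> \<in> V \<Longrightarrow> g \<mu> n \<le> real C * f (C * n + C) + real C * real n + real C"
proof -
  have "\<exists>C. \<forall>\<mu> \<in> V. 0 < C \<mu> \<and> (\<forall>n. g \<mu> n \<le> real (C \<mu>) * f (C \<mu> * n + C \<mu>) + real (C \<mu>) * real n + real (C \<mu>))"
    using g by (intro bchoice) (auto simp: preceq_def)
  then obtain C where C: "\<And>\<mu>. \<mu> \<in> V \<Longrightarrow> 0 < C \<mu>"
    "\<And>\<mu> n. \<mu> \<in> V \<Longrightarrow> g \<mu> n \<le> real (C \<mu>) * f (C \<mu> * n + C \<mu>) + real (C \<mu>) * real n + real (C \<mu>)" by blast
  define c where "c = Suc (\<Sum>\<mu>\<in>V. C \<mu>)"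
  define D where "D = c * Suc (nat \<lceil>f 0\<rceil>) + c"
  have cD: "c \<le> D" by (simp add: D_def)
  have D1: "real c * f 0 + real c \<le> real D"
  proof -
    have "f 0 \<le> real (nat \<lceil>f 0\<rceil>)" by linarith
    then have "real c * f 0 \<le> real c * real (Suc (nat \<lceil>f 0\<rceil>))" by (intro mult_left_mono) auto
    then show ?thesis by (simp add: D_def distrib_left)
  qed
  have "g \<mu> n \<le> real D * f (D * n + D) + real D * real n + real D" if m: "\<mu> \<in> V" for \<mu> n
  proof -
    have Cc: "C \<mu> \<le> c" unfolding c_def using member_le_sum[OF m, of C] fin by (simp add: le_SucI)
    have "C \<mu> * n + C \<mu> \<le> D * n + D" using Cc cD by (intro add_mono mult_right_mono) auto
    then have b: "f (C \<mu> * n + C \<mu>) \<le> f 0 + f (D * n + D)" by (rule convex_nat_bound[OF f])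
    have fD: "0 \<le> f (D * n + D)" "0 \<le> f (C \<mu> * n + C \<mu>)"
      using f(2) by (meson of_nat_0_le_iff order_trans)+
    have "real (C \<mu>) * f (C \<mu> * n + C \<mu>) \<le> real c * (f 0 + f (D * n + D))"
      using Cc b fD by (intro mult_mono) auto
    also have "\<dots> \<le> real c * f 0 + real D * f (D * n + D)"
      using cD fD by (simp add: distrib_left mult_right_mono)
    finally have "real (C \<mu>) * f (C \<mu> * n + C \<mu>) \<le> real c * f 0 + real D * f (D * n + D)" .
    moreover have "real (C \<mu>) * real n \<le> real D * real n" using Cc cD by (intro mult_right_mono) auto
    ultimately show ?thesis using C(2)[OF m, of n] D1 Cc by linarith
  qed
  moreover have "0 < D" by (simp add: D_def c_def)
  ultimately show thesis using that by blast
qed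

lemma envelope_upper:
  assumes f: "convex_nat f" "\<And>n. real n \<le> f n"
  shows "real (envelope f C n) \<le> real C * (2 * f 0 + f (C * n + C) + real n * f C + 2 * real n)"
proof -
  have fC: "0 \<le> f C" "0 \<le> f (C * n + C)" "0 \<le> f 0" using f(2) by (meson of_nat_0_le_iff order_trans)+
  let ?F = "real C * (f (C * n + C) + (real n - 1) * f C) + real C * real n + real C * real n"
  have "?F \<le> real C * (2 * f 0 + f (C * n + C) + real n * f C + 2 * real n)"
    using fC by (simp add: algebra_simps mult_left_mono)
  moreover have "0 \<le> real C * (2 * f 0 + f (C * n + C) + real n * f C + 2 * real n)" using fC by simp
  moreover have "real (nat \<lfloor>y\<rfloor>) \<le> x" if "y \<le> x" "0 \<le> x" for x y :: real using that by linarith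
  ultimately show ?thesis unfolding envelope_def by blast
qed

lemma floor_log_le_ln: "real (floor_log n) \<le> 2 * ln (real (n + 3))"
proof (cases "n = 0")
  case False
  then have "2 ^ floor_log n \<le> n" by (simp add: floor_log_exp2_le)
  then have "2 ^ floor_log n \<le> n + 3" by linarith
  then have "real (2 ^ floor_log n) \<le> real (n + 3)" by (simp only: of_nat_le_iff)
  then have "(2::real) ^ floor_log n \<le> real (n + 3)" by simp
  then have "ln ((2::real) ^ floor_log n) \<le> ln (real (n + 3))" by (subst ln_le_cancel_iff) auto
  then have "real (floor_log n) * ln 2 \<le> ln (real (n + 3))" by (simp add: ln_realpow)
  moreover have "1 / 2 \<le> ln (2 :: real)" using exp_half_le2 by (subst ln_ge_iff) simp_all
  then have "real (floor_log n) * (1 / 2) \<le> real (floor_log n) * ln 2"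
    by (intro mult_left_mono) simp_all
  ultimately show ?thesis by linarith
qed simp

text \<open>All terms are compared with \<open>f m\<close> at \<open>m = D * n + D\<close>, which exceeds both \<open>n\<close> and \<open>1\<close>. Since \<open>m \<ge> 3\<close>, the
logarithm of \<open>m\<close> is at least \<open>1\<close> and absorbs the constant number of additional passes.\<close>

lemma log_factor_preceq:
  assumes f: "convex_nat f" "\<And>n. real n \<le> f n"
  shows "(\<lambda>n. real (2 * ((2 * c + 6) * n + (floor_log n + 2) *
      ((100 + 2 * K) * (envelope f C (c * n) + c * n) + 85 * (c * n) + 10) + 10) + 2 * n + 2))
    \<preceq> (\<lambda>n. ln (real n) * f n)"
proof -
  have f0: "0 \<le> f n" for n using f(2)[of n] by (meson of_nat_0_le_iff order_trans)
  let ?time = "\<lambda>n. real (2 * ((2 * c + 6) * n + (floor_log n + 2) *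
      ((100 + 2 * K) * (envelope f C (c * n) + c * n) + 85 * (c * n) + 10) + 10) + 2 * n + 2)"
  define A where "A = (100 + 2 * real K) * (real C * (3 * f 0 + 1 + real c * f C + 2 * real c) + real c) + 85 * real c + 10"
  define D where "D = nat \<lceil>8 * A\<rceil> + C * c + C + 4 * c + 30"
  have "nat \<lceil>8 * A\<rceil> \<le> D" unfolding D_def by (intro trans_le_add1 order_refl)
  then have "real (nat \<lceil>8 * A\<rceil>) \<le> real D" by (simp only: of_nat_le_iff)
  then have "8 * A \<le> real D" by (rule order_trans[OF real_nat_ceiling_ge])
  moreover have "C * c + C \<le> D" "4 * c + 30 \<le> D" by (simp_all add: D_def)
  ultimately have D: "8 * A \<le> real D" "C * c + C \<le> D" "4 * c + 30 \<le> D" by blast+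
  show ?thesis unfolding preceq_def
  proof (intro exI[of _ D] conjI allI)
    show "0 < D" by (simp add: D_def)
    fix n
    let ?m = "D * n + D"
    have Dn: "n \<le> D * n" using D(3) by (cases D) auto
    have m: "n + 3 \<le> ?m" "C * (c * n) + C \<le> ?m"
    proof -
      show "n + 3 \<le> ?m" using Dn D(3) by linarith
      have "C * c \<le> D" "C \<le> D" using D(2) by auto
      then have "C * c * n + C \<le> ?m" by (intro add_mono mult_le_mono1)
      then show "C * (c * n) + C \<le> ?m" by (simp only: mult.assoc)
    qed
    have fm: "real n \<le> f ?m" "1 \<le> f ?m" using f(2)[of ?m] m(1) by linarith+
    have m': "real (n + 3) \<le> real ?m" using m(1) by (simp only: of_nat_le_iff)
    have "ln (real (n + 3)) \<le> ln (real ?m)"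
      by (intro ln_le_cancel_iff[THEN iffD2]) (use m' in linarith)+
    moreover have "1 \<le> ln (real (n + 3))"
    proof -
      have "exp 1 \<le> real (n + 3)" using exp_le by (simp add: order_trans)
      then show ?thesis by (subst ln_ge_iff) auto
    qed
    ultimately have lg: "real (floor_log n + 2) \<le> 4 * ln (real ?m)" "0 \<le> ln (real ?m)"
      using floor_log_le_ln[of n] by linarith+
    let ?E = "(100 + 2 * real K) * (real (envelope f C (c * n)) + real (c * n)) + 85 * real (c * n) + 10"
    have "f (C * (c * n) + C) \<le> f 0 + f ?m" by (rule convex_nat_bound[OF f m(2)])
    then have "real C * (2 * f 0 + f (C * (c * n) + C) + real (c * n) * f C + 2 * real (c * n))
      \<le> real C * (3 * f 0 + f ?m + real (c * n) * f C + 2 * real (c * n))"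
      by (intro mult_left_mono) auto
    then have "real (envelope f C (c * n)) \<le> real C * (3 * f 0 + f ?m + real (c * n) * f C + 2 * real (c * n))"
      using envelope_upper[OF f, of C "c * n"] by linarith
    also have "\<dots> \<le> real C * ((3 * f 0 + 1 + real c * f C + 2 * real c) * f ?m)"
    proof (intro mult_left_mono)
      have "3 * f 0 * 1 \<le> 3 * f 0 * f ?m" using fm f0[of 0] by (intro mult_left_mono) auto
      moreover have "real c * f C * real n \<le> real c * f C * f ?m" using fm f0[of C] by (intro mult_left_mono) auto
      moreover have "2 * real c * real n \<le> 2 * real c * f ?m" using fm by (intro mult_left_mono) auto
      ultimately show "3 * f 0 + f ?m + real (c * n) * f C + 2 * real (c * n) \<le> (3 * f 0 + 1 + real c * f C + 2 * real c) * f ?m"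
        by (simp add: algebra_simps)
    qed simp
    finally have env: "real (envelope f C (c * n)) \<le> real C * (3 * f 0 + 1 + real c * f C + 2 * real c) * f ?m"
      by (simp add: mult.assoc)
    have cn: "real (c * n) \<le> real c * f ?m" using fm by (simp add: mult_left_mono)
    have "?E \<le> (100 + 2 * real K) * (real C * (3 * f 0 + 1 + real c * f C + 2 * real c) * f ?m + real c * f ?m)
        + 85 * (real c * f ?m) + 10 * f ?m"
      using env cn fm by (intro add_mono mult_left_mono) auto
    also have "\<dots> = A * f ?m" by (simp add: A_def algebra_simps)
    finally have E: "?E \<le> A * f ?m" .
    have E0: "0 \<le> ?E" by simp
    have "real (floor_log n + 2) * ?E \<le> (4 * ln (real ?m)) * (A * f ?m)"
      using lg E E0 by (intro mult_mono) auto
    then have "2 * (real (floor_log n + 2) * ?E) \<le> 8 * A * (ln (real ?m) * f ?m)" by (simp add: algebra_simps)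
    also have "\<dots> \<le> real D * (ln (real ?m) * f ?m)"
      using D(1) lg(2) f0 by (intro mult_right_mono mult_nonneg_nonneg) auto
    finally have main: "2 * (real (floor_log n + 2) * ?E) \<le> real D * (ln (real ?m) * f ?m)" .
    have "(4 * real c + 14) * real n \<le> real D * real n" using D(3) by (intro mult_right_mono) auto
    moreover have "?time n
      = 2 * (real (floor_log n + 2) * ?E) + (4 * real c + 14) * real n + 22"
      by (simp add: algebra_simps)
    ultimately show "?time n
      \<le> real D * (ln (real ?m) * f ?m) + real D * real n + real D"
      using main D(3) by linarith
  qed
qed

section \<open>The word problem\<close>

text \<open>A stable letter is a syllable of its own. Two mutually inverse ones always cancel, so
  the machine that accepts at once answers the only question asked about them.\<close>

definition accepting_tm :: "'a tm" where
  "accepting_tm = \<lparr>tm_tapes = 1, tm_states = 2, tm_aux = 0, tm_start = 0, tm_accept = 0, tm_reject = 1,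
     tm_delta = (\<lambda>q xs. (0, map (\<lambda>x. (x, MStay)) xs))\<rparr>"

lemma wf_accepting_tm: "finite A \<Longrightarrow> wf_tm A accepting_tm"
  by (auto simp: wf_tm_def accepting_tm_def image_image)

locale vertex_machines = trivial_edge_groups \<Gamma> bar GV GE \<tau> Tr
  for \<Gamma> :: "('v, 'e) pre_digraph" and bar :: "'e \<Rightarrow> 'e" and GV :: "'v \<Rightarrow> 'g monoid"
    and GE :: "'e \<Rightarrow> 'h monoid" and \<tau> :: "'e \<Rightarrow> 'h \<Rightarrow> 'g" and Tr :: "'e set" +
  fixes S :: "'v \<Rightarrow> 'g set" and M :: "'v \<Rightarrow> ('g \<times> bool) tm" and f :: "nat \<Rightarrow> real" and C :: nat
  assumes S: "\<mu> \<in> verts \<Gamma> \<Longrightarrow> finite_generating_set (GV \<mu>) (S \<mu>)"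
    and wf_M: "\<mu> \<in> verts \<Gamma> \<Longrightarrow> wf_tm (S \<mu> \<times> UNIV) (M \<mu>)"
    and decides_M: "\<mu> \<in> verts \<Gamma> \<Longrightarrow> tm_decides_within (S \<mu> \<times> UNIV) (M \<mu>) (word_problem (GV \<mu>) (S \<mu>))
      (\<lambda>n. real C * f (C * n + C) + real C * real n + real C)"
    and f: "convex_nat f" "\<And>n. real n \<le> f n" and C: "0 < C"
begin

definition tags :: "('v + 'e) set" where
  "tags = Inl ` verts \<Gamma> \<union> Inr ` (arcs \<Gamma> - Tr)"

text \<open>The tags are the vertices and the edges outside the tree. A stable letter is a syllable with
an arbitrary dummy letter as its content, because syllables must not be empty.\<close>

fun alphabet :: "'v + 'e \<Rightarrow> ('g \<times> bool) set" where
  "alphabet (Inl \<mu>) = S \<mu> \<times> UNIV"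
| "alphabet (Inr \<alpha>) = {undefined}"

fun tester :: "'v + 'e \<Rightarrow> ('g \<times> bool) tm" where
  "tester (Inl \<mu>) = M \<mu>"
| "tester (Inr \<alpha>) = accepting_tm"

fun compatible :: "'v + 'e \<Rightarrow> 'v + 'e \<Rightarrow> bool" where
  "compatible (Inl \<mu>) (Inl \<nu>) \<longleftrightarrow> \<mu> = \<nu>"
| "compatible (Inr \<alpha>) (Inr \<beta>) \<longleftrightarrow> \<beta> = bar \<alpha>"
| "compatible _ _ \<longleftrightarrow> False"

fun vanishes :: "'v + 'e \<Rightarrow> ('g \<times> bool) list \<Rightarrow> bool" where
  "vanishes (Inl \<mu>) a \<longleftrightarrow> word_value (GV \<mu>) a = \<one>\<^bsub>GV \<mu>\<^esub>"
| "vanishes (Inr \<alpha>) a \<longleftrightarrow> True"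

sublocale merging tags alphabet tester compatible vanishes "envelope f C"
proof
  show "finite tags" by (simp add: tags_def)
  show "wf_tm (alphabet x) (tester x)" if "x \<in> tags" for x
    using that by (auto simp: tags_def intro: wf_M wf_accepting_tm)
  show "alphabet x \<subseteq> alphabet y" if "compatible x y" "x \<in> tags" "y \<in> tags" for x y
    using that by (cases "(x, y)" rule: compatible.cases) auto
  show "envelope f C m + envelope f C n \<le> envelope f C (m + n)" for m n
    by (rule envelope_superadditive[OF f C])
  fix x w assume x: "x \<in> tags" and w: "w \<in> lists (alphabet x)" "w \<noteq> []"
  show "\<exists>t \<le> envelope f C (length w). fst ((tm_step (tester x) ^^ t) (tm_init (tester x) w))
    = (if vanishes x w then tm_accept (tester x) else tm_reject (tester x))"
  proof (cases x)
    case (Inl \<mu>)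
    then have m: "\<mu> \<in> verts \<Gamma>" using x by (auto simp: tags_def)
    obtain t :: nat where t: "real t \<le> real C * f (C * length w + C) + real C * real (length w) + real C"
      "fst ((tm_step (M \<mu>) ^^ t) (tm_init (M \<mu>) w)) = (if w \<in> word_problem (GV \<mu>) (S \<mu>) then tm_accept (M \<mu>) else tm_reject (M \<mu>))"
      using decides_M[OF m] w Inl unfolding tm_decides_within_def by auto
    have "t \<le> envelope f C (length w)" using w(2) t(1) by (intro le_envelope[OF f]) auto
    moreover have "w \<in> word_problem (GV \<mu>) (S \<mu>) \<longleftrightarrow> vanishes x w" using w Inl by (auto simp: word_problem_def)
    ultimately show ?thesis using t(2) Inl by auto
  next
    case (Inr \<alpha>)
    then show ?thesis by (intro exI[of _ 0]) (simp add: accepting_tm_def tm_init_def)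
  qed
qed

fun syl :: "('v + 'e, 'g \<times> bool) syllable \<Rightarrow> ('v, 'e, 'g) pi1_gen" where
  "syl (Inl \<mu>, a) = Elem \<mu> (word_value (GV \<mu>) a)"
| "syl (Inr \<alpha>, a) = Stable \<alpha>"

lemma wf_syl_simps:
  "wf_syl (Inl \<mu>, a) \<longleftrightarrow> \<mu> \<in> verts \<Gamma> \<and> a \<in> lists (S \<mu> \<times> UNIV) \<and> a \<noteq> []"
  "wf_syl (Inr \<alpha>, a) \<longleftrightarrow> \<alpha> \<in> arcs \<Gamma> \<and> \<alpha> \<notin> Tr \<and> a \<in> lists {undefined} \<and> a \<noteq> []"
  unfolding wf_syl_def by (auto simp: tags_def)

definition valid :: "('v + 'e, 'g \<times> bool) syllable list \<Rightarrow> bool" where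
  "valid b \<longleftrightarrow> list_all wf_syl b \<and> reduced (map syl b)"

lemma clash_syl: "clash (syl s) (syl t) \<longleftrightarrow> compatible (fst s) (fst t)"
  by (cases s rule: syl.cases; cases t rule: syl.cases) simp_all

lemma reduced_append:
  "reduced (u @ v) \<longleftrightarrow> reduced u \<and> reduced v \<and> (u = [] \<or> v = [] \<or> \<not> clash (last u) (hd v))"
  by (induction u) auto

lemma word_value_vertex:
  assumes "\<mu> \<in> verts \<Gamma>" "a \<in> lists (S \<mu> \<times> UNIV)" "b \<in> lists (S \<mu> \<times> UNIV)"
  shows "word_value (GV \<mu>) a \<in> carrier (GV \<mu>)"
    "word_value (GV \<mu>) (a @ b) = word_value (GV \<mu>) a \<otimes>\<^bsub>GV \<mu>\<^esub> word_value (GV \<mu>) b"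
proof -
  interpret group "GV \<mu>" using vertex_group[OF assms(1)] .
  have "S \<mu> \<subseteq> carrier (GV \<mu>)" using S[OF assms(1)] by (simp add: finite_generating_set_def)
  then show "word_value (GV \<mu>) a \<in> carrier (GV \<mu>)"
    "word_value (GV \<mu>) (a @ b) = word_value (GV \<mu>) a \<otimes>\<^bsub>GV \<mu>\<^esub> word_value (GV \<mu>) b"
    using word_value_closed word_value_append assms by blast+
qed

lemma syl_gens: "wf_syl s \<Longrightarrow> syl s \<in> gens"
  using word_value_vertex(1) by (cases s rule: syl.cases) (auto simp: wf_syl_simps intro!: gens_intros)

lemma syls_gens: "list_all wf_syl v \<Longrightarrow> map syl v \<in> lists gens"
  using syl_gens by (auto simp: list_all_iff)

text \<open>For stable letters the right-hand side is empty: compatible ones are inverse to each other.\<close>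

lemma combine_eq:
  assumes "wf_syl (x, a)" "wf_syl (y, b)" "compatible x y"
  shows "[syl (x, a), syl (y, b)] \<approx> (if vanishes y (a @ b) then [] else [syl (y, a @ b)])"
proof (cases x)
  case (Inl \<mu>)
  then have y: "y = Inl \<mu>" using assms(3) by (cases y) auto
  have m: "\<mu> \<in> verts \<Gamma>" and ab: "a \<in> lists (S \<mu> \<times> UNIV)" "b \<in> lists (S \<mu> \<times> UNIV)"
    using assms Inl y by (auto simp: wf_syl_simps)
  have "[syl (x, a), syl (y, b)] \<approx> [Elem \<mu> (word_value (GV \<mu>) (a @ b))]"
    unfolding Inl y syl.simps word_value_vertex(2)[OF m ab]
    using m ab word_value_vertex(1) by (intro vertex_mult_eq) blast+
  then show ?thesis using vertex_one_eq[OF m] y by (auto intro: presented_eq.trans)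
next
  case (Inr \<alpha>)
  then have y: "y = Inr (bar \<alpha>)" using assms(3) by (cases y) auto
  have "\<alpha> \<in> arcs \<Gamma>" using assms Inr by (auto simp: wf_syl_simps)
  then show ?thesis using stable_cancel_eq Inr y by simp
qed

text \<open>If the joined syllable does not vanish it keeps its vertex, hence it fits between its neighbours
just as the two syllables did before.\<close>

lemma merge_correct:
  assumes "list_all wf_syl u" "list_all wf_syl v" "reduced (map syl (rev u))" "reduced (map syl v)"
  shows "reduced (map syl (merge u v)) \<and> map syl (rev u) @ map syl v \<approx> map syl (merge u v)"
  using assms
proof (induction u v rule: merge.induct)
  case (1 v)
  then show ?case using syls_gens by (auto intro!: presented_eq.refl)
next
  case (2 s u)
  have "map syl (rev (s # u)) \<in> lists gens" using 2 by (intro syls_gens) simp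
  then show ?case using 2 by (auto intro!: presented_eq.refl)
next
  case (3 x a u y b v)
  have wf: "wf_syl (x, a)" "wf_syl (y, b)" "list_all wf_syl u" "list_all wf_syl v" using 3 by auto
  have red: "reduced (map syl (rev u))" "reduced (map syl v)" "proper (syl (x, a))" "proper (syl (y, b))"
    using "3.prems" by (auto simp: reduced_append)
  have l: "map syl (rev u) \<in> lists gens" "map syl v \<in> lists gens"
    using wf syls_gens[of "rev u"] syls_gens[of v] by auto
  show ?case
  proof (cases "compatible x y")
    case False
    have "map syl (rev u) @ syl (x, a) # syl (y, b) # map syl v \<in> lists gens" using l wf syl_gens by auto
    then show ?thesis using "3.prems" False
      by (auto simp: reduced_append clash_syl intro!: presented_eq.refl)
  next
    case True
    let ?r = "if vanishes y (a @ b) then [] else [syl (y, a @ b)]"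
    have eq: "map syl (rev ((x, a) # u)) @ map syl ((y, b) # v) \<approx> map syl (rev u) @ ?r @ map syl v"
      using presented_eq_cong[OF combine_eq[OF wf(1,2) True] l] by simp
    show ?thesis
    proof (cases "vanishes y (a @ b)")
      case van: True
      then show ?thesis using "3.IH"[OF True van wf(3,4) red(1,2)] eq True by (auto intro: presented_eq.trans)
    next
      case van: False
      then obtain \<mu> where y: "y = Inl \<mu>" by (cases y) auto
      then have x: "x = Inl \<mu>" using True by (cases x) auto
      have m: "\<mu> \<in> verts \<Gamma>" and ab: "a @ b \<in> lists (S \<mu> \<times> UNIV)"
        using wf y x by (auto simp: wf_syl_simps)
      have "proper (syl (y, a @ b))" using van y m word_value_vertex(1)[OF m ab ab] by simp
      moreover have "u = [] \<or> \<not> clash (last (map syl (rev u))) (syl (y, a @ b))"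
      proof -
        have "clash z (syl (y, a @ b)) = clash z (syl (x, a))" for z using x y by (cases z) simp_all
        then show ?thesis using "3.prems"(3) by (auto simp: reduced_append)
      qed
      moreover have "v = [] \<or> \<not> clash (syl (y, a @ b)) (hd (map syl v))"
      proof -
        have "clash (syl (y, a @ b)) z = clash (syl (y, b)) z" for z using y by (cases z) simp_all
        then show ?thesis using "3.prems"(4) by auto
      qed
      ultimately have "reduced (map syl (rev u) @ syl (y, a @ b) # map syl v)"
        using red(1,2) by (auto simp: reduced_append)
      then show ?thesis using van True eq by simp
    qed
  qed
qed

lemma valid_gens: "valid b \<Longrightarrow> map syl b \<in> lists gens"
  using syls_gens by (simp add: valid_def)

lemma pass_correct:
  "list_all valid bs \<Longrightarrow> list_all valid (pass bs) \<and> map syl (concat bs) \<approx> map syl (concat (pass bs))"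
proof (induction bs rule: pass.induct)
  case (1 b b' bs)
  have b: "valid b" "valid b'" "list_all valid bs" using 1 by auto
  then have wf: "list_all wf_syl (rev b)" "list_all wf_syl b'" by (auto simp: valid_def)
  have m: "reduced (map syl (merge (rev b) b'))" "map syl b @ map syl b' \<approx> map syl (merge (rev b) b')"
    using merge_correct[OF wf] b by (auto simp: valid_def)
  have "map syl (concat (b # b' # bs)) \<approx> map syl (concat (pass (b # b' # bs)))"
    using presented_eq_append[OF m(2)] "1.IH"[OF b(3)] by simp
  then show ?case using m(1) merge_wf[OF wf] "1.IH"[OF b(3)] by (simp add: valid_def)
next
  case "2_1"
  then show ?case by (auto intro: presented_eq.refl)
next
  case ("2_2" b)
  then show ?case using valid_gens[of b] by (auto intro: presented_eq.refl)
qed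

lemma passes_correct:
  assumes "list_all valid bs"
  shows "list_all valid ((pass ^^ k) bs) \<and> map syl (concat bs) \<approx> map syl (concat ((pass ^^ k) bs))"
proof (induction k)
  case 0
  have "map syl (concat bs) \<in> lists gens" using assms valid_gens by (induction bs) auto
  then show ?case using assms by (auto intro: presented_eq.refl)
next
  case (Suc k)
  then show ?case using pass_correct[of "(pass ^^ k) bs"] by (auto intro: presented_eq.trans)
qed

lemma reduced_syllables: "reduced r \<Longrightarrow> \<exists>b. list_all wf_syl b \<and> map syl b = r"
proof (induction r)
  case (Cons x r)
  then obtain b where b: "list_all wf_syl b" "map syl b = r" by auto
  have "\<exists>s. wf_syl s \<and> syl s = x"
  proof (cases x)
    case (Elem \<mu> g)
    then have m: "\<mu> \<in> verts \<Gamma>" and g: "g \<in> carrier (GV \<mu>)" "g \<noteq> \<one>\<^bsub>GV \<mu>\<^esub>" using Cons.prems by auto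
    interpret group "GV \<mu>" using vertex_group[OF m] .
    have "S \<mu> \<subseteq> carrier (GV \<mu>)" "g \<in> generate (GV \<mu>) (S \<mu>)"
      using S[OF m] g(1) by (auto simp: finite_generating_set_def)
    then obtain a where a: "a \<in> lists (S \<mu> \<times> UNIV)" "word_value (GV \<mu>) a = g"
      using generate_word_value by blast
    then have "a \<noteq> []" using g(2) by (auto simp: word_value_def)
    then show ?thesis using a m Elem by (intro exI[of _ "(Inl \<mu>, a)"]) (auto simp: wf_syl_simps)
  next
    case (Stable \<alpha>)
    then show ?thesis using Cons.prems by (intro exI[of _ "(Inr \<alpha>, [undefined])"]) (auto simp: wf_syl_simps)
  qed (use Cons.prems in auto)
  then obtain s where "wf_syl s" "syl s = x" by blast
  then show ?case using b by (intro exI[of _ "s # b"]) auto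
qed simp

text \<open>Each generator and its inverse is translated into a fixed reduced block, which multiplies lengths
by a constant and makes the result valid for every finite generating set.\<close>

lemma word_problem_pi1:
  assumes T: "finite_generating_set (pi1 \<Gamma> bar GV GE \<tau> Tr) T"
  shows "word_problem_in_time (pi1 \<Gamma> bar GV GE \<tau> Tr) T (\<lambda>n. ln (real n) * f n)"
proof -
  let ?P = "pi1 \<Gamma> bar GV GE \<tau> Tr"
  interpret P: group ?P by (rule group_pi1)
  define cl where "cl = word_class gens rels"
  have carr: "carrier ?P = cl ` lists gens" by (simp add: pi1_def carrier_presented cl_def)
  have mult: "cl u \<otimes>\<^bsub>?P\<^esub> cl v = cl (u @ v)" if "u \<in> lists gens" "v \<in> lists gens" for u v
    using mult_presented[OF that] by (simp add: pi1_def cl_def)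
  have one: "\<one>\<^bsub>?P\<^esub> = cl []" by (simp add: pi1_def one_presented cl_def)
  have Tc: "T \<subseteq> carrier ?P" "finite T" using T by (auto simp: finite_generating_set_def)
  define val where "val x = (if snd x then fst x else inv\<^bsub>?P\<^esub> (fst x))" for x
  have val_carrier: "val x \<in> carrier ?P" if "x \<in> T \<times> (UNIV :: bool set)" for x using that Tc by (auto simp: val_def)
  have "\<exists>b. valid b \<and> cl (map syl b) = val x" if "x \<in> T \<times> UNIV" for x
  proof -
    obtain w where w: "w \<in> lists gens" "val x = cl w" using val_carrier[OF \<open>x \<in> T \<times> UNIV\<close>] carr by auto
    obtain r where r: "reduced r" "w \<approx> r" using reduced_form[OF w(1)] .
    obtain b where "list_all wf_syl b" "map syl b = r" using reduced_syllables[OF r(1)] by auto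
    moreover have "cl w = cl r" unfolding cl_def word_class_eq[OF w(1)] by (rule r(2))
    ultimately show ?thesis using r w by (auto simp: valid_def)
  qed
  then obtain Bl where Bl: "\<And>x. x \<in> T \<times> UNIV \<Longrightarrow> valid (Bl x)" "\<And>x. x \<in> T \<times> UNIV \<Longrightarrow> cl (map syl (Bl x)) = val x"
    by metis
  have blocks_gens: "map syl (concat (map Bl w)) \<in> lists gens" if "w \<in> lists (T \<times> UNIV)" for w
    using that by (induction w) (auto dest!: valid_gens[OF Bl(1)])
  have word_val: "word_value ?P w = cl (map syl (concat (map Bl w)))" if "w \<in> lists (T \<times> UNIV)" for w
    using that
  proof (induction w)
    case Nil
    then show ?case by (simp add: word_value_def one)
  next
    case (Cons x w)
    then have x: "x \<in> T \<times> UNIV" "w \<in> lists (T \<times> UNIV)" by auto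
    have "word_value ?P (x # w) = val x \<otimes>\<^bsub>?P\<^esub> word_value ?P w"
      by (cases x) (simp add: word_value_def val_def)
    also have "\<dots> = cl (map syl (Bl x)) \<otimes>\<^bsub>?P\<^esub> cl (map syl (concat (map Bl w)))"
      using Cons.IH Bl(2)[OF x(1)] by simp
    also have "\<dots> = cl (map syl (concat (map Bl (x # w))))"
      using mult[OF valid_gens[OF Bl(1)[OF x(1)]] blocks_gens[OF x(2)]] by simp
    finally show ?case .
  qed
  show ?thesis unfolding word_problem_in_time_def
  proof (rule decidable_by_merging[where Bl = Bl])
    show "finite (T \<times> (UNIV :: bool set))" using Tc by simp
    show "list_all wf_syl (Bl x)" if "x \<in> T \<times> UNIV" for x using Bl(1)[OF that] by (simp add: valid_def)
    show "(\<lambda>n. real (2 * total_cost c n + 2 * n + 2)) \<preceq> (\<lambda>n. ln (real n) * f n)" for c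
      using log_factor_preceq[OF f, of c sim_factor C] by (simp only: total_cost_def round_cost_def cost_def)
    fix w k assume w: "w \<in> lists (T \<times> UNIV)" and k: "length ((pass ^^ k) (map Bl w)) \<le> 1"
    let ?out = "(pass ^^ k) (map Bl w)"
    have "list_all valid (map Bl w)" using w Bl(1) by (auto simp: list_all_iff)
    then have out: "list_all valid ?out" "map syl (concat (map Bl w)) \<approx> map syl (concat ?out)"
      using passes_correct by auto
    have red: "reduced (map syl (concat ?out))"
      using out(1) k by (cases ?out) (auto simp: valid_def)
    have "map syl (concat ?out) \<approx> [] \<longleftrightarrow> concat ?out = []"
    proof
      assume "map syl (concat ?out) \<approx> []"
      from reduced_trivial[OF red this] show "concat ?out = []" by (simp only: map_is_Nil_conv)
    next
      assume "concat ?out = []"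
      then show "map syl (concat ?out) \<approx> []" by (simp only: list.map(1)) (rule presented_eq.refl, simp)
    qed
    moreover have "word_value ?P w = \<one>\<^bsub>?P\<^esub> \<longleftrightarrow> map syl (concat (map Bl w)) \<approx> []"
      unfolding word_val[OF w] one cl_def using blocks_gens[OF w] by (rule word_class_eq)
    moreover have "map syl (concat (map Bl w)) \<approx> [] \<longleftrightarrow> map syl (concat ?out) \<approx> []"
      using out(2) by (blast intro: presented_eq.trans presented_eq.sym)
    ultimately show "w \<in> word_problem ?P T \<longleftrightarrow> concat ?out = []" using w by (simp add: word_problem_def)
  qed
qed

end

theorem proposition1p3:
  fixes \<Gamma> :: "('v, 'e) pre_digraph"
    and bar :: "'e \<Rightarrow> 'e"
    and GV :: "'v \<Rightarrow> 'g monoid"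
    and GE :: "'e \<Rightarrow> 'h monoid"
    and \<tau> :: "'e \<Rightarrow> 'h \<Rightarrow> 'g"
    and Tr :: "'e set"
    and f :: "nat \<Rightarrow> real"
  assumes "graph_of_groups \<Gamma> bar GV GE \<tau>"
    and "bidirected_spanning_tree \<Gamma> bar Tr"
    and "\<And>\<alpha>. \<alpha> \<in> arcs \<Gamma> \<Longrightarrow> trivial_group (GE \<alpha>)"
    and "convex_nat f"
    and "\<And>n. real n \<le> f n"
    and "\<And>\<mu>. \<mu> \<in> verts \<Gamma> \<Longrightarrow>
           \<exists>S. finite_generating_set (GV \<mu>) S \<and> word_problem_in_time (GV \<mu>) S f"
  shows "(\<exists>T. finite_generating_set (pi1 \<Gamma> bar GV GE \<tau> Tr) T) \<and>
         (\<forall>T. finite_generating_set (pi1 \<Gamma> bar GV GE \<tau> Tr) T \<longrightarrow>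
            word_problem_in_time (pi1 \<Gamma> bar GV GE \<tau> Tr) T (\<lambda>n. ln (real n) * f n))"
proof -
  have "\<forall>\<mu> \<in> verts \<Gamma>. \<exists>S M g. finite_generating_set (GV \<mu>) S \<and> wf_tm (S \<times> UNIV) M \<and> g \<preceq> f \<and>
      tm_decides_within (S \<times> UNIV) M (word_problem (GV \<mu>) S) g"
    using assms(6) unfolding word_problem_in_time_def decidable_in_time_def by blast
  then obtain S M g where SMg: "\<And>\<mu>. \<mu> \<in> verts \<Gamma> \<Longrightarrow> finite_generating_set (GV \<mu>) (S \<mu>)"
    "\<And>\<mu>. \<mu> \<in> verts \<Gamma> \<Longrightarrow> wf_tm (S \<mu> \<times> UNIV) (M \<mu>)" "\<And>\<mu>. \<mu> \<in> verts \<Gamma> \<Longrightarrow> g \<mu> \<preceq> f"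
    "\<And>\<mu>. \<mu> \<in> verts \<Gamma> \<Longrightarrow> tm_decides_within (S \<mu> \<times> UNIV) (M \<mu>) (word_problem (GV \<mu>) (S \<mu>)) (g \<mu>)"
    by metis
  interpret trivial_edge_groups \<Gamma> bar GV GE \<tau> Tr
    using assms(1-3) by (simp add: trivial_edge_groups_def trivial_edge_groups_axioms_def bidirected_spanning_tree_def)
  obtain C :: nat where C: "0 < C"
    "\<And>\<mu> n. \<mu> \<in> verts \<Gamma> \<Longrightarrow> g \<mu> n \<le> real C * f (C * n + C) + real C * real n + real C"
    using preceq_uniform[where g = g, OF finite_verts assms(4,5) SMg(3)] by blast
  interpret vertex_machines \<Gamma> bar GV GE \<tau> Tr S M f C
  proof
    fix \<mu> assume m: "\<mu> \<in> verts \<Gamma>"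
    show "tm_decides_within (S \<mu> \<times> UNIV) (M \<mu>) (word_problem (GV \<mu>) (S \<mu>))
      (\<lambda>n. real C * f (C * n + C) + real C * real n + real C)"
      using SMg(4)[OF m] C(2)[OF m] unfolding tm_decides_within_def by (meson order_trans)
  qed (use SMg assms(4,5) C(1) in auto)
  show ?thesis using pi1_finitely_generated[OF SMg(1)] word_problem_pi1 by blast
qed

end
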